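(* Let $q$ be a prime power, let $n\ge 2$ be an integer, and let $v=\frac{q^{n+1}-1}{q-1}$ denote the number of points of $\mathrm{PG}(n,q)$. \begin{enumerate} \item If $n=3\cdot 2^{i}-1$ for some integer $i\ge 1$, then $$c_n\,\frac{1}{q}\,v^{\frac{4}{3}+\frac{1}{3n}} \leq \alpha'(\mathrm{PG}(n,q)),$$ where $c_n$ is a constant depending only on $n$ and satisfying $\frac{1}{2^{7/5}}\leq c_n< \frac{1}{2^{4/3}}$. \item For every integer $n\geq 2$, $$\psi'(\mathrm{PG}(n,q))\leq\frac{1}{q}\,v^{\frac{3}{2}}.$$ \end{enumerate}
   Context: $\mathrm{PG}(n,q)$ is the $n$-dimensional projective space over $\mathrm{GF}(q)$, viewed as a linear space whose points and lines are the $1$- and $2$-dimensional subspaces of $\mathrm{GF}(q)^{n+1}$. A coloring with $k$ colors is a map from the set of lines to $\{1,\dots,k\}$ (all $k$ colors being used). A coloring is proper if any two distinct intersecting lines receive different colors. A coloring is complete if for every pair of distinct colors $c_1,c_2$ there is a point lying on a line of color $c_1$ and on a line of color $c_2$. The achromatic index $\alpha'(\mathrm{PG}(n,q))$ is the largest $k$ such that there is a proper and complete coloring with $k$ colors; the pseudoachromatic index $\psi'(\mathrm{PG}(n,q))$ is the largest $k$ such that there is a complete (not necessarily proper) coloring with $k$ colors. *)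

theory Defs
  imports Complex_Main "HOL-Number_Theory.Prime_Powers" "HOL-Algebra.Module"
begin

text \<open>
  The ring multiplication and unit are record fields that a module does not use, so they are
  left unspecified.
\<close>

definition coord_space :: "('a, 'b) ring_scheme \<Rightarrow> nat \<Rightarrow> ('a, nat \<Rightarrow> 'a) module" where
  "coord_space F m =
     \<lparr>carrier = {..<m} \<rightarrow>\<^sub>E carrier F,
      mult = undefined,
      one = undefined,
      zero = (\<lambda>i\<in>{..<m}. \<zero>\<^bsub>F\<^esub>),
      add = (\<lambda>u w. \<lambda>i\<in>{..<m}. u i \<oplus>\<^bsub>F\<^esub> w i),
      smult = (\<lambda>a u. \<lambda>i\<in>{..<m}. a \<otimes>\<^bsub>F\<^esub> u i)\<rparr>"

definition lin_comb ::
  "('a, 'v, 'm) module_scheme \<Rightarrow> nat \<Rightarrow> (nat \<Rightarrow> 'a) \<Rightarrow> (nat \<Rightarrow> 'v) \<Rightarrow> 'v" where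
  "lin_comb M d a b = (\<Oplus>\<^bsub>M\<^esub>j\<in>{..<d}. a j \<odot>\<^bsub>M\<^esub> b j)"

definition lin_indep ::
  "('a, 'b) ring_scheme \<Rightarrow> ('a, 'v, 'm) module_scheme \<Rightarrow> nat \<Rightarrow> (nat \<Rightarrow> 'v) \<Rightarrow> bool" where
  "lin_indep F M d b \<longleftrightarrow>
     (\<forall>a \<in> {..<d} \<rightarrow> carrier F. lin_comb M d a b = \<zero>\<^bsub>M\<^esub> \<longrightarrow> (\<forall>j<d. a j = \<zero>\<^bsub>F\<^esub>))"

definition lin_span ::
  "('a, 'b) ring_scheme \<Rightarrow> ('a, 'v, 'm) module_scheme \<Rightarrow> nat \<Rightarrow> (nat \<Rightarrow> 'v) \<Rightarrow> 'v set" where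
  "lin_span F M d b = {lin_comb M d a b | a. a \<in> {..<d} \<rightarrow> carrier F}"

definition subspace_of_dim ::
  "('a, 'b) ring_scheme \<Rightarrow> ('a, 'v, 'm) module_scheme \<Rightarrow> nat \<Rightarrow> 'v set \<Rightarrow> bool" where
  "subspace_of_dim F M d W \<longleftrightarrow>
     submodule W F M \<and>
     (\<exists>b \<in> {..<d} \<rightarrow> W. lin_indep F M d b \<and> lin_span F M d b = W)"

definition pg_points :: "('a, 'b) ring_scheme \<Rightarrow> nat \<Rightarrow> (nat \<Rightarrow> 'a) set set" where
  "pg_points F n = {p. subspace_of_dim F (coord_space F (n + 1)) 1 p}"

definition pg_lines :: "('a, 'b) ring_scheme \<Rightarrow> nat \<Rightarrow> (nat \<Rightarrow> 'a) set set" where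
  "pg_lines F n = {l. subspace_of_dim F (coord_space F (n + 1)) 2 l}"

text \<open>
  Below, \<open>P\<close> and \<open>L\<close> are the points and lines of a linear space in which a point \<open>p\<close> lies on a
  line \<open>l\<close> iff \<open>p \<subseteq> l\<close>, as in a projective space of subspaces.
\<close>

definition line_coloring :: "'v set set \<Rightarrow> nat \<Rightarrow> ('v set \<Rightarrow> nat) \<Rightarrow> bool" where
  "line_coloring L k f \<longleftrightarrow> f ` L = {1..k}"

definition proper_coloring :: "'v set set \<Rightarrow> 'v set set \<Rightarrow> ('v set \<Rightarrow> nat) \<Rightarrow> bool" where
  "proper_coloring P L f \<longleftrightarrow>
     (\<forall>l1\<in>L. \<forall>l2\<in>L. l1 \<noteq> l2 \<and> (\<exists>p\<in>P. p \<subseteq> l1 \<and> p \<subseteq> l2) \<longrightarrow> f l1 \<noteq> f l2)"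

definition complete_coloring ::
  "'v set set \<Rightarrow> 'v set set \<Rightarrow> nat \<Rightarrow> ('v set \<Rightarrow> nat) \<Rightarrow> bool" where
  "complete_coloring P L k f \<longleftrightarrow>
     (\<forall>c1\<in>{1..k}. \<forall>c2\<in>{1..k}. c1 \<noteq> c2 \<longrightarrow>
        (\<exists>p\<in>P. (\<exists>l1\<in>L. p \<subseteq> l1 \<and> f l1 = c1) \<and> (\<exists>l2\<in>L. p \<subseteq> l2 \<and> f l2 = c2)))"

definition achromatic_index :: "'v set set \<Rightarrow> 'v set set \<Rightarrow> nat" where
  "achromatic_index P L =
     (GREATEST k. \<exists>f. line_coloring L k f \<and> proper_coloring P L f \<and> complete_coloring P L k f)"

definition pseudoachromatic_index :: "'v set set \<Rightarrow> 'v set set \<Rightarrow> nat" where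
  "pseudoachromatic_index P L =
     (GREATEST k. \<exists>f. line_coloring L k f \<and> complete_coloring P L k f)"

definition pg_achromatic_index :: "('a, 'b) ring_scheme \<Rightarrow> nat \<Rightarrow> nat" where
  "pg_achromatic_index F n = achromatic_index (pg_points F n) (pg_lines F n)"

definition pg_pseudoachromatic_index :: "('a, 'b) ring_scheme \<Rightarrow> nat \<Rightarrow> nat" where
  "pg_pseudoachromatic_index F n = pseudoachromatic_index (pg_points F n) (pg_lines F n)"

definition pg_order :: "nat \<Rightarrow> nat \<Rightarrow> real" where
  "pg_order n q = (real q ^ (n + 1) - 1) / (real q - 1)"

text \<open>
  The constant of the lower bound has to be chosen before the field, so fields must be quantified
  inside the formula. The carriers are therefore taken in the fixed infinite type \<open>nat\<close>, which
  contains an isomorphic copy of every finite field.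
\<close>

definition is_GF :: "nat \<Rightarrow> nat ring \<Rightarrow> bool" where
  "is_GF q F \<longleftrightarrow> field F \<and> finite (carrier F) \<and> card (carrier F) = q"

end

theory Submission
  imports Defs "HOL-Library.Nat_Bijection"
begin

text \<open>
  Upper bound. Let \<open>r = (v - 1) / q\<close> be the number of lines through a point. If a colour class covers
  the point set \<open>X\<close>, completeness gives \<open>k \<le> |X| r\<close>. Summing over the colours, where each of the
  \<open>v r\<close> flags is counted at most once, gives \<open>k\<^sup>2 \<le> v r\<^sup>2\<close>.

  Lower bound. Put \<open>m = 2 ^ i\<close> and \<open>n + 1 = 3 m\<close>. Since \<open>v \<le> 2 q ^ n\<close>, it suffices to find
  \<open>q ^ (4 m - 2)\<close> pairwise disjoint classes, each consisting of pairwise skew lines, such that any two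
  classes cover a common point: the remaining lines can then be coloured greedily. For \<open>m = 1\<close> take
  single lines of a projective plane. To pass from \<open>m\<close> to \<open>2 m\<close>, let \<open>E\<close> be the quadratic extension of
  \<open>F = GF(q)\<close> and view \<open>F ^ (6 m)\<close> as \<open>E ^ (3 m)\<close>. In each \<open>E\<close>-line, which is a \<open>PG(3,q)\<close>, the lines that
  are not \<open>E\<close>-points contain \<open>q\<^sup>2\<close> disjoint spreads (part of a packing in the style of Denniston).
  Replacing every \<open>E\<close>-line of a class by one of these spreads turns it into \<open>q\<^sup>2\<close> classes that cover the
  same points, and an \<open>F\<close>-line determines the \<open>E\<close>-line that it spans. This gives
  \<open>(q\<^sup>2) ^ (4 m - 2) * q\<^sup>2 = q ^ (8 m - 2)\<close> classes.
\<close>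

section \<open>Points and lines of a vector space\<close>

text \<open>Replacing lines by spreads preserves the points covered by a class, so the condition
  that any two classes meet is inherited; the difficulty is to keep the classes disjoint. This is
  why points over \<open>E\<close> are avoided: such a line over \<open>F\<close> lies on many lines
  over \<open>E\<close> and could be produced more than once, whereas any other line over
  \<open>F\<close> contains two vectors that are independent over \<open>E\<close>. In an
  \<open>E\<close>-line, viewed as pairs over \<open>E\<close>, the complements of x = 0 are the
  graphs of the \<open>F\<close>-linear maps x -> P x + H \<psi>(x) for one fixed \<psi> that is not
  \<open>E\<close>-linear, and H = 0 gives exactly the points over \<open>E\<close>. Every H outside
  \<open>F\<close> is e h for one e in \<theta> + F and one nonzero h in \<open>F\<close>; each of
  the q values of e supplies the graphs for q spreads. If there are q^d classes, doubling the
  dimension yields q^(2 d + 2) of them, and d = 2 for the plane; this solves to d = 4 m - 2. The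
  exponent of the theorem is tuned to it: n (4/3 + 1/(3 n)) = 4 m - 1, and the surplus factor q
  cancels 1/q.\<close>

definition comb2 :: "('a, 'v, 'm) module_scheme \<Rightarrow> 'a \<Rightarrow> 'a \<Rightarrow> 'v \<Rightarrow> 'v \<Rightarrow> 'v" where
  "comb2 M a b u w = a \<odot>\<^bsub>M\<^esub> u \<oplus>\<^bsub>M\<^esub> b \<odot>\<^bsub>M\<^esub> w"

definition span2 ::
  "('a, 'b) ring_scheme \<Rightarrow> ('a, 'v, 'm) module_scheme \<Rightarrow> 'v \<Rightarrow> 'v \<Rightarrow> 'v set" where
  "span2 F M u w = {comb2 M a b u w | a b. a \<in> carrier F \<and> b \<in> carrier F}"

definition indep2 ::
  "('a, 'b) ring_scheme \<Rightarrow> ('a, 'v, 'm) module_scheme \<Rightarrow> 'v \<Rightarrow> 'v \<Rightarrow> bool" where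
  "indep2 F M u w \<longleftrightarrow>
     (\<forall>a\<in>carrier F. \<forall>b\<in>carrier F. comb2 M a b u w = \<zero>\<^bsub>M\<^esub> \<longrightarrow> a = \<zero>\<^bsub>F\<^esub> \<and> b = \<zero>\<^bsub>F\<^esub>)"

definition vline :: "('a, 'b) ring_scheme \<Rightarrow> ('a, 'v, 'm) module_scheme \<Rightarrow> 'v set \<Rightarrow> bool" where
  "vline F M l \<longleftrightarrow>
     (\<exists>u\<in>carrier M. \<exists>w\<in>carrier M. indep2 F M u w \<and> l = span2 F M u w)"

definition span1 :: "('a, 'b) ring_scheme \<Rightarrow> ('a, 'v, 'm) module_scheme \<Rightarrow> 'v \<Rightarrow> 'v set" where
  "span1 F M u = {a \<odot>\<^bsub>M\<^esub> u | a. a \<in> carrier F}"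

locale vecsp = R?: field F + module F M for F (structure) and M
begin

lemma comb2_closed [simp, intro]:
  "a \<in> carrier F \<Longrightarrow> b \<in> carrier F \<Longrightarrow> u \<in> carrier M \<Longrightarrow> w \<in> carrier M
    \<Longrightarrow> comb2 M a b u w \<in> carrier M"
  by (simp add: comb2_def)

lemma comb2_add:
  assumes "a \<in> carrier F" "b \<in> carrier F" "c \<in> carrier F" "d \<in> carrier F"
    "u \<in> carrier M" "w \<in> carrier M"
  shows "comb2 M a b u w \<oplus>\<^bsub>M\<^esub> comb2 M c d u w = comb2 M (a \<oplus> c) (b \<oplus> d) u w"
  using assms by (simp add: comb2_def smult_l_distr M.a_ac)

lemma comb2_smult:
  assumes "a \<in> carrier F" "b \<in> carrier F" "c \<in> carrier F" "u \<in> carrier M" "w \<in> carrier M"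
  shows "c \<odot>\<^bsub>M\<^esub> comb2 M a b u w = comb2 M (c \<otimes> a) (c \<otimes> b) u w"
  using assms by (simp add: comb2_def smult_r_distr smult_assoc1)

lemma comb2_comb2:
  assumes "a \<in> carrier F" "b \<in> carrier F" "c \<in> carrier F" "d \<in> carrier F"
    "c' \<in> carrier F" "d' \<in> carrier F" "u \<in> carrier M" "w \<in> carrier M"
  shows "comb2 M a b (comb2 M c d u w) (comb2 M c' d' u w)
    = comb2 M (a \<otimes> c \<oplus> b \<otimes> c') (a \<otimes> d \<oplus> b \<otimes> d') u w"
proof -
  have "comb2 M a b (comb2 M c d u w) (comb2 M c' d' u w)
    = a \<odot>\<^bsub>M\<^esub> comb2 M c d u w \<oplus>\<^bsub>M\<^esub> b \<odot>\<^bsub>M\<^esub> comb2 M c' d' u w"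
    unfolding comb2_def[of M a b] ..
  then show ?thesis using assms by (simp add: comb2_smult comb2_add)
qed

lemma comb2_minus:
  assumes "a \<in> carrier F" "b \<in> carrier F" "u \<in> carrier M" "w \<in> carrier M"
  shows "\<ominus>\<^bsub>M\<^esub> comb2 M a b u w = comb2 M (\<ominus> a) (\<ominus> b) u w"
  using assms by (simp add: comb2_def smult_l_minus M.minus_add)

lemma comb2_unit [simp]:
  assumes "u \<in> carrier M" "w \<in> carrier M"
  shows "comb2 M \<one> \<zero> u w = u" "comb2 M \<zero> \<one> u w = w" "comb2 M \<zero> \<zero> u w = \<zero>\<^bsub>M\<^esub>"
  using assms by (auto simp: comb2_def)

lemma comb2_inject:
  assumes "indep2 F M u w" "comb2 M a b u w = comb2 M c d u w"
    "a \<in> carrier F" "b \<in> carrier F" "c \<in> carrier F" "d \<in> carrier F"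
    "u \<in> carrier M" "w \<in> carrier M"
  shows "a = c \<and> b = d"
proof -
  have "comb2 M (a \<oplus> \<ominus> c) (b \<oplus> \<ominus> d) u w
      = comb2 M a b u w \<oplus>\<^bsub>M\<^esub> (\<ominus>\<^bsub>M\<^esub> comb2 M c d u w)"
    using assms(3-) by (simp add: comb2_add comb2_minus)
  also have "\<dots> = \<zero>\<^bsub>M\<^esub>"
    using assms by (simp add: M.r_neg)
  finally have "a \<oplus> \<ominus> c = \<zero> \<and> b \<oplus> \<ominus> d = \<zero>"
    using assms(1,3-) unfolding indep2_def by blast
  then show ?thesis
    using assms R.minus_equality by fastforce
qed

lemma indep2_nonzero:
  assumes "indep2 F M u w" "u \<in> carrier M" "w \<in> carrier M"
  shows "u \<noteq> \<zero>\<^bsub>M\<^esub>" "w \<noteq> \<zero>\<^bsub>M\<^esub>"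
  using assms(1) comb2_unit[OF assms(2,3)] R.zero_not_one R.one_closed R.zero_closed
  unfolding indep2_def by metis+

lemma smult_eq_zero:
  assumes "a \<in> carrier F" "u \<in> carrier M" "a \<odot>\<^bsub>M\<^esub> u = \<zero>\<^bsub>M\<^esub>"
  shows "a = \<zero> \<or> u = \<zero>\<^bsub>M\<^esub>"
proof (rule disjCI)
  assume u: "u \<noteq> \<zero>\<^bsub>M\<^esub>"
  show "a = \<zero>"
  proof (rule ccontr)
    assume "a \<noteq> \<zero>"
    then have a: "a \<in> Units F" using assms(1) field_Units by auto
    then have "u = inv a \<odot>\<^bsub>M\<^esub> (a \<odot>\<^bsub>M\<^esub> u)"
      using assms(1,2) R.Units_inv_closed R.Units_l_inv by (simp flip: smult_assoc1)
    then show False using assms(3) u a by simp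
  qed
qed

lemma smult_inject:
  assumes "a \<in> carrier F" "b \<in> carrier F" "u \<in> carrier M" "u \<noteq> \<zero>\<^bsub>M\<^esub>"
    "a \<odot>\<^bsub>M\<^esub> u = b \<odot>\<^bsub>M\<^esub> u"
  shows "a = b"
proof -
  have "(a \<oplus> \<ominus> b) \<odot>\<^bsub>M\<^esub> u = \<zero>\<^bsub>M\<^esub>"
    using assms by (simp add: smult_l_distr smult_l_minus M.r_neg)
  then have "a \<oplus> \<ominus> b = \<zero>"
    using smult_eq_zero[of "a \<oplus> \<ominus> b" u] assms by auto
  then show ?thesis
    using assms R.minus_equality by fastforce
qed

lemma smult_in_span1:
  assumes "v \<in> span1 F M u" "v \<noteq> \<zero>\<^bsub>M\<^esub>" "u \<in> carrier M"
  shows "span1 F M v = span1 F M u"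
proof -
  from assms obtain a where a: "a \<in> carrier F" "v = a \<odot>\<^bsub>M\<^esub> u" by (auto simp: span1_def)
  then have "a \<noteq> \<zero>" using assms by auto
  then have aU: "a \<in> Units F" using a field_Units by auto
  show ?thesis
  proof
    show "span1 F M v \<subseteq> span1 F M u"
      using a assms by (auto simp: span1_def simp flip: smult_assoc1)
    show "span1 F M u \<subseteq> span1 F M v"
    proof
      fix x assume "x \<in> span1 F M u"
      then obtain b where b: "b \<in> carrier F" "x = b \<odot>\<^bsub>M\<^esub> u" by (auto simp: span1_def)
      have "x = (b \<otimes> inv a) \<odot>\<^bsub>M\<^esub> v"
        using a aU b assms by (simp add: m_assoc flip: smult_assoc1)
      then show "x \<in> span1 F M v" using aU b by (auto simp: span1_def)
    qed
  qed
qed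

lemma span1_closed: "u \<in> carrier M \<Longrightarrow> span1 F M u \<subseteq> carrier M"
  by (auto simp: span1_def)

lemma in_span1: "u \<in> carrier M \<Longrightarrow> u \<in> span1 F M u"
  by (force simp: span1_def intro: exI[of _ \<one>])

lemma span2_closed: "u \<in> carrier M \<Longrightarrow> w \<in> carrier M \<Longrightarrow> span2 F M u w \<subseteq> carrier M"
  by (auto simp: span2_def)

lemma in_span2:
  assumes "u \<in> carrier M" "w \<in> carrier M"
  shows "u \<in> span2 F M u w" "w \<in> span2 F M u w"
  unfolding span2_def using comb2_unit[OF assms, symmetric] by blast+

lemma span2_mono:
  assumes "u \<in> carrier M" "w \<in> carrier M" "v1 \<in> span2 F M u w" "v2 \<in> span2 F M u w"
  shows "span2 F M v1 v2 \<subseteq> span2 F M u w"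
proof
  fix x assume "x \<in> span2 F M v1 v2"
  then obtain a b where x: "x = comb2 M a b v1 v2" "a \<in> carrier F" "b \<in> carrier F"
    by (auto simp: span2_def)
  from assms obtain c d c' d' where "c \<in> carrier F" "d \<in> carrier F" "c' \<in> carrier F"
    "d' \<in> carrier F" "v1 = comb2 M c d u w" "v2 = comb2 M c' d' u w"
    by (auto simp: span2_def)
  then show "x \<in> span2 F M u w"
    using x assms(1,2) by (auto simp: comb2_comb2 span2_def)
qed

lemma card_span1:
  assumes "u \<in> carrier M" "u \<noteq> \<zero>\<^bsub>M\<^esub>"
  shows "card (span1 F M u) = card (carrier F)"
proof -
  have "span1 F M u = (\<lambda>a. a \<odot>\<^bsub>M\<^esub> u) ` carrier F" by (auto simp: span1_def)
  moreover have "inj_on (\<lambda>a. a \<odot>\<^bsub>M\<^esub> u) (carrier F)"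
    using assms by (auto intro!: inj_onI smult_inject)
  ultimately show ?thesis by (simp add: card_image)
qed

lemma card_span2:
  assumes "u \<in> carrier M" "w \<in> carrier M" "indep2 F M u w"
  shows "card (span2 F M u w) = card (carrier F) ^ 2"
proof -
  have "span2 F M u w = (\<lambda>(a, b). comb2 M a b u w) ` (carrier F \<times> carrier F)"
    by (auto simp: span2_def)
  moreover have "inj_on (\<lambda>(a, b). comb2 M a b u w) (carrier F \<times> carrier F)"
    using comb2_inject[OF assms(3)] assms by (auto intro!: inj_onI)
  ultimately show ?thesis by (simp add: card_image card_cartesian_product power2_eq_square)
qed

lemma finite_span2: "finite (carrier F) \<Longrightarrow> finite (span2 F M u w)"
proof -
  assume "finite (carrier F)"
  moreover have "span2 F M u w = (\<lambda>(a, b). comb2 M a b u w) ` (carrier F \<times> carrier F)"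
    by (auto simp: span2_def)
  ultimately show ?thesis by simp
qed

text \<open>One inclusion is clear, and both sides have \<open>card (carrier F) ^ 2\<close>
  elements; counting replaces the exchange argument, which is why finiteness is assumed.\<close>

lemma vline_eq_span2:
  assumes "finite (carrier F)" "vline F M l" "v1 \<in> l" "v2 \<in> l" "indep2 F M v1 v2"
  shows "l = span2 F M v1 v2"
proof -
  from assms(2) obtain u w where uw: "u \<in> carrier M" "w \<in> carrier M" "indep2 F M u w"
    "l = span2 F M u w" by (auto simp: vline_def)
  have v: "v1 \<in> carrier M" "v2 \<in> carrier M" using assms(3,4) span2_closed uw by auto
  have "span2 F M v1 v2 \<subseteq> l"
    using span2_mono uw assms by simp
  moreover have "card (span2 F M v1 v2) = card l"
    using card_span2 uw v assms(5) by simp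
  ultimately show ?thesis
    using finite_span2 assms(1) uw by (metis card_subset_eq)
qed

lemma vline_eqI:
  assumes "finite (carrier F)" "vline F M l" "vline F M l'" "indep2 F M v1 v2"
    "v1 \<in> l" "v2 \<in> l" "v1 \<in> l'" "v2 \<in> l'"
  shows "l = l'"
  using vline_eq_span2[OF assms(1,2)] vline_eq_span2[OF assms(1,3)] assms by metis

lemma indep2I_notin_span1:
  assumes "u \<in> carrier M" "w \<in> carrier M" "u \<noteq> \<zero>\<^bsub>M\<^esub>" "w \<notin> span1 F M u"
  shows "indep2 F M u w"
  unfolding indep2_def
proof (intro ballI impI)
  fix a b assume ab: "a \<in> carrier F" "b \<in> carrier F" "comb2 M a b u w = \<zero>\<^bsub>M\<^esub>"
  have b0: "b = \<zero>"
  proof (rule ccontr)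
    assume "b \<noteq> \<zero>"
    then have bU: "b \<in> Units F" using ab field_Units by auto
    have "\<zero>\<^bsub>M\<^esub> = inv b \<odot>\<^bsub>M\<^esub> comb2 M a b u w"
      using ab R.Units_inv_closed[OF bU] by simp
    also have "\<dots> = (inv b \<otimes> a) \<odot>\<^bsub>M\<^esub> u \<oplus>\<^bsub>M\<^esub> w"
      using ab(1,2) R.Units_inv_closed[OF bU] R.Units_l_inv[OF bU] assms
      by (simp add: comb2_smult) (simp add: comb2_def)
    finally have "w = \<ominus>\<^bsub>M\<^esub> ((inv b \<otimes> a) \<odot>\<^bsub>M\<^esub> u)"
      using ab R.Units_inv_closed[OF bU] assms M.minus_equality[of w "(inv b \<otimes> a) \<odot>\<^bsub>M\<^esub> u"]
      by (simp add: M.a_comm)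
    also have "\<dots> = (\<ominus> (inv b \<otimes> a)) \<odot>\<^bsub>M\<^esub> u"
      using ab bU assms by (simp add: smult_l_minus)
    finally show False using assms(4) ab bU by (auto simp: span1_def)
  qed
  then have "a \<odot>\<^bsub>M\<^esub> u = \<zero>\<^bsub>M\<^esub>" using ab assms by (simp add: comb2_def)
  then show "a = \<zero> \<and> b = \<zero>" using smult_eq_zero ab assms b0 by blast
qed

section \<open>Subspaces of dimension one and two in terms of explicit spans\<close>

lemma lin_comb_1:
  assumes "a 0 \<in> carrier F" "b 0 \<in> carrier M"
  shows "lin_comb M 1 a b = a 0 \<odot>\<^bsub>M\<^esub> b 0"
  using assms by (simp add: lin_comb_def lessThan_Suc)

lemma lin_comb_2:
  assumes "a 0 \<in> carrier F" "b 0 \<in> carrier M" "a 1 \<in> carrier F" "b 1 \<in> carrier M"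
  shows "lin_comb M 2 a b = comb2 M (a 0) (a 1) (b 0) (b 1)"
proof -
  have "{..<2::nat} = {0, 1}" by auto
  then show ?thesis using assms by (simp add: lin_comb_def comb2_def)
qed

lemma submodule_span2:
  assumes "u \<in> carrier M" "w \<in> carrier M"
  shows "submodule (span2 F M u w) F M"
proof (rule submoduleI)
  show "span2 F M u w \<subseteq> carrier M" using assms by (rule span2_closed)
  show "\<zero>\<^bsub>M\<^esub> \<in> span2 F M u w"
    unfolding span2_def using comb2_unit(3)[OF assms] R.zero_closed by force
next
  fix x assume "x \<in> span2 F M u w"
  then obtain a b where "a \<in> carrier F" "b \<in> carrier F" "x = comb2 M a b u w"
    by (auto simp: span2_def)
  moreover from this have "\<ominus>\<^bsub>M\<^esub> x = comb2 M (\<ominus> a) (\<ominus> b) u w"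
    using assms comb2_minus by simp
  ultimately show "\<ominus>\<^bsub>M\<^esub> x \<in> span2 F M u w"
    using R.a_inv_closed unfolding span2_def by blast
next
  fix x y assume "x \<in> span2 F M u w" "y \<in> span2 F M u w"
  then obtain a b c d where "a \<in> carrier F" "b \<in> carrier F" "x = comb2 M a b u w"
    "c \<in> carrier F" "d \<in> carrier F" "y = comb2 M c d u w"
    by (auto simp: span2_def)
  moreover from this have "x \<oplus>\<^bsub>M\<^esub> y = comb2 M (a \<oplus> c) (b \<oplus> d) u w"
    using assms comb2_add by simp
  ultimately show "x \<oplus>\<^bsub>M\<^esub> y \<in> span2 F M u w"
    using R.add.m_closed unfolding span2_def by blast
next
  fix c x assume c: "c \<in> carrier F" and "x \<in> span2 F M u w"
  then obtain a b where "a \<in> carrier F" "b \<in> carrier F" "x = comb2 M a b u w"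
    by (auto simp: span2_def)
  moreover from this have "c \<odot>\<^bsub>M\<^esub> x = comb2 M (c \<otimes> a) (c \<otimes> b) u w"
    using assms comb2_smult c by simp
  ultimately show "c \<odot>\<^bsub>M\<^esub> x \<in> span2 F M u w"
    using R.m_closed c unfolding span2_def by blast
qed

lemma submodule_span1:
  assumes "u \<in> carrier M"
  shows "submodule (span1 F M u) F M"
proof -
  have "span1 F M u = span2 F M u \<zero>\<^bsub>M\<^esub>"
    using assms by (force simp: span1_def span2_def comb2_def)
  then show ?thesis using submodule_span2[of u "\<zero>\<^bsub>M\<^esub>"] assms by simp
qed

lemma lin_span_1:
  assumes "b 0 \<in> carrier M"
  shows "lin_span F M 1 b = span1 F M (b 0)"
proof -
  have "lin_span F M 1 b = {a 0 \<odot>\<^bsub>M\<^esub> b 0 | a. a \<in> {..<1::nat} \<rightarrow> carrier F}"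
    unfolding lin_span_def using assms lin_comb_1[where b=b]
    by (intro Collect_cong ex_cong1) (auto simp: Pi_iff)
  also have "\<dots> = span1 F M (b 0)"
  proof -
    have "\<exists>c. x \<odot>\<^bsub>M\<^esub> b 0 = c 0 \<odot>\<^bsub>M\<^esub> b 0 \<and> c \<in> {..<1::nat} \<rightarrow> carrier F" if "x \<in> carrier F" for x
      using that by (intro exI[of _ "\<lambda>i::nat. x"]) auto
    moreover have "c 0 \<in> carrier F" if "c \<in> {..<1::nat} \<rightarrow> carrier F" for c
      using that by auto
    ultimately show ?thesis unfolding span1_def by blast
  qed
  finally show ?thesis .
qed

lemma subspace_of_dim_1_iff:
  "subspace_of_dim F M 1 p \<longleftrightarrow> (\<exists>u\<in>carrier M. u \<noteq> \<zero>\<^bsub>M\<^esub> \<and> p = span1 F M u)"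
proof
  assume "subspace_of_dim F M 1 p"
  then obtain b where sub: "submodule p F M" and b: "b \<in> {..<1} \<rightarrow> p"
    "lin_indep F M 1 b" "lin_span F M 1 b = p"
    by (auto simp: subspace_of_dim_def)
  have bM: "b 0 \<in> carrier M" using submoduleE(1)[OF sub] b(1) by auto
  have "b 0 \<noteq> \<zero>\<^bsub>M\<^esub>"
  proof
    assume "b 0 = \<zero>\<^bsub>M\<^esub>"
    then have "lin_comb M 1 (\<lambda>_. \<one>) b = \<zero>\<^bsub>M\<^esub>" by (simp add: lin_comb_def lessThan_Suc)
    then have "\<one> = \<zero>" using b(2) by (auto simp: lin_indep_def)
    then show False by simp
  qed
  then show "\<exists>u\<in>carrier M. u \<noteq> \<zero>\<^bsub>M\<^esub> \<and> p = span1 F M u"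
    using bM lin_span_1[of b, OF bM] b(3) by (intro bexI[of _ "b 0"]) simp_all
next
  assume "\<exists>u\<in>carrier M. u \<noteq> \<zero>\<^bsub>M\<^esub> \<and> p = span1 F M u"
  then obtain u where u: "u \<in> carrier M" "u \<noteq> \<zero>\<^bsub>M\<^esub>" "p = span1 F M u" by blast
  let ?b = "\<lambda>_::nat. u"
  have "lin_indep F M 1 ?b"
    unfolding lin_indep_def
  proof (intro ballI impI allI)
    fix a j assume a: "a \<in> {..<1::nat} \<rightarrow> carrier F" "lin_comb M 1 a ?b = \<zero>\<^bsub>M\<^esub>" "j < (1::nat)"
    from a(1) have a0: "a 0 \<in> carrier F" by auto
    have "a 0 \<odot>\<^bsub>M\<^esub> u = \<zero>\<^bsub>M\<^esub>" using lin_comb_1[of a ?b, OF a0 u(1)] a(2) by (rule trans[OF sym])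
    then have "a 0 = \<zero>" using smult_eq_zero[OF a0 u(1)] u(2) by blast
    then show "a j = \<zero>" using a(3) by simp
  qed
  moreover have "lin_span F M 1 ?b = p" using lin_span_1[of ?b] u by simp
  moreover have "?b \<in> {..<1} \<rightarrow> p" using in_span1 u by auto
  ultimately show "subspace_of_dim F M 1 p"
    using submodule_span1[OF u(1)] u(3) unfolding subspace_of_dim_def
    by (auto intro!: bexI[of _ ?b])
qed

lemma lin_span_2:
  assumes "b 0 \<in> carrier M" "b 1 \<in> carrier M"
  shows "lin_span F M 2 b = span2 F M (b 0) (b 1)"
proof -
  have "lin_span F M 2 b = {comb2 M (a 0) (a 1) (b 0) (b 1) | a. a \<in> {..<2::nat} \<rightarrow> carrier F}"
    unfolding lin_span_def using assms lin_comb_2[where b=b]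
    by (intro Collect_cong ex_cong1) (auto simp: Pi_iff)
  also have "\<dots> = span2 F M (b 0) (b 1)"
  proof -
    have "\<exists>c. comb2 M x y (b 0) (b 1) = comb2 M (c 0) (c 1) (b 0) (b 1) \<and> c \<in> {..<2::nat} \<rightarrow> carrier F"
      if "x \<in> carrier F" "y \<in> carrier F" for x y
      using that by (intro exI[of _ "\<lambda>i::nat. if i = 0 then x else y"]) auto
    moreover have "c 0 \<in> carrier F \<and> c 1 \<in> carrier F" if "c \<in> {..<2::nat} \<rightarrow> carrier F" for c
      using that by auto
    ultimately show ?thesis unfolding span2_def by blast
  qed
  finally show ?thesis .
qed

lemma lin_indep_2:
  assumes "b 0 \<in> carrier M" "b 1 \<in> carrier M"
  shows "lin_indep F M 2 b \<longleftrightarrow> indep2 F M (b 0) (b 1)"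
proof
  assume L: "lin_indep F M 2 b"
  show "indep2 F M (b 0) (b 1)"
    unfolding indep2_def
  proof (intro ballI impI)
    fix x y assume xy: "x \<in> carrier F" "y \<in> carrier F" "comb2 M x y (b 0) (b 1) = \<zero>\<^bsub>M\<^esub>"
    let ?c = "\<lambda>i::nat. if i = 0 then x else y"
    have "lin_comb M 2 ?c b = \<zero>\<^bsub>M\<^esub>" using lin_comb_2[of ?c b] xy assms by simp
    moreover have "?c \<in> {..<2} \<rightarrow> carrier F" using xy by simp
    ultimately have "\<forall>j<2. ?c j = \<zero>" using L unfolding lin_indep_def by blast
    from spec[OF this, of 0] spec[OF this, of 1] show "x = \<zero> \<and> y = \<zero>" by simp
  qed
next
  assume L: "indep2 F M (b 0) (b 1)"
  show "lin_indep F M 2 b"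
    unfolding lin_indep_def
  proof (intro ballI impI allI)
    fix a j assume a: "a \<in> {..<2::nat} \<rightarrow> carrier F" "lin_comb M 2 a b = \<zero>\<^bsub>M\<^esub>" "j < (2::nat)"
    then have "a 0 \<in> carrier F" "a 1 \<in> carrier F" by auto
    then have "a 0 = \<zero> \<and> a 1 = \<zero>"
      using L assms a(2) lin_comb_2[of a b] unfolding indep2_def by metis
    with a(3) show "a j = \<zero>" by (auto simp: less_2_cases_iff)
  qed
qed

lemma subspace_of_dim_2_iff: "subspace_of_dim F M 2 l \<longleftrightarrow> vline F M l"
proof
  assume "subspace_of_dim F M 2 l"
  then obtain b where sub: "submodule l F M" and b: "b \<in> {..<2} \<rightarrow> l"
    "lin_indep F M 2 b" "lin_span F M 2 b = l"
    by (auto simp: subspace_of_dim_def)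
  have bM: "b 0 \<in> carrier M" "b 1 \<in> carrier M" using submoduleE(1)[OF sub] b(1) by auto
  then show "vline F M l" using lin_span_2[OF bM] lin_indep_2[OF bM] b by (auto simp: vline_def)
next
  assume "vline F M l"
  then obtain u w where uw: "u \<in> carrier M" "w \<in> carrier M" "indep2 F M u w"
    "l = span2 F M u w" by (auto simp: vline_def)
  let ?b = "\<lambda>i::nat. if i = 0 then u else w"
  have "lin_indep F M 2 ?b" "lin_span F M 2 ?b = l"
    using lin_indep_2[of ?b] lin_span_2[of ?b] uw by auto
  moreover have "?b \<in> {..<2} \<rightarrow> l" using in_span2 uw by auto
  ultimately show "subspace_of_dim F M 2 l"
    using submodule_span2[OF uw(1,2)] uw(4) unfolding subspace_of_dim_def by (auto intro!: bexI[of _ ?b])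
qed

lemma vline_closed: "vline F M l \<Longrightarrow> l \<subseteq> carrier M"
  using span2_closed unfolding vline_def by auto

lemma span1_subset_vline:
  assumes "vline F M l" "v \<in> l"
  shows "span1 F M v \<subseteq> l"
proof -
  have "submodule l F M" using assms submodule_span2 by (auto simp: vline_def)
  then show ?thesis using assms submoduleE(4) by (auto simp: span1_def)
qed

end

section \<open>Coordinate spaces as vector spaces\<close>

lemma coord_space_simps:
  "carrier (coord_space F m) = {..<m} \<rightarrow>\<^sub>E carrier F"
  "\<zero>\<^bsub>coord_space F m\<^esub> = (\<lambda>i\<in>{..<m}. \<zero>\<^bsub>F\<^esub>)"
  "u \<oplus>\<^bsub>coord_space F m\<^esub> w = (\<lambda>i\<in>{..<m}. u i \<oplus>\<^bsub>F\<^esub> w i)"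
  "a \<odot>\<^bsub>coord_space F m\<^esub> u = (\<lambda>i\<in>{..<m}. a \<otimes>\<^bsub>F\<^esub> u i)"
  by (simp_all add: coord_space_def)

lemma vecsp_coord_space:
  fixes F (structure)
  assumes "field F"
  shows "vecsp F (coord_space F m)"
proof -
  interpret field F by fact
  have "abelian_group (coord_space F m)"
  proof (rule abelian_groupI)
    fix x assume "x \<in> carrier (coord_space F m)"
    then show "\<exists>y\<in>carrier (coord_space F m). y \<oplus>\<^bsub>coord_space F m\<^esub> x = \<zero>\<^bsub>coord_space F m\<^esub>"
      by (intro bexI[of _ "\<lambda>i\<in>{..<m}. \<ominus> x i"])
         (auto simp: coord_space_simps PiE_iff l_neg intro!: restrict_ext)
  next
    fix x y assume "x \<in> carrier (coord_space F m)" "y \<in> carrier (coord_space F m)"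
    then show "x \<oplus>\<^bsub>coord_space F m\<^esub> y = y \<oplus>\<^bsub>coord_space F m\<^esub> x"
      unfolding coord_space_simps by (intro restrict_ext) (auto simp: PiE_iff intro: a_comm)
  qed (auto simp: coord_space_simps PiE_iff a_assoc extensional_def intro!: ext)
  then have "module F (coord_space F m)"
    by (intro moduleI is_cring)
       (auto simp: coord_space_simps PiE_iff l_distr r_distr m_assoc extensional_def
             intro!: restrict_ext ext)
  then show ?thesis by (simp add: vecsp_def field_axioms)
qed

section \<open>Colour classes\<close>

definition share_point :: "'v set set \<Rightarrow> 'v set \<Rightarrow> 'v set \<Rightarrow> bool" where
  "share_point P l1 l2 \<longleftrightarrow> (\<exists>p\<in>P. p \<subseteq> l1 \<and> p \<subseteq> l2)"

text \<open>A partial colouring given by its colour classes; lines outside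
  \<open>\<Union>\<D>\<close> are still uncoloured. Adding lines to a class can only create further
  meetings, so completeness survives every extension. Classes are nonempty so that each becomes a
  colour that occurs.\<close>

definition class_family :: "'v set set \<Rightarrow> 'v set set \<Rightarrow> 'v set set set \<Rightarrow> bool" where
  "class_family P L \<D> \<longleftrightarrow> pairwise disjnt \<D> \<and> \<Union>\<D> \<subseteq> L \<and> {} \<notin> \<D> \<and>
     (\<forall>C\<in>\<D>. \<forall>l1\<in>C. \<forall>l2\<in>C. l1 \<noteq> l2 \<longrightarrow> \<not> share_point P l1 l2) \<and>
     (\<forall>C1\<in>\<D>. \<forall>C2\<in>\<D>. C1 \<noteq> C2 \<longrightarrow> (\<exists>l1\<in>C1. \<exists>l2\<in>C2. share_point P l1 l2))"

lemma share_point_sym: "share_point P l1 l2 \<longleftrightarrow> share_point P l2 l1"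
  by (auto simp: share_point_def)

text \<open>Greedy extension: an uncoloured line either fits into an existing class, or it meets every
  class and can form a class of its own.\<close>

lemma class_family_extend:
  assumes "finite L" "class_family P L \<D>"
  shows "\<exists>\<D>'. class_family P L \<D>' \<and> \<Union>\<D>' = L \<and> card \<D> \<le> card \<D>'"
  using assms(2)
proof (induction "card (L - \<Union>\<D>)" arbitrary: \<D> rule: less_induct)
  case less
  note D = less.prems
  have sub: "\<Union>\<D> \<subseteq> L" using D by (simp add: class_family_def)
  have finU: "finite (\<Union>\<D>)" using sub assms(1) finite_subset by blast
  have finD: "finite \<D>" using finU finite_UnionD by blast
  show ?case
  proof (cases "\<Union>\<D> = L")
    case True
    then show ?thesis using D by auto
  next
    case False
    then obtain l where l: "l \<in> L" "l \<notin> \<Union>\<D>" using sub by auto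
    show ?thesis
    proof (cases "\<exists>C\<in>\<D>. \<forall>l'\<in>C. \<not> share_point P l l'")
      case True
      then obtain C where C: "C \<in> \<D>" "\<forall>l'\<in>C. \<not> share_point P l l'" by blast
      define \<D>' where "\<D>' = insert (insert l C) (\<D> - {C})"
      have U: "\<Union>\<D>' = insert l (\<Union>\<D>)" using C(1) by (auto simp: \<D>'_def)
      have "insert l C \<notin> \<D> - {C}" using l by auto
      then have card: "card \<D>' = card \<D>"
        using finD C(1) card_Suc_Diff1[OF finD C(1)] unfolding \<D>'_def by (subst card_insert_disjoint) auto
      have "class_family P L \<D>'"
        unfolding class_family_def
      proof (intro conjI)
        have "pairwise disjnt \<D>" using D by (simp add: class_family_def)
        then show "pairwise disjnt \<D>'"
          using C(1) l(2) unfolding \<D>'_def pairwise_def disjnt_def by blast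
        show "\<Union>\<D>' \<subseteq> L" using U l sub by simp
        show "{} \<notin> \<D>'" using D by (auto simp: \<D>'_def class_family_def)
        have "\<forall>C\<in>\<D>. \<forall>l1\<in>C. \<forall>l2\<in>C. l1 \<noteq> l2 \<longrightarrow> \<not> share_point P l1 l2"
          using D by (simp add: class_family_def)
        then show "\<forall>C\<in>\<D>'. \<forall>l1\<in>C. \<forall>l2\<in>C. l1 \<noteq> l2 \<longrightarrow> \<not> share_point P l1 l2"
          using C share_point_sym[of P] unfolding \<D>'_def by (metis Diff_iff insert_iff)
        have "\<forall>C1\<in>\<D>. \<forall>C2\<in>\<D>. C1 \<noteq> C2 \<longrightarrow> (\<exists>l1\<in>C1. \<exists>l2\<in>C2. share_point P l1 l2)"
          using D by (simp add: class_family_def)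
        then show "\<forall>C1\<in>\<D>'. \<forall>C2\<in>\<D>'. C1 \<noteq> C2 \<longrightarrow> (\<exists>l1\<in>C1. \<exists>l2\<in>C2. share_point P l1 l2)"
          using C(1) unfolding \<D>'_def by (metis Diff_iff insert_iff)
      qed
      moreover have "card (L - \<Union>\<D>') < card (L - \<Union>\<D>)"
        using U l assms(1) by (intro psubset_card_mono) auto
      ultimately obtain \<D>'' where "class_family P L \<D>''" "\<Union>\<D>'' = L" "card \<D>' \<le> card \<D>''"
        using less.hyps[of \<D>'] by blast
      then show ?thesis using card by (intro exI[of _ \<D>'']) simp
    next
      case False
      define \<D>' where "\<D>' = insert {l} \<D>"
      have U: "\<Union>\<D>' = insert l (\<Union>\<D>)" by (auto simp: \<D>'_def)
      have card: "card \<D> \<le> card \<D>'" using finD by (simp add: \<D>'_def card_insert_le)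
      have "class_family P L \<D>'"
        unfolding class_family_def
      proof (intro conjI)
        have "pairwise disjnt \<D>" using D by (simp add: class_family_def)
        then show "pairwise disjnt \<D>'"
          using l(2) unfolding \<D>'_def pairwise_def disjnt_def by blast
        show "\<Union>\<D>' \<subseteq> L" using U l sub by simp
        show "{} \<notin> \<D>'" using D by (auto simp: \<D>'_def class_family_def)
        show "\<forall>C\<in>\<D>'. \<forall>l1\<in>C. \<forall>l2\<in>C. l1 \<noteq> l2 \<longrightarrow> \<not> share_point P l1 l2"
          using D by (auto simp: \<D>'_def class_family_def)
        show "\<forall>C1\<in>\<D>'. \<forall>C2\<in>\<D>'. C1 \<noteq> C2 \<longrightarrow> (\<exists>l1\<in>C1. \<exists>l2\<in>C2. share_point P l1 l2)"
          using D False share_point_sym[of P] unfolding \<D>'_def class_family_def by (auto; meson)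
      qed
      moreover have "card (L - \<Union>\<D>') < card (L - \<Union>\<D>)"
        using U l assms(1) by (intro psubset_card_mono) auto
      ultimately obtain \<D>'' where "class_family P L \<D>''" "\<Union>\<D>'' = L" "card \<D>' \<le> card \<D>''"
        using less.hyps[of \<D>'] by blast
      then show ?thesis using card by (intro exI[of _ \<D>'']) simp
    qed
  qed
qed

text \<open>After the greedy extension the classes partition \<open>L\<close>, so any numbering of
  them is a colouring. The extension may create new classes, hence only an inequality for
  \<open>k\<close>.\<close>

lemma class_family_coloring:
  assumes "finite L" "class_family P L \<D>"
  shows "\<exists>k f. card \<D> \<le> k \<and> line_coloring L k f \<and> proper_coloring P L f \<and> complete_coloring P L k f"
proof -
  obtain \<D>' where D: "class_family P L \<D>'" and U: "\<Union>\<D>' = L" and card: "card \<D> \<le> card \<D>'"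
    using class_family_extend[OF assms] by blast
  define k where "k = card \<D>'"
  have fin: "finite \<D>'" using U assms(1) finite_UnionD by blast
  obtain g where g: "bij_betw g \<D>' {1..k}"
  proof -
    have "card \<D>' = card {1..k}" by (simp add: k_def)
    then show ?thesis using finite_same_card_bij[OF fin finite_atLeastAtMost] that by blast
  qed
  define cl where "cl l = (THE C. C \<in> \<D>' \<and> l \<in> C)" for l
  have cl: "cl l = C" if "C \<in> \<D>'" "l \<in> C" for C l
    unfolding cl_def
  proof (rule the_equality)
    show "C \<in> \<D>' \<and> l \<in> C" using that by simp
    fix C' assume "C' \<in> \<D>' \<and> l \<in> C'"
    moreover have "pairwise disjnt \<D>'" using D by (simp add: class_family_def)
    ultimately show "C' = C"
      using that pairwiseD[of disjnt \<D>' C' C] by (auto simp: disjnt_def)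
  qed
  define f where "f l = g (cl l)" for l
  have clD: "cl l \<in> \<D>' \<and> l \<in> cl l" if "l \<in> L" for l
    using that U cl by blast
  have "f ` L = {1..k}"
  proof -
    have "cl ` L = \<D>'"
    proof
      show "cl ` L \<subseteq> \<D>'" using clD by blast
      show "\<D>' \<subseteq> cl ` L"
      proof
        fix C assume C: "C \<in> \<D>'"
        then obtain l where "l \<in> C" using D by (auto simp: class_family_def) (metis ex_in_conv)
        then show "C \<in> cl ` L" using cl C U by blast
      qed
    qed
    then show ?thesis using g unfolding f_def by (metis bij_betw_imp_surj_on image_image)
  qed
  moreover have "proper_coloring P L f"
    unfolding proper_coloring_def
  proof (intro ballI impI)
    fix l1 l2 assume l: "l1 \<in> L" "l2 \<in> L" "l1 \<noteq> l2 \<and> (\<exists>p\<in>P. p \<subseteq> l1 \<and> p \<subseteq> l2)"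
    have "\<forall>C\<in>\<D>'. \<forall>l1\<in>C. \<forall>l2\<in>C. l1 \<noteq> l2 \<longrightarrow> \<not> share_point P l1 l2"
      using D by (simp add: class_family_def)
    then have "cl l1 \<noteq> cl l2"
      using clD[OF l(1)] clD[OF l(2)] l(3) unfolding share_point_def by metis
    then show "f l1 \<noteq> f l2"
      using clD[OF l(1)] clD[OF l(2)] inj_onD[OF bij_betw_imp_inj_on[OF g]] unfolding f_def by blast
  qed
  moreover have "complete_coloring P L k f"
    unfolding complete_coloring_def
  proof (intro ballI impI)
    fix c1 c2 assume c: "c1 \<in> {1..k}" "c2 \<in> {1..k}" "c1 \<noteq> c2"
    obtain C1 C2 where C: "C1 \<in> \<D>'" "C2 \<in> \<D>'" "g C1 = c1" "g C2 = c2"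
      using bij_betw_imp_surj_on[OF g] c by (metis imageE)
    moreover have "\<forall>C1\<in>\<D>'. \<forall>C2\<in>\<D>'. C1 \<noteq> C2 \<longrightarrow> (\<exists>l1\<in>C1. \<exists>l2\<in>C2. share_point P l1 l2)"
      using D by (simp add: class_family_def)
    ultimately obtain l1 l2 where l: "l1 \<in> C1" "l2 \<in> C2" "share_point P l1 l2"
      using c by metis
    then have "f l1 = c1" "f l2 = c2" "l1 \<in> L" "l2 \<in> L"
      using C cl U by (auto simp: f_def)
    with l(3) show "\<exists>p\<in>P. (\<exists>l1\<in>L. p \<subseteq> l1 \<and> f l1 = c1) \<and> (\<exists>l2\<in>L. p \<subseteq> l2 \<and> f l2 = c2)"
      unfolding share_point_def by blast
  qed
  ultimately show ?thesis using card unfolding k_def line_coloring_def by blast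
qed

text \<open>Boundedness of the number of colours gives the \<open>GREATEST\<close> in the two
  indices its meaning as a maximum.\<close>

lemma line_coloring_le_card: "finite L \<Longrightarrow> line_coloring L k f \<Longrightarrow> k \<le> card L"
  unfolding line_coloring_def by (metis card_atLeastAtMost card_image_le diff_Suc_1)

lemma achromatic_index_ge:
  assumes "finite L" "class_family P L \<D>"
  shows "card \<D> \<le> achromatic_index P L"
proof -
  from class_family_coloring[OF assms] obtain k where k: "card \<D> \<le> k"
    and kf: "\<exists>f. line_coloring L k f \<and> proper_coloring P L f \<and> complete_coloring P L k f"
    by blast
  note k
  also have "k \<le> achromatic_index P L"
    unfolding achromatic_index_def
    by (rule Greatest_le_nat[where b = "card L"]) (use kf line_coloring_le_card[OF assms(1)] in blast)+
  finally show ?thesis .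
qed

text \<open>With a single colour there is no pair to check, so the constant colouring shows that the
  maximum is taken over a nonempty set.\<close>

lemma pseudoachromatic_index_attained:
  assumes "finite L" "L \<noteq> {}"
  shows "\<exists>f. line_coloring L (pseudoachromatic_index P L) f
    \<and> complete_coloring P L (pseudoachromatic_index P L) f"
proof -
  have "line_coloring L 1 (\<lambda>_. 1) \<and> complete_coloring P L 1 (\<lambda>_. 1)"
    using assms by (auto simp: line_coloring_def complete_coloring_def)
  then have ex: "\<exists>f. line_coloring L 1 f \<and> complete_coloring P L 1 f" by blast
  show ?thesis
    unfolding pseudoachromatic_index_def
    using GreatestI_nat[of "\<lambda>k. \<exists>f. line_coloring L k f \<and> complete_coloring P L k f" 1 "card L",
        OF ex] line_coloring_le_card[OF assms(1)] by blast
qed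

lemma complete_coloring_bound:
  assumes "finite P" "finite L" "line_coloring L k f" "complete_coloring P L k f"
    and deg: "\<And>p. p \<in> P \<Longrightarrow> card {l \<in> L. p \<subseteq> l} \<le> r"
    and inc: "\<And>l. l \<in> L \<Longrightarrow> \<exists>p\<in>P. p \<subseteq> l"
  shows "k * k \<le> card P * r * r"
proof -
  define X where "X c = {p \<in> P. \<exists>l\<in>L. p \<subseteq> l \<and> f l = c}" for c
  have finX: "finite (X c)" for c using assms(1) by (simp add: X_def)
  have kX: "k \<le> card (X c) * r" if c: "c \<in> {1..k}" for c
  proof -
    \<comment> \<open>The colour \<open>c\<close> is itself seen from \<open>X c\<close>, because
      every line contains a point; this gives \<open>k\<close> rather than \<open>k - 1\<close> on
      the left of the count.\<close>
    have "{1..k} \<subseteq> (\<Union>p\<in>X c. f ` {l \<in> L. p \<subseteq> l})"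
    proof
      fix d assume d: "d \<in> {1..k}"
      show "d \<in> (\<Union>p\<in>X c. f ` {l \<in> L. p \<subseteq> l})"
      proof (cases "d = c")
        case True
        have "c \<in> f ` L" using c assms(3) by (simp add: line_coloring_def)
        then obtain l where "l \<in> L" "f l = c" by auto
        then show ?thesis using inc[of l] True by (auto simp: X_def)
      next
        case False
        then obtain p where "p \<in> P" "\<exists>l1\<in>L. p \<subseteq> l1 \<and> f l1 = c" "\<exists>l2\<in>L. p \<subseteq> l2 \<and> f l2 = d"
          using assms(4) c d unfolding complete_coloring_def by metis
        then show ?thesis by (auto simp: X_def)
      qed
    qed
    then have "card {1..k} \<le> card (\<Union>p\<in>X c. f ` {l \<in> L. p \<subseteq> l})"
      using assms(2) finX by (intro card_mono) auto
    also have "\<dots> \<le> (\<Sum>p\<in>X c. card (f ` {l \<in> L. p \<subseteq> l}))"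
      using finX by (rule card_UN_le)
    also have "\<dots> \<le> (\<Sum>p\<in>X c. r)"
      using deg assms(2) by (intro sum_mono) (force simp: X_def intro: order_trans[OF card_image_le])
    finally show ?thesis by simp
  qed
  \<comment> \<open>A point lies in \<open>X c\<close> exactly when the colour \<open>c\<close>
    occurs on a line through it, so it is counted for at most \<open>r\<close> colours.\<close>
  have sumX: "(\<Sum>c\<in>{1..k}. card (X c)) \<le> card P * r"
  proof -
    have "(\<Sum>c\<in>{1..k}. card (X c)) = card (SIGMA c:{1..k}. X c)"
      using finX by simp
    also have "\<dots> \<le> card (SIGMA p:P. f ` {l \<in> L. p \<subseteq> l})"
    proof -
      have "(\<lambda>(c, p). (p, c)) ` (SIGMA c:{1..k}. X c) \<subseteq> (SIGMA p:P. f ` {l \<in> L. p \<subseteq> l})"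
        by (auto simp: X_def)
      then show ?thesis
        using assms(1,2) by (intro card_inj_on_le[of "\<lambda>(c, p). (p, c)"]) (auto simp: inj_on_def)
    qed
    also have "\<dots> = (\<Sum>p\<in>P. card (f ` {l \<in> L. p \<subseteq> l}))"
      using assms(1,2) by simp
    also have "\<dots> \<le> (\<Sum>p\<in>P. r)"
      using deg assms(2) by (intro sum_mono) (force intro: order_trans[OF card_image_le])
    finally show ?thesis by simp
  qed
  have "k * k = (\<Sum>c\<in>{1..k}. k)" by simp
  also have "\<dots> \<le> (\<Sum>c\<in>{1..k}. card (X c) * r)" using kX by (intro sum_mono)
  also have "\<dots> = (\<Sum>c\<in>{1..k}. card (X c)) * r" by (simp add: sum_distrib_right)
  also have "\<dots> \<le> card P * r * r" using sumX by simp
  finally show ?thesis .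
qed

section \<open>The upper bound\<close>

context vecsp
begin

text \<open>Distinct points share only the zero vector, and each contains
  \<open>card (carrier F) - 1\<close> other vectors. Disjointness alone yields the
  inequality.\<close>

lemma card_span1_family_le:
  assumes "finite (carrier M)" "finite (carrier F)"
  shows "card {p. subspace_of_dim F M 1 p} * (card (carrier F) - 1) \<le> card (carrier M) - 1"
    and "finite {p. subspace_of_dim F M 1 p}"
proof -
  let ?P = "{p. subspace_of_dim F M 1 p}"
  have sub: "?P \<subseteq> Pow (carrier M)"
    using span1_closed unfolding subspace_of_dim_1_iff by auto
  then show fin: "finite ?P" using assms(1) finite_subset by blast
  have finp: "finite p" if "p \<in> ?P" for p
    using that sub assms(1) finite_subset by (metis PowD subsetD)
  have zero: "\<zero>\<^bsub>M\<^esub> \<in> span1 F M u" if "u \<in> carrier M" for u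
    using that by (auto simp: span1_def intro!: exI[of _ "\<zero>"])
  have cardp: "card (p - {\<zero>\<^bsub>M\<^esub>}) = card (carrier F) - 1" if "p \<in> ?P" for p
    using that zero card_span1 unfolding subspace_of_dim_1_iff by (auto simp: card_Diff_singleton)
  have "card ?P * (card (carrier F) - 1) = (\<Sum>p\<in>?P. card (p - {\<zero>\<^bsub>M\<^esub>}))"
    using cardp by simp
  also have "\<dots> = card (SIGMA p:?P. p - {\<zero>\<^bsub>M\<^esub>})"
    using fin finp by simp
  also have "\<dots> \<le> card (carrier M - {\<zero>\<^bsub>M\<^esub>})"
  proof (rule card_inj_on_le[of snd])
    show "inj_on snd (SIGMA p:?P. p - {\<zero>\<^bsub>M\<^esub>})"
    proof (rule inj_onI)
      fix x y assume xy: "x \<in> (SIGMA p:?P. p - {\<zero>\<^bsub>M\<^esub>})" "y \<in> (SIGMA p:?P. p - {\<zero>\<^bsub>M\<^esub>})" "snd x = snd y"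
      have "p = span1 F M v" if "p \<in> ?P" "v \<in> p" "v \<noteq> \<zero>\<^bsub>M\<^esub>" for p v
        using that smult_in_span1 unfolding subspace_of_dim_1_iff by auto
      then have "fst x = fst y" using xy by (cases x; cases y) auto
      then show "x = y" using xy(3) by (simp add: prod_eq_iff)
    qed
    show "snd ` (SIGMA p:?P. p - {\<zero>\<^bsub>M\<^esub>}) \<subseteq> carrier M - {\<zero>\<^bsub>M\<^esub>}"
    proof
      fix v assume "v \<in> snd ` (SIGMA p:?P. p - {\<zero>\<^bsub>M\<^esub>})"
      then have "\<exists>p\<in>?P. v \<in> p - {\<zero>\<^bsub>M\<^esub>}" by force
      then show "v \<in> carrier M - {\<zero>\<^bsub>M\<^esub>}" using sub by blast
    qed
    show "finite (carrier M - {\<zero>\<^bsub>M\<^esub>})" using assms(1) by simp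
  qed
  finally show "card ?P * (card (carrier F) - 1) \<le> card (carrier M) - 1"
    by (simp add: card_Diff_singleton)
qed

lemma finite_vlines:
  assumes "finite (carrier M)"
  shows "finite {l. vline F M l}"
proof (rule finite_subset)
  show "{l. vline F M l} \<subseteq> Pow (carrier M)" using vline_closed by blast
qed (simp add: assms)

text \<open>A vector outside a point determines the line that joins them. The lines through the
  point are therefore disjoint outside it, and each takes up \<open>q\<^sup>2 - q\<close> vectors of
  the complement.\<close>

lemma card_vlines_through_le:
  assumes "finite (carrier M)" "finite (carrier F)" "u \<in> carrier M" "u \<noteq> \<zero>\<^bsub>M\<^esub>"
  defines "q \<equiv> card (carrier F)"
  shows "card {l. vline F M l \<and> span1 F M u \<subseteq> l} * (q\<^sup>2 - q) \<le> card (carrier M) - q"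
proof -
  let ?L = "{l. vline F M l \<and> span1 F M u \<subseteq> l}"
  let ?p = "span1 F M u"
  have fin: "finite ?L" using finite_vlines[OF assms(1)] by simp
  have finl: "finite l" if "l \<in> ?L" for l
    using that vline_closed assms(1) finite_subset by blast
  have finp: "finite ?p" using span1_closed[OF assms(3)] assms(1) finite_subset by blast
  have cardl: "card (l - ?p) = q\<^sup>2 - q" if "l \<in> ?L" for l
    using that finp card_span1[OF assms(3,4)]
    by (auto simp: card_Diff_subset q_def vline_def card_span2)
  have "card ?L * (q\<^sup>2 - q) = (\<Sum>l\<in>?L. card (l - ?p))"
    using cardl by simp
  also have "\<dots> = card (SIGMA l:?L. l - ?p)"
    using fin finl by simp
  also have "\<dots> \<le> card (carrier M - ?p)"
  proof (rule card_inj_on_le[of snd])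
    show "inj_on snd (SIGMA l:?L. l - ?p)"
    proof (rule inj_onI)
      fix x y assume xy: "x \<in> (SIGMA l:?L. l - ?p)" "y \<in> (SIGMA l:?L. l - ?p)" "snd x = snd y"
      have v: "snd x \<in> carrier M" "snd x \<notin> ?p" using xy vline_closed[of "fst x"] by auto
      have "fst x = fst y"
        by (rule vline_eqI[OF assms(2) _ _ indep2I_notin_span1[OF assms(3) v(1) assms(4) v(2)]])
          (use xy in_span1[OF assms(3)] in auto)
      then show "x = y" using xy(3) by (simp add: prod_eq_iff)
    qed
    show "snd ` (SIGMA l:?L. l - ?p) \<subseteq> carrier M - ?p"
      using vline_closed by fastforce
    show "finite (carrier M - ?p)" using assms(1) by simp
  qed
  also have "\<dots> = card (carrier M) - q"
    using finp span1_closed[OF assms(3)] card_span1[OF assms(3,4)] by (simp add: card_Diff_subset q_def)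
  finally show ?thesis .
qed

text \<open>With this translation the construction of the classes can speak of common nonzero
  vectors instead of points.\<close>

lemma share_point_vlines_iff:
  assumes "vline F M l1" "vline F M l2"
  shows "share_point {p. subspace_of_dim F M 1 p} l1 l2 \<longleftrightarrow> (\<exists>v\<in>l1 \<inter> l2. v \<noteq> \<zero>\<^bsub>M\<^esub>)"
proof
  assume "share_point {p. subspace_of_dim F M 1 p} l1 l2"
  then show "\<exists>v\<in>l1 \<inter> l2. v \<noteq> \<zero>\<^bsub>M\<^esub>"
    using in_span1 unfolding share_point_def subspace_of_dim_1_iff by blast
next
  assume "\<exists>v\<in>l1 \<inter> l2. v \<noteq> \<zero>\<^bsub>M\<^esub>"
  then obtain v where v: "v \<in> l1" "v \<in> l2" "v \<noteq> \<zero>\<^bsub>M\<^esub>" by blast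
  moreover have "v \<in> carrier M" using v vline_closed assms by blast
  ultimately show "share_point {p. subspace_of_dim F M 1 p} l1 l2"
    using span1_subset_vline assms unfolding share_point_def subspace_of_dim_1_iff by blast
qed

end

lemma card_coord_space:
  "card (carrier (coord_space F m)) = card (carrier F) ^ m"
  by (simp add: coord_space_simps card_PiE)

lemma finite_coord_space: "finite (carrier F) \<Longrightarrow> finite (carrier (coord_space F m))"
  by (simp add: coord_space_simps finite_PiE)

lemma is_GF_card_ge_2:
  assumes "is_GF q F"
  shows "q \<ge> 2"
proof -
  interpret field F using assms by (simp add: is_GF_def)
  have "{\<zero>\<^bsub>F\<^esub>, \<one>\<^bsub>F\<^esub>} \<subseteq> carrier F" by simp
  then have "card {\<zero>\<^bsub>F\<^esub>, \<one>\<^bsub>F\<^esub>} \<le> card (carrier F)"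
    using assms by (intro card_mono) (auto simp: is_GF_def)
  then show ?thesis using assms zero_not_one by (simp add: is_GF_def)
qed

lemma pg_pseudoachromatic_upper_bound:
  assumes "n \<ge> 2" "is_GF q F"
  shows "real (pg_pseudoachromatic_index F n) \<le> (1 / real q) * pg_order n q powr (3 / 2)"
proof -
  let ?M = "coord_space F (n + 1)"
  have F: "field F" "finite (carrier F)" "card (carrier F) = q" using assms by (auto simp: is_GF_def)
  interpret vecsp F ?M using vecsp_coord_space F(1) .
  have q2: "q \<ge> 2" using is_GF_card_ge_2 assms by blast
  have finM: "finite (carrier ?M)" using finite_coord_space F(2) .
  have cardM: "card (carrier ?M) = q ^ (n + 1)" by (simp add: card_coord_space F(3))
  have points: "pg_points F n = {p. subspace_of_dim F ?M 1 p}" unfolding pg_points_def ..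
  have lines: "pg_lines F n = {l. vline F ?M l}" unfolding pg_lines_def subspace_of_dim_2_iff ..
  have finP: "finite (pg_points F n)" and cardP: "card (pg_points F n) * (q - 1) \<le> q ^ (n + 1) - 1"
    using card_span1_family_le[OF finM F(2)] F(3) cardM by (simp_all add: points)
  have finL: "finite (pg_lines F n)" using finite_vlines[OF finM] by (simp add: lines)
  \<comment> \<open>In terms of \<open>v = pg_order n q\<close> this number is
    \<open>(v - 1) / q\<close>.\<close>
  define r where "r = (q ^ (n + 1) - q) div (q\<^sup>2 - q)"
  have qq: "q\<^sup>2 - q > 0" using q2 by (simp add: power2_eq_square)
  have deg: "card {l \<in> pg_lines F n. p \<subseteq> l} \<le> r" if p: "p \<in> pg_points F n" for p
  proof -
    obtain u where u: "u \<in> carrier ?M" "u \<noteq> \<zero>\<^bsub>?M\<^esub>" "p = span1 F ?M u"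
      using p unfolding points subspace_of_dim_1_iff by blast
    have "card {l. vline F ?M l \<and> span1 F ?M u \<subseteq> l} * (q\<^sup>2 - q) \<le> q ^ (n + 1) - q"
      using card_vlines_through_le[OF finM F(2) u(1,2)] F(3) cardM by simp
    then show ?thesis
      using qq by (simp add: r_def lines u(3) less_eq_div_iff_mult_less_eq)
  qed
  have inc: "\<exists>p\<in>pg_points F n. p \<subseteq> l" if l: "l \<in> pg_lines F n" for l
  proof -
    from l obtain u w where "u \<in> carrier ?M" "w \<in> carrier ?M" "indep2 F ?M u w" "l = span2 F ?M u w"
      by (auto simp: lines vline_def)
    then have "u \<in> carrier ?M" "u \<noteq> \<zero>\<^bsub>?M\<^esub>" "u \<in> l" using indep2_nonzero in_span2 by auto
    then show ?thesis
      using span1_subset_vline[of l u] l unfolding points lines subspace_of_dim_1_iff by blast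
  qed
  have neL: "pg_lines F n \<noteq> {}"
  proof -
    have "card {\<zero>\<^bsub>?M\<^esub>} < card (carrier ?M)"
      unfolding cardM using q2 one_less_power[of q "n+1"] by simp
    then obtain u where u: "u \<in> carrier ?M" "u \<noteq> \<zero>\<^bsub>?M\<^esub>"
      using card_mono[of "{\<zero>\<^bsub>?M\<^esub>}" "carrier ?M"] by fastforce
    have "card (span1 F ?M u) < card (carrier ?M)"
      using card_span1[OF u] F(3) q2 assms(1) power_strict_increasing[of 1 "n + 1" q] unfolding cardM by simp
    moreover have "finite (span1 F ?M u)" using span1_closed[OF u(1)] finM finite_subset by blast
    ultimately obtain w where w: "w \<in> carrier ?M" "w \<notin> span1 F ?M u"
      using card_mono[of "span1 F ?M u" "carrier ?M"] by fastforce
    have "vline F ?M (span2 F ?M u w)"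
      using indep2I_notin_span1[OF u(1) w(1) u(2) w(2)] u w by (auto simp: vline_def)
    then show ?thesis by (auto simp: lines)
  qed
  define k where "k = pg_pseudoachromatic_index F n"
  from pseudoachromatic_index_attained[OF finL neL]
  obtain f where f: "line_coloring (pg_lines F n) k f" "complete_coloring (pg_points F n) (pg_lines F n) k f"
    unfolding k_def pg_pseudoachromatic_index_def by blast
  have kk: "k * k \<le> card (pg_points F n) * r * r"
    using complete_coloring_bound[OF finP finL f deg inc] .
  define v where "v = pg_order n q"
  have qr: "real q \<ge> 2" using q2 by simp
  have pw: "real q ^ (n + 1) \<ge> real q" "q ^ (n + 1) \<ge> q" "q ^ (n + 1) \<ge> 1"
    using qr q2 by simp_all
  have P: "real (card (pg_points F n)) \<le> v"
  proof -
    have "real (card (pg_points F n) * (q - 1)) \<le> real (q ^ (n + 1) - 1)"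
      using cardP of_nat_le_iff by blast
    then have "real (card (pg_points F n)) * (real q - 1) \<le> real q ^ (n + 1) - 1"
      using q2 pw(3) by (simp add: of_nat_diff)
    then show ?thesis using qr by (simp add: v_def pg_order_def field_simps)
  qed
  have r: "real r \<le> v / real q"
  proof -
    have "r * (q\<^sup>2 - q) \<le> q ^ (n + 1) - q" by (simp add: r_def)
    then have "real (r * (q\<^sup>2 - q)) \<le> real (q ^ (n + 1) - q)" using of_nat_le_iff by blast
    moreover have "q \<le> q\<^sup>2" by (simp add: power2_eq_square)
    ultimately have "real r * ((real q)\<^sup>2 - real q) \<le> real q ^ (n + 1) - real q"
      using pw(2) by (simp add: of_nat_diff)
    \<comment> \<open>Here \<open>v - 1\<close> is weakened to \<open>v\<close>, which turns the
      final estimate into a pure power of \<open>v\<close>.\<close>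
    also have "\<dots> \<le> real q ^ (n + 1) - 1" using qr by simp
    also have "\<dots> = v * (real q - 1)" using qr by (simp add: v_def pg_order_def)
    finally have "(real r * real q) * (real q - 1) \<le> v * (real q - 1)"
      by (simp add: power2_eq_square algebra_simps)
    then have "real r * real q \<le> v" using qr by (simp add: mult_le_cancel_right)
    then show ?thesis using qr by (simp add: field_simps)
  qed
  have v0: "v \<ge> 0" using P by (meson of_nat_0_le_iff order_trans)
  have "(real k)\<^sup>2 = real (k * k)" by (simp add: power2_eq_square)
  also have "\<dots> \<le> real (card (pg_points F n) * r * r)" using kk of_nat_le_iff by blast
  also have "\<dots> \<le> v * (v / real q) * (v / real q)"
    unfolding of_nat_mult using P r v0 by (intro mult_mono) simp_all
  also have "\<dots> = ((1 / real q) * v powr (3 / 2))\<^sup>2"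
  proof -
    have "(v powr (3 / 2))\<^sup>2 = v powr 3"
      by (simp add: power2_eq_square flip: powr_add)
    also have "\<dots> = v ^ 3" using v0 powr_realpow'[of v 3] by simp
    finally show ?thesis by (simp add: power_mult_distrib power2_eq_square power3_eq_cube field_simps)
  qed
  finally show ?thesis
    unfolding k_def[symmetric] v_def[symmetric] by (rule power2_le_imp_le) simp
qed

section \<open>Quadratic extensions of finite fields\<close>

text \<open>
  \<open>prod_encode (s, t)\<close> stands for \<open>s + t\<theta>\<close> with \<open>\<theta>\<^sup>2 = a\<theta> + b\<close>. Coding pairs as numbers keeps the carrier in
  \<open>nat\<close>, so that the extension step can be iterated.
\<close>

definition quad_ext :: "nat ring \<Rightarrow> nat \<Rightarrow> nat \<Rightarrow> nat ring" where
  "quad_ext F a b =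
     \<lparr>carrier = prod_encode ` (carrier F \<times> carrier F),
      mult = (\<lambda>x y. case (prod_decode x, prod_decode y) of ((s, t), (s', t')) \<Rightarrow>
        prod_encode (s \<otimes>\<^bsub>F\<^esub> s' \<oplus>\<^bsub>F\<^esub> b \<otimes>\<^bsub>F\<^esub> (t \<otimes>\<^bsub>F\<^esub> t'),
                     s \<otimes>\<^bsub>F\<^esub> t' \<oplus>\<^bsub>F\<^esub> t \<otimes>\<^bsub>F\<^esub> s' \<oplus>\<^bsub>F\<^esub> a \<otimes>\<^bsub>F\<^esub> (t \<otimes>\<^bsub>F\<^esub> t'))),
      one = prod_encode (\<one>\<^bsub>F\<^esub>, \<zero>\<^bsub>F\<^esub>),
      zero = prod_encode (\<zero>\<^bsub>F\<^esub>, \<zero>\<^bsub>F\<^esub>),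
      add = (\<lambda>x y. case (prod_decode x, prod_decode y) of ((s, t), (s', t')) \<Rightarrow>
        prod_encode (s \<oplus>\<^bsub>F\<^esub> s', t \<oplus>\<^bsub>F\<^esub> t'))\<rparr>"

lemma quad_ext_simps [simp]:
  "carrier (quad_ext F a b) = prod_encode ` (carrier F \<times> carrier F)"
  "prod_encode (s, t) \<otimes>\<^bsub>quad_ext F a b\<^esub> prod_encode (s', t') =
     prod_encode (s \<otimes>\<^bsub>F\<^esub> s' \<oplus>\<^bsub>F\<^esub> b \<otimes>\<^bsub>F\<^esub> (t \<otimes>\<^bsub>F\<^esub> t'),
                  s \<otimes>\<^bsub>F\<^esub> t' \<oplus>\<^bsub>F\<^esub> t \<otimes>\<^bsub>F\<^esub> s' \<oplus>\<^bsub>F\<^esub> a \<otimes>\<^bsub>F\<^esub> (t \<otimes>\<^bsub>F\<^esub> t'))"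
  "\<one>\<^bsub>quad_ext F a b\<^esub> = prod_encode (\<one>\<^bsub>F\<^esub>, \<zero>\<^bsub>F\<^esub>)"
  "\<zero>\<^bsub>quad_ext F a b\<^esub> = prod_encode (\<zero>\<^bsub>F\<^esub>, \<zero>\<^bsub>F\<^esub>)"
  "prod_encode (s, t) \<oplus>\<^bsub>quad_ext F a b\<^esub> prod_encode (s', t') = prod_encode (s \<oplus>\<^bsub>F\<^esub> s', t \<oplus>\<^bsub>F\<^esub> t')"
  by (simp_all add: quad_ext_def)

lemma cring_quad_ext:
  fixes F (structure)
  assumes "field F" and ab: "a \<in> carrier F" "b \<in> carrier F"
  shows "cring (quad_ext F a b)"
proof -
  interpret field F by fact
  show ?thesis
  proof (rule cringI)
    show "abelian_group (quad_ext F a b)"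
    proof (rule abelian_groupI)
      fix x assume "x \<in> carrier (quad_ext F a b)"
      then obtain s t where "s \<in> carrier F" "t \<in> carrier F" "x = prod_encode (s, t)" by auto
      then show "\<exists>y\<in>carrier (quad_ext F a b). y \<oplus>\<^bsub>quad_ext F a b\<^esub> x = \<zero>\<^bsub>quad_ext F a b\<^esub>"
        by (intro bexI[of _ "prod_encode (\<ominus> s, \<ominus> t)"]) (auto simp: l_neg)
    qed (auto simp: a_ac)
    show "comm_monoid (quad_ext F a b)"
    proof (rule comm_monoidI)
      fix x y z assume "x \<in> carrier (quad_ext F a b)" "y \<in> carrier (quad_ext F a b)" "z \<in> carrier (quad_ext F a b)"
      then obtain s t s' t' s'' t'' where c: "s \<in> carrier F" "t \<in> carrier F" "s' \<in> carrier F" "t' \<in> carrier F"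
        "s'' \<in> carrier F" "t'' \<in> carrier F"
        and e: "x = prod_encode (s, t)" "y = prod_encode (s', t')" "z = prod_encode (s'', t'')" by auto
      show "x \<otimes>\<^bsub>quad_ext F a b\<^esub> y \<otimes>\<^bsub>quad_ext F a b\<^esub> z = x \<otimes>\<^bsub>quad_ext F a b\<^esub> (y \<otimes>\<^bsub>quad_ext F a b\<^esub> z)"
        unfolding e quad_ext_simps prod_encode_eq prod.inject using c ab by (simp add: l_distr r_distr m_ac a_ac)
    next
      fix x y assume "x \<in> carrier (quad_ext F a b)" "y \<in> carrier (quad_ext F a b)"
      then obtain s t s' t' where c: "s \<in> carrier F" "t \<in> carrier F" "s' \<in> carrier F" "t' \<in> carrier F"
        and e: "x = prod_encode (s, t)" "y = prod_encode (s', t')" by auto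
      show "x \<otimes>\<^bsub>quad_ext F a b\<^esub> y = y \<otimes>\<^bsub>quad_ext F a b\<^esub> x"
        unfolding e quad_ext_simps prod_encode_eq prod.inject using c ab by (simp add: l_distr r_distr m_ac a_ac)
    qed (use ab in auto)
  next
    fix x y z assume "x \<in> carrier (quad_ext F a b)" "y \<in> carrier (quad_ext F a b)" "z \<in> carrier (quad_ext F a b)"
    then obtain s t s' t' s'' t'' where c: "s \<in> carrier F" "t \<in> carrier F" "s' \<in> carrier F" "t' \<in> carrier F"
      "s'' \<in> carrier F" "t'' \<in> carrier F"
      and e: "x = prod_encode (s, t)" "y = prod_encode (s', t')" "z = prod_encode (s'', t'')" by auto
    show "(x \<oplus>\<^bsub>quad_ext F a b\<^esub> y) \<otimes>\<^bsub>quad_ext F a b\<^esub> z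
      = x \<otimes>\<^bsub>quad_ext F a b\<^esub> z \<oplus>\<^bsub>quad_ext F a b\<^esub> y \<otimes>\<^bsub>quad_ext F a b\<^esub> z"
      unfolding e quad_ext_simps prod_encode_eq prod.inject using c ab by (simp add: l_distr r_distr m_ac a_ac)
  qed
qed

text \<open>Without a root in \<open>F\<close> the norm form vanishes only at zero, so a nonzero
  element is inverted by dividing its conjugate by its norm.\<close>

lemma field_quad_ext:
  fixes F (structure)
  assumes "field F" and ab: "a \<in> carrier F" "b \<in> carrier F"
    and irred: "\<And>x. x \<in> carrier F \<Longrightarrow> x \<otimes> x \<noteq> a \<otimes> x \<oplus> b"
  shows "field (quad_ext F a b)"
proof -
  interpret field F by fact
  interpret E: cring "quad_ext F a b" using cring_quad_ext assms by blast
  show ?thesis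
  proof (rule E.cring_fieldI2)
    show "\<zero>\<^bsub>quad_ext F a b\<^esub> \<noteq> \<one>\<^bsub>quad_ext F a b\<^esub>" by simp
    fix x assume x: "x \<in> carrier (quad_ext F a b)" "x \<noteq> \<zero>\<^bsub>quad_ext F a b\<^esub>"
    then obtain s t where st: "s \<in> carrier F" "t \<in> carrier F" "x = prod_encode (s, t)" by auto
    \<comment> \<open>the norm of \<open>s + t\<theta>\<close>\<close>
    define N where "N = s \<otimes> (s \<oplus> a \<otimes> t) \<ominus> b \<otimes> (t \<otimes> t)"
    have N: "N \<in> carrier F" using st ab by (simp add: N_def)
    have "N \<noteq> \<zero>"
    proof
      assume N0: "N = \<zero>"
      show False
      proof (cases "t = \<zero>")
        case True
        then have "s \<otimes> s = \<zero>" using N0 st ab by (simp add: N_def a_minus_def)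
        then have "s = \<zero>" using st integral_iff by simp
        then show False using True x st by simp
      next
        case False
        then have tU: "t \<in> Units F" using st field_Units by auto
        define i where "i = inv t"
        have i: "i \<in> carrier F" "i \<otimes> t = \<one>" using tU by (auto simp: i_def)
        define y where "y = \<ominus> (s \<otimes> i)"
        have y: "y \<in> carrier F" using i st by (simp add: y_def)
        \<comment> \<open>If the norm vanished, -s/t would be a root of the quadratic. The factors
          \<open>i \<otimes> t\<close>, all equal to \<open>\<one>\<close>, make the right side
          homogeneous, so that its equality with \<open>i \<otimes> i \<otimes> N\<close> is a plain
          ring identity.\<close>
        have "y \<otimes> y \<ominus> (a \<otimes> y \<oplus> b) = s \<otimes> s \<otimes> (i \<otimes> i) \<oplus> a \<otimes> s \<otimes> i \<otimes> (i \<otimes> t) \<ominus> b \<otimes> ((i \<otimes> t) \<otimes> (i \<otimes> t))"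
          unfolding i(2) using i(1) st ab unfolding y_def by algebra
        also have "\<dots> = i \<otimes> i \<otimes> N" unfolding N_def using i(1) st ab by algebra
        also have "\<dots> = \<zero>" using N0 i by simp
        finally have "y \<otimes> y = a \<otimes> y \<oplus> b"
          using y ab by (simp add: a_minus_def) (metis a_closed add.inv_closed m_closed minus_equality minus_minus)
        then show False using irred y by blast
      qed
    qed
    then have NU: "N \<in> Units F" using N field_Units by auto
    define j where "j = inv N"
    have j: "j \<in> carrier F" "j \<otimes> N = \<one>" using NU by (auto simp: j_def)
    \<comment> \<open>The other root of the quadratic is a - \<theta>, so the conjugate of s +
      t\<theta> is (s + a t) - t\<theta>; it is scaled by the inverse norm.\<close>
    let ?y = "prod_encode (j \<otimes> (s \<oplus> a \<otimes> t), j \<otimes> (\<ominus> t))"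
    have "s \<otimes> (j \<otimes> (s \<oplus> a \<otimes> t)) \<oplus> b \<otimes> (t \<otimes> (j \<otimes> (\<ominus> t))) = j \<otimes> N"
      unfolding N_def using st ab j(1) by algebra
    moreover have "s \<otimes> (j \<otimes> (\<ominus> t)) \<oplus> t \<otimes> (j \<otimes> (s \<oplus> a \<otimes> t)) \<oplus> a \<otimes> (t \<otimes> (j \<otimes> (\<ominus> t))) = \<zero>"
      using st ab j(1) by algebra
    ultimately have "x \<otimes>\<^bsub>quad_ext F a b\<^esub> ?y = \<one>\<^bsub>quad_ext F a b\<^esub>"
      unfolding st(3) quad_ext_simps by (simp add: j)
    moreover have "?y \<in> carrier (quad_ext F a b)" using st ab j by simp
    ultimately show "\<exists>y\<in>carrier (quad_ext F a b). x \<otimes>\<^bsub>quad_ext F a b\<^esub> y = \<one>\<^bsub>quad_ext F a b\<^esub>" by blast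
  qed
qed

lemma is_GF_quad_ext:
  assumes "is_GF q F" "a \<in> carrier F" "b \<in> carrier F"
    and "\<And>x. x \<in> carrier F \<Longrightarrow> x \<otimes>\<^bsub>F\<^esub> x \<noteq> a \<otimes>\<^bsub>F\<^esub> x \<oplus>\<^bsub>F\<^esub> b"
  shows "is_GF (q\<^sup>2) (quad_ext F a b)"
  using assms field_quad_ext[of F a b]
  by (simp add: is_GF_def card_image inj_prod_encode card_cartesian_product power2_eq_square)

text \<open>The map \<open>x \<mapsto> x\<^sup>2 - a x\<close> takes the same value at \<open>0\<close> and at \<open>a\<close>, so on a finite field it is
  not onto.\<close>

lemma (in cring) exists_irreducible_quadratic:
  assumes "finite K" "K \<subseteq> carrier R" "\<zero> \<in> K" "a \<in> K" "a \<noteq> \<zero>"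
    and closed: "\<And>x y. x \<in> K \<Longrightarrow> y \<in> K \<Longrightarrow> x \<otimes> y \<in> K \<and> x \<ominus> y \<in> K"
  shows "\<exists>b\<in>K. \<forall>x\<in>K. x \<otimes> x \<noteq> a \<otimes> x \<oplus> b"
proof -
  let ?h = "\<lambda>x. x \<otimes> x \<ominus> a \<otimes> x"
  have a: "a \<in> carrier R" using assms by auto
  have "?h \<zero> = ?h a" using a by (simp add: a_minus_def r_neg)
  then have "\<not> inj_on ?h K" using assms(3-5) unfolding inj_on_def by metis
  moreover have sub: "?h ` K \<subseteq> K" using assms(4) closed by auto
  ultimately have "?h ` K \<noteq> K" using assms(1) finite_surj_inj by (metis order_refl)
  then obtain b where b: "b \<in> K" "b \<notin> ?h ` K" using sub by blast
  have "x \<otimes> x \<noteq> a \<otimes> x \<oplus> b" if x: "x \<in> K" for x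
  proof
    assume "x \<otimes> x = a \<otimes> x \<oplus> b"
    then have "?h x = (a \<otimes> x \<oplus> b) \<ominus> a \<otimes> x" by simp
    also have "\<dots> = b"
    proof -
      have "b \<in> carrier R" "x \<in> carrier R" using b(1) x assms(2) by auto
      then show ?thesis using a by algebra
    qed
    finally show False using b(2) x by blast
  qed
  then show ?thesis using b(1) by blast
qed

section \<open>Disjoint spreads in a plane over a quadratic extension\<close>

text \<open>The set \<open>K\<close> stands for the copy of \<open>F\<close> inside its quadratic
  extension. The geometry below uses only this interface and never the coding of pairs.\<close>

locale quad_over = field E for E (structure) +
  fixes K :: "'a set" and \<theta> :: 'a
  assumes K_carrier: "K \<subseteq> carrier E"
    and K_zero: "\<zero> \<in> K" and K_one: "\<one> \<in> K"
    and K_add: "x \<in> K \<Longrightarrow> y \<in> K \<Longrightarrow> x \<oplus> y \<in> K"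
    and K_minus: "x \<in> K \<Longrightarrow> \<ominus> x \<in> K"
    and K_mult: "x \<in> K \<Longrightarrow> y \<in> K \<Longrightarrow> x \<otimes> y \<in> K"
    and K_inv: "x \<in> K \<Longrightarrow> x \<noteq> \<zero> \<Longrightarrow> inv x \<in> K"
    and \<theta>_carrier: "\<theta> \<in> carrier E" and \<theta>_notin: "\<theta> \<notin> K"
    and basis: "x \<in> carrier E \<Longrightarrow> \<exists>s\<in>K. \<exists>t\<in>K. x = s \<oplus> t \<otimes> \<theta>"
begin

lemma KE [simp, intro]: "x \<in> K \<Longrightarrow> x \<in> carrier E"
  using K_carrier by blast

lemmas K_closed = K_zero K_one K_add K_minus K_mult K_inv

lemma inv_E:
  assumes "x \<in> carrier E" "x \<noteq> \<zero>"
  shows "inv x \<in> carrier E" "inv x \<otimes> x = \<one>" "x \<otimes> inv x = \<one>"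
  using assms field_Units by auto

lemma eq_if_diff_zero: "x \<in> carrier E \<Longrightarrow> y \<in> carrier E \<Longrightarrow> x \<oplus> \<ominus> y = \<zero> \<Longrightarrow> x = y"
  using minus_equality by fastforce

lemma basis_unique:
  assumes "s \<in> K" "t \<in> K" "s' \<in> K" "t' \<in> K" "s \<oplus> t \<otimes> \<theta> = s' \<oplus> t' \<otimes> \<theta>"
  shows "s = s' \<and> t = t'"
proof -
  note [simp] = \<theta>_carrier
  define d where "d = t \<oplus> \<ominus> t'"
  have d: "d \<in> K" using assms by (simp add: d_def K_closed)
  have "d \<otimes> \<theta> = (s \<oplus> t \<otimes> \<theta>) \<oplus> \<ominus> s \<oplus> \<ominus> (t' \<otimes> \<theta>)"
    unfolding d_def using assms(1-4) \<theta>_carrier KE by algebra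
  also have "\<dots> = s' \<oplus> \<ominus> s"
    unfolding assms(5) using assms(1-4) \<theta>_carrier KE by algebra
  finally have e: "d \<otimes> \<theta> = s' \<oplus> \<ominus> s" .
  have "d = \<zero>"
  proof (rule ccontr)
    assume d0: "d \<noteq> \<zero>"
    have "\<theta> = inv d \<otimes> (d \<otimes> \<theta>)" using inv_E[OF KE[OF d] d0] d by (simp flip: m_assoc)
    also have "\<dots> \<in> K" unfolding e using d d0 assms by (simp add: K_closed)
    finally show False using \<theta>_notin by simp
  qed
  then have "t = t'" using eq_if_diff_zero assms by (simp add: d_def)
  moreover have "s' \<oplus> \<ominus> s = \<zero>" using e \<open>d = \<zero>\<close> by simp
  then have "s' = s" using eq_if_diff_zero assms by simp
  ultimately show ?thesis by simp
qed

end

text \<open>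
  The last two assumptions say that \<open>f \<mapsto> \<sigma> f x\<close> maps \<open>K\<close> bijectively onto \<open>E / K x\<close>. If \<open>\<psi>\<close> has no
  eigenvector over \<open>K\<close>, then \<open>\<sigma> f x = f \<psi> x\<close> works for all \<open>f\<close>. Over the field with two elements every
  such \<open>\<psi>\<close> is a multiplication by an element of \<open>E\<close>, hence the freedom in the choice of \<open>\<sigma> \<zero>\<close>.
\<close>

locale denniston = quad_over +
  fixes \<psi> :: "'a \<Rightarrow> 'a" and \<sigma> :: "'a \<Rightarrow> 'a \<Rightarrow> 'a"
  assumes \<psi>_carrier: "x \<in> carrier E \<Longrightarrow> \<psi> x \<in> carrier E"
    and \<psi>_add: "x \<in> carrier E \<Longrightarrow> y \<in> carrier E \<Longrightarrow> \<psi> (x \<oplus> y) = \<psi> x \<oplus> \<psi> y"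
    and \<psi>_smult: "k \<in> K \<Longrightarrow> x \<in> carrier E \<Longrightarrow> \<psi> (k \<otimes> x) = k \<otimes> \<psi> x"
    and \<psi>_nonlinear: "\<psi> \<theta> \<noteq> \<theta> \<otimes> \<psi> \<one>"
    and \<sigma>_carrier: "f \<in> K \<Longrightarrow> x \<in> carrier E \<Longrightarrow> \<sigma> f x \<in> carrier E"
    and \<sigma>_nonzero: "f \<in> K \<Longrightarrow> f \<noteq> \<zero> \<Longrightarrow> x \<in> carrier E \<Longrightarrow> \<sigma> f x = f \<otimes> \<psi> x"
    and \<sigma>_smult: "f \<in> K \<Longrightarrow> k \<in> K \<Longrightarrow> k \<noteq> \<zero> \<Longrightarrow> x \<in> carrier E \<Longrightarrow> \<sigma> f (k \<otimes> x) = k \<otimes> \<sigma> f x"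
    and \<sigma>_cover: "x \<in> carrier E \<Longrightarrow> x \<noteq> \<zero> \<Longrightarrow> y \<in> carrier E \<Longrightarrow>
      \<exists>f\<in>K. \<exists>t\<in>K. y = \<sigma> f x \<oplus> t \<otimes> x"
    and \<sigma>_unique: "x \<in> carrier E \<Longrightarrow> x \<noteq> \<zero> \<Longrightarrow> f \<in> K \<Longrightarrow> f' \<in> K \<Longrightarrow> t \<in> K \<Longrightarrow> t' \<in> K \<Longrightarrow>
      \<sigma> f x \<oplus> t \<otimes> x = \<sigma> f' x \<oplus> t' \<otimes> x \<Longrightarrow> f = f'"
begin

definition graph :: "'a \<Rightarrow> 'a \<Rightarrow> 'a \<Rightarrow> ('a \<times> 'a) set" where
  "graph e c h = {(x, e \<otimes> (c \<otimes> x \<oplus> h \<otimes> \<psi> x)) | x. x \<in> carrier E}"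

text \<open>For \<open>f \<noteq> \<zero>\<close> these are the lines of the opposite regulus: such
  a line meets x = 0 in the multiples of \<open>(\<zero>, e \<otimes> x)\<close> and, taking
  \<open>a = \<one>\<close> and \<open>b = c\<close>, meets each graph with parameters
  \<open>c \<in> K\<close> and \<open>f\<close>. They are called transversals below.\<close>

definition tang :: "'a \<Rightarrow> 'a \<Rightarrow> 'a \<Rightarrow> ('a \<times> 'a) set" where
  "tang e f x = {(a \<otimes> x, e \<otimes> (a \<otimes> \<sigma> f x \<oplus> b \<otimes> x)) | a b. a \<in> K \<and> b \<in> K}"

text \<open>
  The maps \<open>x \<mapsto> c x + h \<psi> x\<close> are all the \<open>K\<close>-linear maps of \<open>E\<close>. For \<open>f \<noteq> \<zero>\<close> the lines
  \<open>y = e (c x + f \<psi> x)\<close> with \<open>c \<in> E\<close> and the line \<open>x = \<zero>\<close> form a regular spread, and \<open>spread e f\<close>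
  arises from it by reversing the regulus \<open>c \<in> K\<close>. The graphs removed in this way are the ones
  that \<open>spread e \<zero>\<close> uses.
\<close>

definition coeffs :: "'a \<Rightarrow> ('a \<times> 'a) set" where
  "coeffs f = (if f = \<zero> then K \<times> (K - {\<zero>}) else (carrier E - K) \<times> {f})"

definition spread :: "'a \<Rightarrow> 'a \<Rightarrow> ('a \<times> 'a) set set" where
  "spread e f = {graph e c h | c h. (c, h) \<in> coeffs f} \<union> {tang e f x | x. x \<in> carrier E \<and> x \<noteq> \<zero>}"

text \<open>Representatives, up to factors in \<open>K\<close>, of the elements of \<open>E\<close>
  outside \<open>K\<close>: since s + t\<theta> = t (\<theta> + s/t), the products
  \<open>e \<otimes> h\<close> with \<open>h\<close> nonzero in \<open>K\<close> reach each such
  element exactly once.\<close>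

definition slopes :: "'a set" where
  "slopes = (\<lambda>s. \<theta> \<oplus> s) ` K"

definition kspan :: "'a \<times> 'a \<Rightarrow> 'a \<times> 'a \<Rightarrow> ('a \<times> 'a) set" where
  "kspan p p' = {(a \<otimes> fst p \<oplus> b \<otimes> fst p', a \<otimes> snd p \<oplus> b \<otimes> snd p') | a b. a \<in> K \<and> b \<in> K}"

text \<open>Independence over all of \<open>E\<close>, although the span \<open>kspan\<close> is
  taken over \<open>K\<close>: it prevents the \<open>K\<close>-line from lying inside a single
  point over \<open>E\<close>.\<close>

definition eindep :: "'a \<times> 'a \<Rightarrow> 'a \<times> 'a \<Rightarrow> bool" where
  "eindep p p' \<longleftrightarrow> (\<forall>a\<in>carrier E. \<forall>b\<in>carrier E. a \<otimes> fst p \<oplus> b \<otimes> fst p' = \<zero> \<longrightarrow>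
      a \<otimes> snd p \<oplus> b \<otimes> snd p' = \<zero> \<longrightarrow> a = \<zero> \<and> b = \<zero>)"

lemma slopes_carrier: "e \<in> slopes \<Longrightarrow> e \<in> carrier E"
  using \<theta>_carrier by (auto simp: slopes_def)

text \<open>The coefficients of \<open>\<theta>\<close> give \<open>a = b\<close>; cancelling this
  factor in the constant terms gives equal slopes.\<close>

lemma slopes_proportional:
  assumes "e \<in> slopes" "e' \<in> slopes" "a \<in> K" "b \<in> K" "a \<noteq> \<zero>" "e \<otimes> a = e' \<otimes> b"
  shows "e = e' \<and> a = b"
proof -
  obtain s s' where s: "s \<in> K" "s' \<in> K" "e = \<theta> \<oplus> s" "e' = \<theta> \<oplus> s'"
    using assms by (auto simp: slopes_def)
  have "s \<otimes> a \<oplus> a \<otimes> \<theta> = s' \<otimes> b \<oplus> b \<otimes> \<theta>"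
    using assms(6) s assms(3,4) \<theta>_carrier by (simp add: l_distr r_distr m_ac a_ac)
  then have "s \<otimes> a = s' \<otimes> b \<and> a = b"
    by (rule basis_unique[rotated 4]) (use s assms K_mult in auto)
  then have "s \<otimes> a = s' \<otimes> a" "a = b" by auto
  then show ?thesis using s assms(3,5) m_rcancel[of a s s'] by auto
qed

lemma slopes_nonzero: "e \<in> slopes \<Longrightarrow> e \<noteq> \<zero>"
proof
  assume "e \<in> slopes" "e = \<zero>"
  then obtain s where s: "s \<in> K" "\<theta> \<oplus> s = \<zero>" by (auto simp: slopes_def)
  then have "\<theta> = \<ominus> s" using \<theta>_carrier minus_equality by fastforce
  then show False using \<theta>_notin K_minus s by simp
qed

lemma card_slopes: "card slopes = card K"
proof -
  have "inj_on (\<lambda>s. \<theta> \<oplus> s) K" using \<theta>_carrier by (auto simp: inj_on_def)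
  then show ?thesis by (simp add: slopes_def card_image)
qed

lemma coeffs_carrier: "(c, h) \<in> coeffs f \<Longrightarrow> f \<in> K \<Longrightarrow> c \<in> carrier E \<and> h \<in> K \<and> h \<noteq> \<zero>"
  by (auto simp: coeffs_def split: if_splits)

lemma \<psi>_zero: "\<psi> \<zero> = \<zero>"
  using \<psi>_smult[of \<zero> \<zero>] \<psi>_carrier[of \<zero>] K_zero by simp

lemma \<psi>_basis:
  assumes "a \<in> K" "b \<in> K"
  shows "\<psi> (a \<oplus> b \<otimes> \<theta>) = a \<otimes> \<psi> \<one> \<oplus> b \<otimes> \<psi> \<theta>"
  using assms \<theta>_carrier \<psi>_add[of a "b \<otimes> \<theta>"] \<psi>_smult[of a \<one>] \<psi>_smult[of b \<theta>] by simp

lemma graph_eq_kspan: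
  assumes "e \<in> carrier E" "c \<in> carrier E" "h \<in> K"
  shows "graph e c h = kspan (\<one>, e \<otimes> (c \<oplus> h \<otimes> \<psi> \<one>)) (\<theta>, e \<otimes> (c \<otimes> \<theta> \<oplus> h \<otimes> \<psi> \<theta>))"
proof -
  note [simp] = \<theta>_carrier \<psi>_carrier
  have eq: "e \<otimes> (c \<otimes> (a \<oplus> b \<otimes> \<theta>) \<oplus> h \<otimes> \<psi> (a \<oplus> b \<otimes> \<theta>))
    = a \<otimes> (e \<otimes> (c \<oplus> h \<otimes> \<psi> \<one>)) \<oplus> b \<otimes> (e \<otimes> (c \<otimes> \<theta> \<oplus> h \<otimes> \<psi> \<theta>))"
    if "a \<in> K" "b \<in> K" for a b
    using that assms unfolding \<psi>_basis[OF that] by (simp add: l_distr r_distr m_ac a_ac)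
  have "graph e c h = {(a \<oplus> b \<otimes> \<theta>, e \<otimes> (c \<otimes> (a \<oplus> b \<otimes> \<theta>) \<oplus> h \<otimes> \<psi> (a \<oplus> b \<otimes> \<theta>))) | a b. a \<in> K \<and> b \<in> K}"
    (is "_ = ?R")
  proof
    show "graph e c h \<subseteq> ?R" unfolding graph_def using basis by blast
    show "?R \<subseteq> graph e c h" unfolding graph_def by auto
  qed
  also have "\<dots> = kspan (\<one>, e \<otimes> (c \<oplus> h \<otimes> \<psi> \<one>)) (\<theta>, e \<otimes> (c \<otimes> \<theta> \<oplus> h \<otimes> \<psi> \<theta>))"
    unfolding kspan_def using eq by (intro Collect_cong ex_cong1) (auto simp del: r_distr)
  finally show ?thesis .
qed

lemma tang_eq_kspan:
  assumes "e \<in> carrier E" "f \<in> K" "x \<in> carrier E"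
  shows "tang e f x = kspan (x, e \<otimes> \<sigma> f x) (\<zero>, e \<otimes> x)"
proof -
  have "e \<otimes> (a \<otimes> \<sigma> f x \<oplus> b \<otimes> x) = a \<otimes> (e \<otimes> \<sigma> f x) \<oplus> b \<otimes> (e \<otimes> x) \<and> a \<otimes> x = a \<otimes> x \<oplus> b \<otimes> \<zero>"
    if "a \<in> K" "b \<in> K" for a b
    using that assms \<sigma>_carrier by (simp add: l_distr r_distr m_ac a_ac)
  then show ?thesis
    unfolding kspan_def tang_def by (intro Collect_cong ex_cong1) auto
qed

text \<open>Independence over \<open>E\<close> is a nonzero determinant of the two spanning pairs.
  For a graph, spanned by the points above \<open>\<one>\<close> and \<open>\<theta>\<close>, it is
  e h (\<psi>(\<theta>) - \<theta> \<psi>(1)), nonzero because \<psi> is not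
  \<open>E\<close>-linear; for a transversal it is e x^2.\<close>

lemma spread_lines:
  assumes "e \<in> slopes" "f \<in> K" "g \<in> spread e f"
  shows "\<exists>p\<in>carrier E \<times> carrier E. \<exists>p'\<in>carrier E \<times> carrier E. g = kspan p p' \<and> eindep p p'"
proof -
  note [simp] = \<theta>_carrier \<psi>_carrier
  have e: "e \<in> carrier E" "e \<noteq> \<zero>" using assms slopes_carrier slopes_nonzero by auto
  consider c h where "g = graph e c h" "(c, h) \<in> coeffs f"
    | x where "g = tang e f x" "x \<in> carrier E" "x \<noteq> \<zero>"
    using assms(3) by (auto simp: spread_def)
  then show ?thesis
  proof cases
    case 1
    then have ch: "c \<in> carrier E" "h \<in> K" "h \<noteq> \<zero>" using coeffs_carrier assms by auto
    let ?p = "(\<one>, e \<otimes> (c \<oplus> h \<otimes> \<psi> \<one>))" and ?p' = "(\<theta>, e \<otimes> (c \<otimes> \<theta> \<oplus> h \<otimes> \<psi> \<theta>))"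
    have "eindep ?p ?p'"
      unfolding eindep_def fst_conv snd_conv
    proof (intro ballI impI)
      fix a b assume ab: "a \<in> carrier E" "b \<in> carrier E" and 1: "a \<otimes> \<one> \<oplus> b \<otimes> \<theta> = \<zero>"
        and 2: "a \<otimes> (e \<otimes> (c \<oplus> h \<otimes> \<psi> \<one>)) \<oplus> b \<otimes> (e \<otimes> (c \<otimes> \<theta> \<oplus> h \<otimes> \<psi> \<theta>)) = \<zero>"
      \<comment> \<open>Subtracting a multiple of the first equation from the second eliminates
        \<open>a\<close> and leaves \<open>b\<close> times the determinant.\<close>
      have "b \<otimes> (e \<otimes> (h \<otimes> (\<psi> \<theta> \<oplus> \<ominus> (\<theta> \<otimes> \<psi> \<one>))))
        = (a \<otimes> (e \<otimes> (c \<oplus> h \<otimes> \<psi> \<one>)) \<oplus> b \<otimes> (e \<otimes> (c \<otimes> \<theta> \<oplus> h \<otimes> \<psi> \<theta>)))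
          \<oplus> \<ominus> ((a \<otimes> \<one> \<oplus> b \<otimes> \<theta>) \<otimes> (e \<otimes> (c \<oplus> h \<otimes> \<psi> \<one>)))"
      proof -
        have "\<psi> \<theta> \<in> carrier E" "\<psi> \<one> \<in> carrier E" "h \<in> carrier E" using ch by auto
        then show ?thesis using ab ch(1) e(1) \<theta>_carrier by algebra
      qed
      also have "\<dots> = \<zero>" unfolding 1 2 using e ch by simp
      finally have z: "b \<otimes> (e \<otimes> (h \<otimes> (\<psi> \<theta> \<oplus> \<ominus> (\<theta> \<otimes> \<psi> \<one>)))) = \<zero>" .
      have "\<psi> \<theta> \<oplus> \<ominus> (\<theta> \<otimes> \<psi> \<one>) \<noteq> \<zero>"
        using \<psi>_nonlinear eq_if_diff_zero[of "\<psi> \<theta>" "\<theta> \<otimes> \<psi> \<one>"] by auto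
      then have b: "b = \<zero>" using z ab e ch by (simp add: integral_iff)
      then show "a = \<zero> \<and> b = \<zero>" using 1 ab by simp
    qed
    moreover have "g = kspan ?p ?p'" using graph_eq_kspan e ch 1 by simp
    moreover have "?p \<in> carrier E \<times> carrier E" "?p' \<in> carrier E \<times> carrier E" using e ch by simp_all
    ultimately show ?thesis by blast
  next
    case 2
    let ?p = "(x, e \<otimes> \<sigma> f x)" and ?p' = "(\<zero>, e \<otimes> x)"
    have s: "\<sigma> f x \<in> carrier E" using 2 assms \<sigma>_carrier by simp
    have "eindep ?p ?p'"
      unfolding eindep_def using 2 e s by (auto simp: integral_iff)
    moreover have "g = kspan ?p ?p'" using tang_eq_kspan e 2 assms by simp
    moreover have "?p \<in> carrier E \<times> carrier E" "?p' \<in> carrier E \<times> carrier E" using e 2 s by simp_all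
    ultimately show ?thesis by blast
  qed
qed

text \<open>A transversal thus depends only on the \<open>K\<close>-multiples of \<open>x\<close>,
  so a spread contains one for each point of the line x = 0.\<close>

lemma tang_smult:
  assumes "e \<in> carrier E" "f \<in> K" "x \<in> carrier E" "k \<in> K" "k \<noteq> \<zero>"
  shows "tang e f (k \<otimes> x) = tang e f x"
proof -
  have sub: "tang e f (k \<otimes> x) \<subseteq> tang e f x"
    if "x \<in> carrier E" "k \<in> K" "k \<noteq> \<zero>" for x k
  proof
    fix v assume "v \<in> tang e f (k \<otimes> x)"
    then obtain a b where ab: "a \<in> K" "b \<in> K"
      "v = (a \<otimes> (k \<otimes> x), e \<otimes> (a \<otimes> \<sigma> f (k \<otimes> x) \<oplus> b \<otimes> (k \<otimes> x)))"
      by (auto simp: tang_def)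
    then have "v = ((a \<otimes> k) \<otimes> x, e \<otimes> ((a \<otimes> k) \<otimes> \<sigma> f x \<oplus> (b \<otimes> k) \<otimes> x))"
      using that assms(1,2) \<sigma>_carrier by (simp add: \<sigma>_smult m_assoc)
    then show "v \<in> tang e f x" using ab that K_mult unfolding tang_def by blast
  qed
  have "tang e f x = tang e f (inv k \<otimes> (k \<otimes> x))"
    using inv_E[of k] assms by (simp flip: m_assoc)
  also have "\<dots> \<subseteq> tang e f (k \<otimes> x)"
    using sub[of "k \<otimes> x" "inv k"] assms K_inv inv_E[of k] by (metis KE m_closed l_null zero_not_one)
  finally show ?thesis using sub[OF assms(3-5)] by blast
qed

lemma graph_mem:
  assumes "e \<in> carrier E" "e \<noteq> \<zero>" "c \<in> carrier E" "h \<in> K" "x \<in> carrier E" "y \<in> carrier E"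
  shows "(x, e \<otimes> y) \<in> graph e c h \<longleftrightarrow> y = c \<otimes> x \<oplus> h \<otimes> \<psi> x"
  using assms \<psi>_carrier by (auto simp: graph_def m_lcancel)

lemma tang_mem_nonzero:
  assumes "e \<in> carrier E" "e \<noteq> \<zero>" "f \<in> K" "x0 \<in> carrier E" "x \<in> carrier E" "x \<noteq> \<zero>" "y \<in> carrier E"
    "(x, e \<otimes> y) \<in> tang e f x0"
  shows "tang e f x0 = tang e f x \<and> (\<exists>t\<in>K. y = \<sigma> f x \<oplus> t \<otimes> x)"
proof -
  note [simp] = \<sigma>_carrier
  obtain a b where ab: "a \<in> K" "b \<in> K" "x = a \<otimes> x0" "e \<otimes> y = e \<otimes> (a \<otimes> \<sigma> f x0 \<oplus> b \<otimes> x0)"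
    using assms(8) by (auto simp: tang_def)
  have a0: "a \<noteq> \<zero>" using ab assms by auto
  have y: "y = a \<otimes> \<sigma> f x0 \<oplus> b \<otimes> x0"
    using ab assms by (simp add: m_lcancel)
  have "a \<otimes> \<sigma> f x0 = \<sigma> f x" using \<sigma>_smult ab a0 assms by simp
  moreover have "b \<otimes> x0 = (b \<otimes> inv a) \<otimes> x"
  proof -
    have "(b \<otimes> inv a) \<otimes> x = b \<otimes> ((inv a \<otimes> a) \<otimes> x0)"
      using ab(1-3) inv_E(1)[of a] a0 assms(4) by (simp add: m_assoc)
    then show ?thesis using inv_E(2)[of a] a0 ab assms(4) by simp
  qed
  ultimately have "y = \<sigma> f x \<oplus> (b \<otimes> inv a) \<otimes> x" using y by simp
  moreover have "b \<otimes> inv a \<in> K" using ab a0 by (simp add: K_closed)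
  moreover have "tang e f x0 = tang e f x" using tang_smult ab a0 assms by simp
  ultimately show ?thesis by blast
qed

lemma tang_mem_zero:
  assumes "e \<in> carrier E" "e \<noteq> \<zero>" "f \<in> K" "x0 \<in> carrier E" "x0 \<noteq> \<zero>" "y \<in> carrier E" "y \<noteq> \<zero>"
    "(\<zero>, e \<otimes> y) \<in> tang e f x0"
  shows "tang e f x0 = tang e f y"
proof -
  obtain a b where ab: "a \<in> K" "b \<in> K" "\<zero> = a \<otimes> x0" "e \<otimes> y = e \<otimes> (a \<otimes> \<sigma> f x0 \<oplus> b \<otimes> x0)"
    using assms(8) by (auto simp: tang_def)
  have a0: "a = \<zero>" using ab assms integral_iff[of a x0] by auto
  then have y: "y = b \<otimes> x0"
    using ab(2,4) assms(1-6) \<sigma>_carrier by (simp add: m_lcancel)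
  then have "b \<noteq> \<zero>" using assms by auto
  then show ?thesis using tang_smult y ab assms by simp
qed

text \<open>After division of the second coordinate by \<open>e\<close>, let \<open>x\<close> be
  nonzero. If \<open>f \<noteq> \<zero>\<close>, then z - f \<psi>(x) = c x for one
  \<open>c\<close>, and the point is on a transversal or on a graph according to whether
  \<open>c\<close> lies in \<open>K\<close>. If \<open>f = \<zero>\<close>, the coset of
  \<open>z\<close> modulo K x decides.\<close>

lemma spread_cover:
  assumes "e \<in> slopes" "f \<in> K" "x \<in> carrier E" "y \<in> carrier E"
  shows "\<exists>g\<in>spread e f. (x, y) \<in> g"
proof -
  note [simp] = \<psi>_carrier \<sigma>_carrier
  have e: "e \<in> carrier E" "e \<noteq> \<zero>" using assms slopes_carrier slopes_nonzero by auto
  define z where "z = inv e \<otimes> y"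
  have z: "z \<in> carrier E" "y = e \<otimes> z"
    using inv_E[OF e] e assms by (simp_all add: z_def flip: m_assoc)
  have tang_x: "\<exists>g\<in>spread e f. (x, y) \<in> g" if "x \<noteq> \<zero>" "t \<in> K" "z = \<sigma> f x \<oplus> t \<otimes> x" for t
  proof -
    have "(x, y) = (\<one> \<otimes> x, e \<otimes> (\<one> \<otimes> \<sigma> f x \<oplus> t \<otimes> x))" using that z assms by simp
    then have "(x, y) \<in> tang e f x" using that K_one unfolding tang_def by blast
    then show ?thesis using that assms unfolding spread_def by blast
  qed
  show ?thesis
  proof (cases "x = \<zero>")
    case True
    \<comment> \<open>A nonzero \<open>z\<close> selects the transversal through the point; the zero
      vector lies on all of them, and \<open>\<one>\<close> is an arbitrary choice.\<close>
    define w where "w = (if z = \<zero> then \<one> else z)"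
    have w: "w \<in> carrier E" "w \<noteq> \<zero>" using z by (auto simp: w_def)
    have "(x, y) \<in> tang e f w"
    proof -
      define b where "b = (if z = \<zero> then \<zero> else \<one>)"
      have "b \<in> K" using K_closed by (simp add: b_def)
      moreover have "(x, y) = (\<zero> \<otimes> w, e \<otimes> (\<zero> \<otimes> \<sigma> f w \<oplus> b \<otimes> w))"
        using True z w assms by (simp add: b_def w_def)
      ultimately show ?thesis using K_zero unfolding tang_def by blast
    qed
    then show ?thesis using w unfolding spread_def by blast
  next
    case x: False
    show ?thesis
    proof (cases "f = \<zero>")
      case False
      define c where "c = inv x \<otimes> (z \<oplus> \<ominus> (f \<otimes> \<psi> x))"
      have c: "c \<in> carrier E" using inv_E[of x] x z assms by (simp add: c_def)
      have "c \<otimes> x = (inv x \<otimes> x) \<otimes> (z \<oplus> \<ominus> (f \<otimes> \<psi> x))"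
        using inv_E(1)[of x] x z assms by (simp add: c_def m_ac)
      then have cx: "c \<otimes> x = z \<oplus> \<ominus> (f \<otimes> \<psi> x)" using inv_E(2)[of x] x z assms by simp
      have zc: "z = c \<otimes> x \<oplus> f \<otimes> \<psi> x"
        unfolding cx using z assms by (simp add: a_assoc l_neg)
      show ?thesis
      proof (cases "c \<in> K")
        case True
        have "z = \<sigma> f x \<oplus> c \<otimes> x" using zc \<sigma>_nonzero False assms c by (simp add: a_comm)
        then show ?thesis using tang_x x True by blast
      next
        case cK: False
        then have "(c, f) \<in> coeffs f" using c False by (simp add: coeffs_def)
        moreover have "(x, y) \<in> graph e c f" unfolding z(2) using graph_mem e c assms z zc by simp
        ultimately show ?thesis unfolding spread_def by blast
      qed
    next
      case f0: True
      obtain h t where h: "h \<in> K" "t \<in> K" "z = \<sigma> h x \<oplus> t \<otimes> x"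
        using \<sigma>_cover[of x z] x z assms by blast
      show ?thesis
      proof (cases "h = \<zero>")
        case True
        then show ?thesis using tang_x[OF x h(2)] h f0 by simp
      next
        case False
        then have "z = t \<otimes> x \<oplus> h \<otimes> \<psi> x" using h \<sigma>_nonzero assms by (simp add: a_comm)
        then have "(x, y) \<in> graph e t h" unfolding z(2) using graph_mem e h assms z by simp
        moreover have "(t, h) \<in> coeffs f" using f0 h False by (simp add: coeffs_def)
        ultimately show ?thesis unfolding spread_def by blast
      qed
    qed
  qed
qed

lemma spread_disjoint:
  assumes "e \<in> slopes" "f \<in> K" "g \<in> spread e f" "g' \<in> spread e f"
    "x \<in> carrier E" "y \<in> carrier E" "(x, y) \<in> g" "(x, y) \<in> g'" "x \<noteq> \<zero> \<or> y \<noteq> \<zero>"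
  shows "g = g'"
proof -
  note [simp] = \<psi>_carrier \<sigma>_carrier
  have e: "e \<in> carrier E" "e \<noteq> \<zero>" using assms slopes_carrier slopes_nonzero by auto
  define z where "z = inv e \<otimes> y"
  have z: "z \<in> carrier E" "y = e \<otimes> z"
    using inv_E[OF e] e assms by (simp_all add: z_def flip: m_assoc)
  show ?thesis
  proof (cases "x = \<zero>")
    case True
    then have z0: "z \<noteq> \<zero>" using z e assms by auto
    have "g = tang e f z" if "g \<in> spread e f" "(x, y) \<in> g" for g
    proof -
      consider c h where "g = graph e c h" "(c, h) \<in> coeffs f"
        | w where "g = tang e f w" "w \<in> carrier E" "w \<noteq> \<zero>"
        using \<open>g \<in> spread e f\<close> by (auto simp: spread_def)
      then show ?thesis
      proof cases
        case 1
        then have "c \<in> carrier E" "h \<in> K" using coeffs_carrier assms by auto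
        then have "z = \<zero>" using graph_mem[of e c h x z] e z \<open>(x, y) \<in> g\<close> 1 True \<psi>_zero by simp
        then show ?thesis using z0 by simp
      next
        case 2
        then show ?thesis using tang_mem_zero[of e f w z] e z z0 assms \<open>(x, y) \<in> g\<close> True by simp
      qed
    qed
    then show ?thesis using assms by metis
  next
    case x: False
    \<comment> \<open>the line through \<open>(x, y)\<close> is determined by the coset of \<open>z\<close> modulo \<open>K x\<close>\<close>
    have char: "(\<exists>c h. g = graph e c h \<and> (c, h) \<in> coeffs f \<and> z = c \<otimes> x \<oplus> h \<otimes> \<psi> x)
       \<or> (g = tang e f x \<and> (\<exists>t\<in>K. z = \<sigma> f x \<oplus> t \<otimes> x))"
      if g: "g \<in> spread e f" "(x, y) \<in> g" for g
    proof -
      consider c h where "g = graph e c h" "(c, h) \<in> coeffs f"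
        | w where "g = tang e f w" "w \<in> carrier E" "w \<noteq> \<zero>"
        using g(1) by (auto simp: spread_def)
      then show ?thesis
      proof cases
        case 1
        then have "c \<in> carrier E" "h \<in> K" using coeffs_carrier assms by auto
        then have "z = c \<otimes> x \<oplus> h \<otimes> \<psi> x" using graph_mem[of e c h x z] e z g(2) 1 assms by simp
        then show ?thesis using 1 by blast
      next
        case 2
        then show ?thesis using tang_mem_nonzero[of e f w x z] e z x assms g(2) by simp
      qed
    qed
    \<comment> \<open>For \<open>f = \<zero>\<close> the graphs lie in the cosets of
      \<open>\<sigma> h x\<close> with \<open>h \<noteq> \<zero>\<close> and the transversal in that
      of \<open>\<sigma> \<zero> x\<close>; for \<open>f \<noteq> \<zero>\<close> the two kinds are
      separated by whether the coefficient of \<open>x\<close> is in \<open>K\<close>.\<close>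
    have mixed: False if "(c, h) \<in> coeffs f" "z = c \<otimes> x \<oplus> h \<otimes> \<psi> x" "t \<in> K" "z = \<sigma> f x \<oplus> t \<otimes> x" for c h t
    proof (cases "f = \<zero>")
      case True
      then have ch: "c \<in> K" "h \<in> K" "h \<noteq> \<zero>" using that by (auto simp: coeffs_def)
      then have "\<sigma> h x \<oplus> c \<otimes> x = \<sigma> f x \<oplus> t \<otimes> x"
        using that \<sigma>_nonzero[of h x] assms by (simp add: a_comm)
      then have "h = f" using \<sigma>_unique[of x h f c t] ch x assms that by blast
      then show False using True ch by simp
    next
      case False
      then have ch: "c \<in> carrier E" "c \<notin> K" "h = f" using that by (auto simp: coeffs_def)
      then have "f \<otimes> \<psi> x \<oplus> c \<otimes> x = f \<otimes> \<psi> x \<oplus> t \<otimes> x"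
        using that \<sigma>_nonzero[of f x] False assms by (simp add: a_comm)
      then have "c \<otimes> x = t \<otimes> x" using ch that assms by simp
      then show False using m_rcancel[of x c t] ch x that assms by auto
    qed
    have same: "c = c' \<and> h = h'" if "(c, h) \<in> coeffs f" "z = c \<otimes> x \<oplus> h \<otimes> \<psi> x"
      "(c', h') \<in> coeffs f" "z = c' \<otimes> x \<oplus> h' \<otimes> \<psi> x" for c h c' h'
    proof -
      have C: "c \<in> carrier E" "h \<in> K" "h \<noteq> \<zero>" "c' \<in> carrier E" "h' \<in> K" "h' \<noteq> \<zero>"
        using coeffs_carrier that assms by auto
      have "h = h'"
      proof (cases "f = \<zero>")
        case True
        then have ch: "c \<in> K" "c' \<in> K" using that by (auto simp: coeffs_def)
        then have "\<sigma> h x \<oplus> c \<otimes> x = \<sigma> h' x \<oplus> c' \<otimes> x"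
          using that C \<sigma>_nonzero[of h x] \<sigma>_nonzero[of h' x] assms by (simp add: a_comm)
        then show ?thesis using \<sigma>_unique[of x h h' c c'] C ch x assms that by blast
      qed (use that in \<open>auto simp: coeffs_def\<close>)
      moreover from this have "c \<otimes> x = c' \<otimes> x" using that C assms by simp
      then have "c = c'" using m_rcancel[of x c c'] C x assms by simp
      ultimately show ?thesis by simp
    qed
    show ?thesis
      using char[OF assms(3,7)] char[OF assms(4,8)] mixed same by metis
  qed
qed

text \<open>This is what makes the spreads pairwise disjoint as sets of lines. A graph determines
  \<open>e \<otimes> c\<close> and \<open>e \<otimes> h\<close>, because the identity and \<psi> are
  independent over \<open>E\<close>, and \<open>slopes_proportional\<close> splits the products. A
  transversal determines \<open>e\<close> from its points above zero and its projection to the first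
  coordinate, and then \<open>f\<close> from the coset of \<open>\<sigma> f x\<close>.\<close>

lemma spread_index_unique:
  assumes "e \<in> slopes" "f \<in> K" "e' \<in> slopes" "f' \<in> K" "g \<in> spread e f" "g \<in> spread e' f'"
  shows "e = e' \<and> f = f'"
proof -
  note [simp] = \<psi>_carrier \<sigma>_carrier \<theta>_carrier
  have e: "e \<in> carrier E" "e \<noteq> \<zero>" "e' \<in> carrier E" "e' \<noteq> \<zero>"
    using assms slopes_carrier slopes_nonzero by auto
  \<comment> \<open>A graph has only the zero vector above zero, a transversal has a whole point
    there. All parameters are generalised so that both orders of the two kinds are covered.\<close>
  have mixed: False if "graph e c h = tang e' f' x" "x \<in> carrier E" "x \<noteq> \<zero>"
    "e \<in> carrier E" "e' \<in> carrier E" "e' \<noteq> \<zero>" "c \<in> carrier E" "h \<in> K" "f' \<in> K" for e c h e' f' x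
  proof -
    have "(\<zero>, e' \<otimes> x) = (\<zero> \<otimes> x, e' \<otimes> (\<zero> \<otimes> \<sigma> f' x \<oplus> \<one> \<otimes> x))" using that by simp
    then have "(\<zero>, e' \<otimes> x) \<in> tang e' f' x" using K_zero K_one unfolding tang_def by blast
    then have "(\<zero>, e' \<otimes> x) \<in> graph e c h" using that by simp
    then have "e' \<otimes> x = \<zero>" using that \<psi>_zero by (auto simp: graph_def)
    then show False using that integral_iff[of e' x] by auto
  qed
  consider (gg) c h c' h' where "g = graph e c h" "(c, h) \<in> coeffs f" "g = graph e' c' h'" "(c', h') \<in> coeffs f'"
    | (tt) x x' where "g = tang e f x" "x \<in> carrier E" "x \<noteq> \<zero>" "g = tang e' f' x'" "x' \<in> carrier E" "x' \<noteq> \<zero>"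
    using assms(5,6) mixed e coeffs_carrier assms(2,4) unfolding spread_def by blast
  then show ?thesis
  proof cases
    case gg
    then have C: "c \<in> carrier E" "h \<in> K" "h \<noteq> \<zero>" "c' \<in> carrier E" "h' \<in> K" "h' \<noteq> \<zero>"
      using coeffs_carrier assms by auto
    have eq: "e \<otimes> (c \<otimes> x \<oplus> h \<otimes> \<psi> x) = e' \<otimes> (c' \<otimes> x \<oplus> h' \<otimes> \<psi> x)" if "x \<in> carrier E" for x
    proof -
      have "(x, e \<otimes> (c \<otimes> x \<oplus> h \<otimes> \<psi> x)) \<in> graph e' c' h'" using gg that by (auto simp: graph_def)
      then show ?thesis by (auto simp: graph_def)
    qed
    define P where "P = e \<otimes> c \<oplus> \<ominus> (e' \<otimes> c')"
    define H where "H = e \<otimes> h \<oplus> \<ominus> (e' \<otimes> h')"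
    have PH: "P \<in> carrier E" "H \<in> carrier E" using C e by (auto simp: P_def H_def)
    have lin: "P \<otimes> x \<oplus> H \<otimes> \<psi> x = \<zero>" if x: "x \<in> carrier E" for x
    proof -
      have "P \<otimes> x \<oplus> H \<otimes> \<psi> x = e \<otimes> (c \<otimes> x \<oplus> h \<otimes> \<psi> x) \<oplus> \<ominus> (e' \<otimes> (c' \<otimes> x \<oplus> h' \<otimes> \<psi> x))"
      proof -
        have "\<psi> x \<in> carrier E" "h \<in> carrier E" "h' \<in> carrier E" using x C by auto
        then show ?thesis unfolding P_def H_def using x C(1,4) e(1,3) by algebra
      qed
      also have "\<dots> = \<zero>" unfolding eq[OF x] using x C e by (simp add: r_neg)
      finally show ?thesis .
    qed
    have "H \<otimes> (\<psi> \<theta> \<oplus> \<ominus> (\<theta> \<otimes> \<psi> \<one>)) = (P \<otimes> \<theta> \<oplus> H \<otimes> \<psi> \<theta>) \<oplus> \<ominus> (\<theta> \<otimes> (P \<otimes> \<one> \<oplus> H \<otimes> \<psi> \<one>))"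
    proof -
      have "\<psi> \<theta> \<in> carrier E" "\<psi> \<one> \<in> carrier E" by auto
      then show ?thesis using PH \<theta>_carrier by algebra
    qed
    also have "\<dots> = \<zero>" using lin[of \<theta>] lin[of \<one>] by simp
    finally have "H = \<zero>"
      using \<psi>_nonlinear eq_if_diff_zero[of "\<psi> \<theta>" "\<theta> \<otimes> \<psi> \<one>"] PH by (auto simp: integral_iff)
    moreover from this have "P = \<zero>" using lin[of \<one>] PH by simp
    ultimately have eh: "e \<otimes> h = e' \<otimes> h'" "e \<otimes> c = e' \<otimes> c'"
      using eq_if_diff_zero C e by (auto simp: P_def H_def)
    then have ee: "e = e'" "h = h'" using slopes_proportional assms C by blast+
    then have "c = c'" using eh m_lcancel[of e c c'] e C by simp
    then show ?thesis using ee gg assms by (auto simp: coeffs_def split: if_splits)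
  next
    case tt
    have mem: "(a \<otimes> x, e \<otimes> (a \<otimes> \<sigma> f x \<oplus> b \<otimes> x)) \<in> tang e' f' x'" if "a \<in> K" "b \<in> K" for a b
      using tt that by (auto simp: tang_def)
    have "(\<zero>, e \<otimes> x) \<in> tang e' f' x'" using mem[OF K_zero K_one] tt assms by simp
    then obtain a0 b where b: "a0 \<in> K" "b \<in> K" "\<zero> = a0 \<otimes> x'" "e \<otimes> x = e' \<otimes> (a0 \<otimes> \<sigma> f' x' \<oplus> b \<otimes> x')"
      by (auto simp: tang_def)
    then have "a0 = \<zero>" using integral_iff[of a0 x'] tt by auto
    then have ex: "e \<otimes> x = e' \<otimes> (b \<otimes> x')" using b(2,4) tt assms by simp
    have "(x, e \<otimes> \<sigma> f x) \<in> tang e' f' x'" using mem[OF K_one K_zero] tt assms by simp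
    then obtain a b' where a: "a \<in> K" "b' \<in> K" "x = a \<otimes> x'" "e \<otimes> \<sigma> f x = e' \<otimes> (a \<otimes> \<sigma> f' x' \<oplus> b' \<otimes> x')"
      by (auto simp: tang_def)
    have a0: "a \<noteq> \<zero>" using a tt by auto
    have "(e \<otimes> a) \<otimes> x' = (e' \<otimes> b) \<otimes> x'" using ex a e b tt by (simp add: m_assoc)
    then have "e \<otimes> a = e' \<otimes> b" using m_rcancel[of x' "e \<otimes> a" "e' \<otimes> b"] e a b tt by simp
    then have ee: "e = e'" using slopes_proportional assms a b a0 by blast
    have "(x, e \<otimes> \<sigma> f x) \<in> tang e f' x'" using \<open>(x, e \<otimes> \<sigma> f x) \<in> tang e' f' x'\<close> ee by simp
    then obtain t where t: "t \<in> K" "\<sigma> f x = \<sigma> f' x \<oplus> t \<otimes> x"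
      using tang_mem_nonzero[of e f' x' x "\<sigma> f x"] e tt assms by auto
    then have "\<sigma> f x \<oplus> \<zero> \<otimes> x = \<sigma> f' x \<oplus> t \<otimes> x" using tt assms by simp
    then have "f = f'" using \<sigma>_unique[of x f f' \<zero> t] tt assms t K_zero by blast
    then show ?thesis using ee by simp
  qed
qed

end

section \<open>Existence of the maps that define the spreads\<close>

context quad_over
begin

lemma card_E_eq: "card (carrier E) = card (K \<times> K)"
proof -
  have "bij_betw (\<lambda>(s, t). s \<oplus> t \<otimes> \<theta>) (K \<times> K) (carrier E)"
    unfolding bij_betw_def
  proof
    show "inj_on (\<lambda>(s, t). s \<oplus> t \<otimes> \<theta>) (K \<times> K)"
      using basis_unique by (auto simp: inj_on_def)
    show "(\<lambda>(s, t). s \<oplus> t \<otimes> \<theta>) ` (K \<times> K) = carrier E"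
    proof
      show "carrier E \<subseteq> (\<lambda>(s, t). s \<oplus> t \<otimes> \<theta>) ` (K \<times> K)" using basis by (force simp: image_iff)
    qed (use \<theta>_carrier in auto)
  qed
  then show ?thesis by (simp add: bij_betw_same_card)
qed

text \<open>The map \<psi> sends 1 to \<theta> and \<theta> to \<alpha> + \<beta>\<theta>. Its
  characteristic polynomial X^2 - \<beta> X - \<alpha> has no root in \<open>K\<close>, so there is
  no eigenvector and x, \<psi>(x) form a basis over \<open>K\<close> for each nonzero x. An
  \<open>E\<close>-linear map with the same value at 1 would send \<theta> to \<theta>^2, which the
  hypothesis on \<alpha> and \<beta> excludes.\<close>

lemma denniston_large:
  assumes fin: "finite (carrier E)"
    and \<omega>: "\<alpha> \<in> K" "\<beta> \<in> K" "\<theta> \<otimes> \<theta> \<noteq> \<alpha> \<oplus> \<beta> \<otimes> \<theta>"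
    and irred: "\<And>x. x \<in> K \<Longrightarrow> x \<otimes> x \<noteq> \<beta> \<otimes> x \<oplus> \<alpha>"
  shows "\<exists>\<psi> \<sigma>. denniston E K \<theta> \<psi> \<sigma>"
proof -
  note [simp] = \<theta>_carrier
  define co where "co x = (SOME p. fst p \<in> K \<and> snd p \<in> K \<and> x = fst p \<oplus> snd p \<otimes> \<theta>)" for x
  have co: "fst (co x) \<in> K \<and> snd (co x) \<in> K \<and> x = fst (co x) \<oplus> snd (co x) \<otimes> \<theta>"
    if "x \<in> carrier E" for x
  proof -
    have "\<exists>p. fst p \<in> K \<and> snd p \<in> K \<and> x = fst p \<oplus> snd p \<otimes> \<theta>" using basis[OF that] by auto
    then show ?thesis unfolding co_def by (rule someI_ex)
  qed
  have co_eq: "co (s \<oplus> t \<otimes> \<theta>) = (s, t)" if "s \<in> K" "t \<in> K" for s t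
    using co[of "s \<oplus> t \<otimes> \<theta>"] that
      basis_unique[of s t "fst (co (s \<oplus> t \<otimes> \<theta>))" "snd (co (s \<oplus> t \<otimes> \<theta>))"]
    by (metis KE \<theta>_carrier a_closed m_closed prod.collapse)
  define \<psi> where "\<psi> x = fst (co x) \<otimes> \<theta> \<oplus> snd (co x) \<otimes> (\<alpha> \<oplus> \<beta> \<otimes> \<theta>)" for x
  have \<psi>: "\<psi> (s \<oplus> t \<otimes> \<theta>) = s \<otimes> \<theta> \<oplus> t \<otimes> (\<alpha> \<oplus> \<beta> \<otimes> \<theta>)" if "s \<in> K" "t \<in> K" for s t
    using co_eq[OF that] by (simp add: \<psi>_def)
  have \<psi>_closed: "\<psi> x \<in> carrier E" if "x \<in> carrier E" for x
    using co[OF that] \<omega> by (simp add: \<psi>_def)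
  have \<psi>_add: "\<psi> (x \<oplus> y) = \<psi> x \<oplus> \<psi> y" if xy: "x \<in> carrier E" "y \<in> carrier E" for x y
  proof -
    obtain s t s' t' where st: "s \<in> K" "t \<in> K" "x = s \<oplus> t \<otimes> \<theta>" "s' \<in> K" "t' \<in> K" "y = s' \<oplus> t' \<otimes> \<theta>"
      using basis xy by meson
    then have "x \<oplus> y = (s \<oplus> s') \<oplus> (t \<oplus> t') \<otimes> \<theta>" by (simp add: l_distr a_ac)
    then have "\<psi> (x \<oplus> y) = (s \<oplus> s') \<otimes> \<theta> \<oplus> (t \<oplus> t') \<otimes> (\<alpha> \<oplus> \<beta> \<otimes> \<theta>)"
      using \<psi> st by (simp add: K_closed)
    also have "\<dots> = \<psi> x \<oplus> \<psi> y"
      unfolding st(3,6) \<psi>[OF st(1,2)] \<psi>[OF st(4,5)] using st(1,2,4,5) \<omega> by (simp add: l_distr r_distr a_ac m_ac)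
    finally show ?thesis .
  qed
  have \<psi>_smult: "\<psi> (k \<otimes> x) = k \<otimes> \<psi> x" if k: "k \<in> K" "x \<in> carrier E" for k x
  proof -
    obtain s t where st: "s \<in> K" "t \<in> K" "x = s \<oplus> t \<otimes> \<theta>" using basis k by meson
    then have "k \<otimes> x = (k \<otimes> s) \<oplus> (k \<otimes> t) \<otimes> \<theta>" using k by (simp add: r_distr m_ac)
    then have "\<psi> (k \<otimes> x) = (k \<otimes> s) \<otimes> \<theta> \<oplus> (k \<otimes> t) \<otimes> (\<alpha> \<oplus> \<beta> \<otimes> \<theta>)"
      using \<psi> st k by (simp add: K_closed)
    also have "\<dots> = k \<otimes> \<psi> x"
      unfolding st(3) \<psi>[OF st(1,2)] using st(1,2) \<omega> k by (simp add: l_distr r_distr a_ac m_ac)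
    finally show ?thesis .
  qed
  have no_eigen: "x = \<zero>" if x: "x \<in> carrier E" "l \<in> K" "\<psi> x = l \<otimes> x" for x l
  proof -
    obtain s t where st: "s \<in> K" "t \<in> K" "x = s \<oplus> t \<otimes> \<theta>" using basis x by meson
    have "t \<otimes> \<alpha> \<oplus> (s \<oplus> t \<otimes> \<beta>) \<otimes> \<theta> = s \<otimes> \<theta> \<oplus> t \<otimes> (\<alpha> \<oplus> \<beta> \<otimes> \<theta>)"
      using st \<omega> by (simp add: l_distr r_distr a_ac m_ac)
    also have "\<dots> = l \<otimes> (s \<oplus> t \<otimes> \<theta>)" using x(3) \<psi> st by simp
    also have "\<dots> = l \<otimes> s \<oplus> (l \<otimes> t) \<otimes> \<theta>" using st x by (simp add: r_distr m_ac)
    finally have "t \<otimes> \<alpha> = l \<otimes> s \<and> s \<oplus> t \<otimes> \<beta> = l \<otimes> t"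
      by (rule basis_unique[rotated 4]) (use st x \<omega> K_mult K_add in auto)
    then have 1: "t \<otimes> \<alpha> = l \<otimes> s" and 2: "s \<oplus> t \<otimes> \<beta> = l \<otimes> t" by auto
    \<comment> \<open>Eliminating \<open>s\<close> from the two coordinate equations shows that an
      eigenvalue \<open>l\<close> would be a root of the characteristic polynomial, unless
      \<open>t = \<zero>\<close>.\<close>
    have "t \<otimes> (l \<otimes> l) = l \<otimes> (s \<oplus> t \<otimes> \<beta>)" unfolding 2 using st x by (simp add: m_ac)
    also have "\<dots> = t \<otimes> \<alpha> \<oplus> l \<otimes> (t \<otimes> \<beta>)" unfolding 1 using st x \<omega> by (simp add: r_distr)
    also have "\<dots> = t \<otimes> (\<beta> \<otimes> l \<oplus> \<alpha>)" using st x \<omega> by (simp add: r_distr m_ac a_ac)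
    finally have "t \<otimes> (l \<otimes> l) = t \<otimes> (\<beta> \<otimes> l \<oplus> \<alpha>)" .
    then have "t = \<zero>" using irred[of l] m_lcancel[of t "l \<otimes> l" "\<beta> \<otimes> l \<oplus> \<alpha>"] st x \<omega> by auto
    then show "x = \<zero>" using 2 st x \<omega> by simp
  qed
  have unique: "f = f' \<and> t = t'" if H: "x \<in> carrier E" "x \<noteq> \<zero>" "f \<in> K" "f' \<in> K" "t \<in> K" "t' \<in> K"
    "f \<otimes> \<psi> x \<oplus> t \<otimes> x = f' \<otimes> \<psi> x \<oplus> t' \<otimes> x" for x f f' t t'
  proof -
    define d where "d = f \<oplus> \<ominus> f'"
    have d: "d \<in> K" using H by (simp add: d_def K_closed)
    have p: "\<psi> x \<in> carrier E" using \<psi>_closed H by simp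
    have carr: "f \<in> carrier E" "f' \<in> carrier E" "t \<in> carrier E" "t' \<in> carrier E" using H by auto
    have "d \<otimes> \<psi> x = (f \<otimes> \<psi> x \<oplus> t \<otimes> x) \<oplus> \<ominus> (f' \<otimes> \<psi> x) \<oplus> \<ominus> (t \<otimes> x)"
      unfolding d_def using carr H(1) p by algebra
    also have "\<dots> = (t' \<oplus> \<ominus> t) \<otimes> x" unfolding H(7) using carr H(1) p by algebra
    finally have e: "d \<otimes> \<psi> x = (t' \<oplus> \<ominus> t) \<otimes> x" .
    have "d = \<zero>"
    proof (rule ccontr)
      assume d0: "d \<noteq> \<zero>"
      have "\<psi> x = inv d \<otimes> (d \<otimes> \<psi> x)" using inv_E[of d] d d0 p by (simp flip: m_assoc)
      also have "\<dots> = (inv d \<otimes> (t' \<oplus> \<ominus> t)) \<otimes> x" unfolding e using inv_E[of d] d d0 carr H(1) by (simp add: m_assoc)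
      finally have "x = \<zero>" using no_eigen[of x "inv d \<otimes> (t' \<oplus> \<ominus> t)"] H d d0 by (simp add: K_closed)
      then show False using H by simp
    qed
    then have ff: "f = f'" using eq_if_diff_zero carr by (simp add: d_def)
    then have "t \<otimes> x = t' \<otimes> x" using H p by simp
    then show ?thesis using ff m_rcancel[of x t t'] H by simp
  qed
  have cover: "\<exists>f\<in>K. \<exists>t\<in>K. y = f \<otimes> \<psi> x \<oplus> t \<otimes> x" if H: "x \<in> carrier E" "x \<noteq> \<zero>" "y \<in> carrier E" for x y
  proof -
    let ?h = "\<lambda>(f, t). f \<otimes> \<psi> x \<oplus> t \<otimes> x"
    have "inj_on ?h (K \<times> K)" using unique[OF H(1,2)] by (auto simp: inj_on_def)
    \<comment> \<open>By \<open>card_E_eq\<close> there are as many pairs over \<open>K\<close> as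
      elements of \<open>E\<close>, so injectivity already gives surjectivity.\<close>
    then have "card (?h ` (K \<times> K)) = card (carrier E)" by (simp add: card_image card_E_eq)
    moreover have "?h ` (K \<times> K) \<subseteq> carrier E" using H \<psi>_closed by auto
    ultimately have "?h ` (K \<times> K) = carrier E" using fin by (metis card_subset_eq)
    then have "y \<in> ?h ` (K \<times> K)" using H(3) by simp
    then show ?thesis by auto
  qed
  have "denniston E K \<theta> \<psi> (\<lambda>f x. f \<otimes> \<psi> x)"
  proof (intro denniston.intro denniston_axioms.intro)
    show "quad_over E K \<theta>" by (rule quad_over_axioms)
    have "\<psi> \<one> = \<theta>" using \<psi>[OF K_one K_zero] \<omega> by simp
    moreover have "\<psi> \<theta> = \<alpha> \<oplus> \<beta> \<otimes> \<theta>" using \<psi>[OF K_zero K_one] \<omega> by simp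
    ultimately show "\<psi> \<theta> \<noteq> \<theta> \<otimes> \<psi> \<one>" using \<omega> by simp
  next
    fix x f f' t t' assume "x \<in> carrier E" "x \<noteq> \<zero>" "f \<in> K" "f' \<in> K" "t \<in> K" "t' \<in> K"
      "f \<otimes> \<psi> x \<oplus> t \<otimes> x = f' \<otimes> \<psi> x \<oplus> t' \<otimes> x"
    then show "f = f'" using unique by blast
  qed (use \<psi>_closed \<psi>_add \<psi>_smult cover in \<open>auto simp: m_lcomm\<close>)
  then show ?thesis by blast
qed

text \<open>Squaring is linear over two elements but not over \<open>E\<close>. It fixes
  \<open>\<one>\<close>, so taking \<open>\<sigma> \<zero> x = \<zero>\<close> would put both values
  of \<sigma> at \<open>\<one>\<close> into the same coset of \<open>K\<close>. Shifting the square
  by \<open>\<theta> \<otimes> x\<close>, which never lies in K x for nonzero x, reaches the other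
  coset instead.\<close>

lemma denniston_binary:
  assumes K: "K = {\<zero>, \<one>}"
  shows "\<exists>\<psi> \<sigma>. denniston E K \<theta> \<psi> \<sigma>"
proof -
  note [simp] = \<theta>_carrier
  have "\<one> \<oplus> \<one> \<noteq> \<one>"
  proof
    assume "\<one> \<oplus> \<one> = \<one>"
    then show False using add.l_cancel_one'[of \<one> \<one>] by simp
  qed
  then have 11: "\<one> \<oplus> \<one> = \<zero>" using K_add[OF K_one K_one] K by auto
  have dbl: "x \<oplus> x = \<zero>" if "x \<in> carrier E" for x
    using that l_distr[of \<one> \<one> x] 11 by simp
  define \<sigma> where "\<sigma> f x = (if f = \<zero> then x \<otimes> x \<oplus> \<theta> \<otimes> x else x \<otimes> x)" for f x
  have \<theta>0: "\<theta> \<noteq> \<zero>" "\<theta> \<noteq> \<one>" using \<theta>_notin K by auto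
  have neq: "x \<otimes> x \<oplus> \<theta> \<otimes> x \<oplus> t \<otimes> x \<noteq> x \<otimes> x \<oplus> t' \<otimes> x"
    if x: "x \<in> carrier E" "x \<noteq> \<zero>" "t \<in> K" "t' \<in> K" for x t t'
  proof
    assume "x \<otimes> x \<oplus> \<theta> \<otimes> x \<oplus> t \<otimes> x = x \<otimes> x \<oplus> t' \<otimes> x"
    then have "x \<otimes> x \<oplus> (\<theta> \<oplus> t) \<otimes> x = x \<otimes> x \<oplus> t' \<otimes> x" using x by (simp add: a_assoc l_distr)
    then have "(\<theta> \<oplus> t) \<otimes> x = t' \<otimes> x" using x by simp
    then have "\<theta> \<oplus> t = t'" using x m_rcancel[of x "\<theta> \<oplus> t" t'] by simp
    then have "t \<oplus> \<one> \<otimes> \<theta> = t' \<oplus> \<zero> \<otimes> \<theta>" using x by (simp add: a_comm)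
    then have "\<one> = \<zero>" using basis_unique[of t \<one> t' \<zero>] x K_zero K_one by blast
    then show False by simp
  qed
  have "denniston E K \<theta> (\<lambda>x. x \<otimes> x) \<sigma>"
  proof (intro denniston.intro denniston_axioms.intro)
    show "quad_over E K \<theta>" by (rule quad_over_axioms)
    show "\<theta> \<otimes> \<theta> \<noteq> \<theta> \<otimes> (\<one> \<otimes> \<one>)" using m_lcancel[of \<theta> \<theta> \<one>] \<theta>0 by simp
    fix x y assume xy: "x \<in> carrier E" "y \<in> carrier E"
    have "(x \<oplus> y) \<otimes> (x \<oplus> y) = x \<otimes> x \<oplus> y \<otimes> y \<oplus> (x \<otimes> y \<oplus> x \<otimes> y)"
      using xy by (simp add: l_distr r_distr m_ac a_ac)
    then show "(x \<oplus> y) \<otimes> (x \<oplus> y) = x \<otimes> x \<oplus> y \<otimes> y" using dbl[of "x \<otimes> y"] xy by simp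
  next
    fix x y assume xy: "x \<in> carrier E" "x \<noteq> \<zero>" "y \<in> carrier E"
    define w where "w = inv x \<otimes> y"
    have w: "w \<in> carrier E" "y = w \<otimes> x"
      using inv_E[OF xy(1,2)] xy m_comm[of "inv x \<otimes> y" x] by (simp_all add: w_def flip: m_assoc)
    \<comment> \<open>In characteristic two this sum is y/x - x; its coefficient of
      \<open>\<theta>\<close> tells in which of the two cosets of K x the element \<open>y\<close>
      lies.\<close>
    obtain s t where st: "s \<in> K" "t \<in> K" "w \<oplus> x = s \<oplus> t \<otimes> \<theta>" using basis[of "w \<oplus> x"] w xy by auto
    have "w = (w \<oplus> x) \<oplus> x" using dbl[of x] w xy by (simp add: a_assoc)
    then have "w = s \<oplus> t \<otimes> \<theta> \<oplus> x" using st by simp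
    then have y: "y = (s \<oplus> t \<otimes> \<theta> \<oplus> x) \<otimes> x" using w by simp
    show "\<exists>f\<in>K. \<exists>t\<in>K. y = \<sigma> f x \<oplus> t \<otimes> x"
    proof (cases "t = \<zero>")
      case True
      then have "y = \<sigma> \<one> x \<oplus> s \<otimes> x" using y st xy by (simp add: \<sigma>_def l_distr a_ac)
      then show ?thesis using st K_one by blast
    next
      case False
      then have "t = \<one>" using st K by auto
      then have "y = \<sigma> \<zero> x \<oplus> s \<otimes> x" using y st xy by (simp add: \<sigma>_def l_distr a_ac)
      then show ?thesis using st K_zero by blast
    qed
  next
    fix x f f' t t' assume x: "x \<in> carrier E" "x \<noteq> \<zero>" and f: "f \<in> K" "f' \<in> K" and t: "t \<in> K" "t' \<in> K"
      and eq: "\<sigma> f x \<oplus> t \<otimes> x = \<sigma> f' x \<oplus> t' \<otimes> x"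
    have "f = \<zero> \<longleftrightarrow> f' = \<zero>"
    proof (rule ccontr)
      assume "\<not> ?thesis"
      then consider "f = \<zero>" "f' \<noteq> \<zero>" | "f \<noteq> \<zero>" "f' = \<zero>" by blast
      then show False
      proof cases
        case 1
        then show False using eq neq[OF x t] by (simp add: \<sigma>_def)
      next
        case 2
        then show False using eq[symmetric] neq[OF x t(2,1)] by (simp add: \<sigma>_def)
      qed
    qed
    then show "f = f'" using f K by blast
  next
    fix f x assume "f \<in> K" "f \<noteq> \<zero>" "x \<in> carrier E"
    then show "\<sigma> f x = f \<otimes> (x \<otimes> x)" using K by (auto simp: \<sigma>_def)
  next
    fix k x assume "k \<in> K" "x \<in> carrier E"
    then show "k \<otimes> x \<otimes> (k \<otimes> x) = k \<otimes> (x \<otimes> x)" using K by auto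
  next
    fix f k x assume "f \<in> K" "k \<in> K" "k \<noteq> \<zero>" "x \<in> carrier E"
    then show "\<sigma> f (k \<otimes> x) = k \<otimes> \<sigma> f x" using K by (auto simp: \<sigma>_def)
  qed (simp_all add: \<sigma>_def)
  then show ?thesis by blast
qed

text \<open>The coefficient \<beta> must be nonzero for the non-injectivity argument behind
  \<open>exists_irreducible_quadratic\<close>, and different from the trace \<delta> of \<theta> so
  that \<psi> is not multiplication by \<theta>. If no element of \<open>K\<close> satisfies both,
  testing \<open>\<one>\<close> gives \<open>\<delta> = \<one>\<close> and leaves only two elements
  in \<open>K\<close>.\<close>

lemma denniston_exists:
  assumes "finite (carrier E)"
  shows "\<exists>\<psi> \<sigma>. denniston E K \<theta> \<psi> \<sigma>"
proof -
  obtain \<gamma> \<delta> where gd: "\<gamma> \<in> K" "\<delta> \<in> K" "\<theta> \<otimes> \<theta> = \<gamma> \<oplus> \<delta> \<otimes> \<theta>"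
    using basis[of "\<theta> \<otimes> \<theta>"] \<theta>_carrier by auto
  show ?thesis
  proof (cases "\<exists>\<beta>\<in>K. \<beta> \<noteq> \<zero> \<and> \<beta> \<noteq> \<delta>")
    case True
    then obtain \<beta> where \<beta>: "\<beta> \<in> K" "\<beta> \<noteq> \<zero>" "\<beta> \<noteq> \<delta>" by blast
    have "finite K" using assms K_carrier finite_subset by blast
    then obtain \<alpha> where \<alpha>: "\<alpha> \<in> K" "\<forall>x\<in>K. x \<otimes> x \<noteq> \<beta> \<otimes> x \<oplus> \<alpha>"
      using exists_irreducible_quadratic[of K \<beta>] \<beta> K_carrier K_closed by (auto simp: a_minus_def)
    have "\<theta> \<otimes> \<theta> \<noteq> \<alpha> \<oplus> \<beta> \<otimes> \<theta>"
      using basis_unique[of \<gamma> \<delta> \<alpha> \<beta>] gd \<alpha> \<beta> by auto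
    then show ?thesis using denniston_large assms \<alpha> \<beta> by blast
  next
    case False
    then have "\<delta> = \<one>" using K_one zero_not_one by metis
    with False have "K = {\<zero>, \<one>}" using K_zero K_one by auto
    then show ?thesis by (rule denniston_binary)
  qed
qed

end

section \<open>The lower bound\<close>

text \<open>The vector form of \<open>class_family\<close>. The meeting condition includes
  \<open>C = C'\<close> and thereby makes every class nonempty.\<close>

definition class_system ::
  "('a, 'b) ring_scheme \<Rightarrow> ('a, 'v, 'm) module_scheme \<Rightarrow> 'v set set set \<Rightarrow> bool" where
  "class_system F M \<C> \<longleftrightarrow>
     (\<forall>C\<in>\<C>. \<forall>l\<in>C. vline F M l) \<and>
     (\<forall>C\<in>\<C>. \<forall>l\<in>C. \<forall>l'\<in>C. \<forall>v\<in>l \<inter> l'. v \<noteq> \<zero>\<^bsub>M\<^esub> \<longrightarrow> l = l') \<and>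
     (\<forall>C\<in>\<C>. \<forall>C'\<in>\<C>. \<forall>l\<in>C \<inter> C'. C = C') \<and>
     (\<forall>C\<in>\<C>. \<forall>C'\<in>\<C>. \<exists>l\<in>C. \<exists>l'\<in>C'. \<exists>v\<in>l \<inter> l'. v \<noteq> \<zero>\<^bsub>M\<^esub>)"

text \<open>The map \<Phi> restricts scalars along \<iota>. Lines of a new class are skew because
  different \<open>E\<close>-lines of the old class are skew and because the lines of one spread are
  disjoint. Two new classes meet wherever the old ones did, since a spread covers its entire
  \<open>E\<close>-line.\<close>

lemma (in denniston) lift_class_system:
  fixes ME :: "('a, 'v) module" and F :: "('c, 'd) ring_scheme" and MF :: "('c, 'w) module"
  assumes ME: "vecsp E ME" and MF: "vecsp F MF" and fin: "finite (carrier E)"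
    and \<iota>: "bij_betw \<iota> (carrier F) K" "\<iota> \<zero>\<^bsub>F\<^esub> = \<zero>"
    and \<Phi>_closed: "\<And>v. v \<in> carrier ME \<Longrightarrow> \<Phi> v \<in> carrier MF"
    and \<Phi>_inj: "inj_on \<Phi> (carrier ME)"
    and \<Phi>_zero: "\<Phi> \<zero>\<^bsub>ME\<^esub> = \<zero>\<^bsub>MF\<^esub>"
    and \<Phi>_comb: "\<And>s t v w. s \<in> carrier F \<Longrightarrow> t \<in> carrier F \<Longrightarrow> v \<in> carrier ME \<Longrightarrow> w \<in> carrier ME \<Longrightarrow>
      \<Phi> (comb2 ME (\<iota> s) (\<iota> t) v w) = comb2 MF s t (\<Phi> v) (\<Phi> w)"
    and sys: "class_system E ME \<C>"
  shows "\<exists>\<C>'. class_system F MF \<C>' \<and> card \<C>' = card \<C> * card K ^ 2"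
proof -
  interpret V: vecsp E ME by fact
  interpret W: vecsp F MF by fact
  \<comment> \<open>An arbitrary frame identifies each \<open>E\<close>-line with pairs over
    \<open>E\<close>. The transported spread depends on this choice, but the set of vectors that it
    covers does not.\<close>
  define bas where "bas T = (SOME p. fst p \<in> carrier ME \<and> snd p \<in> carrier ME \<and>
     indep2 E ME (fst p) (snd p) \<and> T = span2 E ME (fst p) (snd p))" for T
  have bas_ex: "fst (bas T) \<in> carrier ME \<and> snd (bas T) \<in> carrier ME \<and>
     indep2 E ME (fst (bas T)) (snd (bas T)) \<and> T = span2 E ME (fst (bas T)) (snd (bas T))"
    if "vline E ME T" for T
  proof -
    have "\<exists>p. fst p \<in> carrier ME \<and> snd p \<in> carrier ME \<and>
      indep2 E ME (fst p) (snd p) \<and> T = span2 E ME (fst p) (snd p)"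
      using that by (auto simp: vline_def)
    then show ?thesis unfolding bas_def by (rule someI_ex)
  qed
  then have bas: "fst (bas T) \<in> carrier ME" "snd (bas T) \<in> carrier ME"
    "indep2 E ME (fst (bas T)) (snd (bas T))" and bas_span: "span2 E ME (fst (bas T)) (snd (bas T)) = T"
    if "vline E ME T" for T using that by auto
  define pt where "pt T p = comb2 ME (fst p) (snd p) (fst (bas T)) (snd (bas T))" for T p
  define emb where "emb T p = \<Phi> (pt T p)" for T p
  let ?EE = "carrier E \<times> carrier E"
  have pt_mem: "pt T p \<in> T" "pt T p \<in> carrier ME" if "vline E ME T" "p \<in> ?EE" for T p
  proof -
    have "pt T p \<in> span2 E ME (fst (bas T)) (snd (bas T))"
      using that(2) unfolding pt_def span2_def mem_Times_iff by blast
    then show "pt T p \<in> T" using bas_span[OF that(1)] by simp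
    then show "pt T p \<in> carrier ME" using V.vline_closed[OF that(1)] by blast
  qed
  have pt_surj: "\<exists>p\<in>?EE. v = pt T p" if T: "vline E ME T" "v \<in> T" for T v
  proof -
    have "v \<in> span2 E ME (fst (bas T)) (snd (bas T))" using bas_span[OF T(1)] T(2) by simp
    then obtain a b where "a \<in> carrier E" "b \<in> carrier E" "v = comb2 ME a b (fst (bas T)) (snd (bas T))"
      by (auto simp: span2_def)
    then show ?thesis by (intro bexI[of _ "(a, b)"]) (auto simp: pt_def)
  qed
  have pt_inj: "p = p'" if "vline E ME T" "p \<in> ?EE" "p' \<in> ?EE" "pt T p = pt T p'" for T p p'
  proof -
    have "fst p = fst p' \<and> snd p = snd p'"
      using that(2,3) V.comb2_inject[OF bas(3)[OF that(1)] that(4)[unfolded pt_def] _ _ _ _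
          bas(1)[OF that(1)] bas(2)[OF that(1)]]
      by (metis mem_Times_iff)
    then show ?thesis by (simp add: prod_eq_iff)
  qed
  have pt_zero: "pt T (\<zero>, \<zero>) = \<zero>\<^bsub>ME\<^esub>" if "vline E ME T" for T
    using bas(1,2)[OF that] by (simp add: pt_def)
  have emb_inj: "p = p'" if "vline E ME T" "p \<in> ?EE" "p' \<in> ?EE" "emb T p = emb T p'" for T p p'
    using that(4) pt_inj[OF that(1-3)] inj_onD[OF \<Phi>_inj] pt_mem(2)[OF that(1)] that(2,3)
    unfolding emb_def by metis
  have comb_pt: "comb2 ME a b (pt T p) (pt T p') =
      pt T (a \<otimes> fst p \<oplus> b \<otimes> fst p', a \<otimes> snd p \<oplus> b \<otimes> snd p')"
    if "vline E ME T" "p \<in> ?EE" "p' \<in> ?EE" "a \<in> carrier E" "b \<in> carrier E" for T a b p p'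
    using bas(1,2)[OF that(1)] that(2-) by (simp add: pt_def V.comb2_comb2 mem_Times_iff)
  have indep_pt: "indep2 E ME (pt T p) (pt T p')"
    if T: "vline E ME T" "p \<in> ?EE" "p' \<in> ?EE" "eindep p p'" for T p p'
    unfolding indep2_def
  proof (intro ballI impI)
    fix a b assume ab: "a \<in> carrier E" "b \<in> carrier E" "comb2 ME a b (pt T p) (pt T p') = \<zero>\<^bsub>ME\<^esub>"
    let ?r = "(a \<otimes> fst p \<oplus> b \<otimes> fst p', a \<otimes> snd p \<oplus> b \<otimes> snd p')"
    have "pt T ?r = pt T (\<zero>, \<zero>)" using comb_pt[OF T(1-3) ab(1,2)] ab(3) pt_zero[OF T(1)] by simp
    moreover have "?r \<in> ?EE" using ab T by auto
    ultimately have "?r = (\<zero>, \<zero>)" using pt_inj[OF T(1), of ?r "(\<zero>, \<zero>)"] by blast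
    then show "a = \<zero> \<and> b = \<zero>" using T(4) ab unfolding eindep_def by blast
  qed
  have \<iota>K: "\<iota> s \<in> K" if "s \<in> carrier F" for s using \<iota>(1) that by (auto simp: bij_betw_def)
  have sub: "g \<subseteq> ?EE" if "e \<in> slopes" "f \<in> K" "g \<in> spread e f" for e f g
    using spread_lines[OF that] by (auto simp: kspan_def)
  have line: "vline F MF (emb T ` g) \<and> (\<exists>v1 v2. indep2 E ME v1 v2 \<and> v1 \<in> T \<and> v2 \<in> T \<and>
      \<Phi> v1 \<in> emb T ` g \<and> \<Phi> v2 \<in> emb T ` g)"
    if T: "vline E ME T" and g: "e \<in> slopes" "f \<in> K" "g \<in> spread e f" for T e f g
  proof -
    obtain p p' where p: "p \<in> ?EE" "p' \<in> ?EE" "g = kspan p p'" "eindep p p'"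
      using spread_lines[OF g] by blast
    let ?v = "pt T p" and ?v' = "pt T p'"
    note v = pt_mem[OF T p(1)] and v' = pt_mem[OF T p(2)]
    have ind: "indep2 E ME ?v ?v'" using indep_pt T p by blast
    have img: "emb T ` g = span2 F MF (\<Phi> ?v) (\<Phi> ?v')"
    proof -
      have "emb T ` g = {\<Phi> (comb2 ME a b ?v ?v') | a b. a \<in> K \<and> b \<in> K}"
        unfolding p(3) kspan_def emb_def using comb_pt[OF T p(1,2)] by (auto simp: image_iff) (metis KE)+
      also have "\<dots> = {\<Phi> (comb2 ME (\<iota> s) (\<iota> t) ?v ?v') | s t. s \<in> carrier F \<and> t \<in> carrier F}"
        using bij_betw_imp_surj_on[OF \<iota>(1)] by blast
      also have "\<dots> = span2 F MF (\<Phi> ?v) (\<Phi> ?v')"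
        unfolding span2_def using \<Phi>_comb v v' by (intro Collect_cong ex_cong1) auto
      finally show ?thesis .
    qed
    have "indep2 F MF (\<Phi> ?v) (\<Phi> ?v')"
      unfolding indep2_def
    proof (intro ballI impI)
      fix s t assume st: "s \<in> carrier F" "t \<in> carrier F" "comb2 MF s t (\<Phi> ?v) (\<Phi> ?v') = \<zero>\<^bsub>MF\<^esub>"
      then have "\<Phi> (comb2 ME (\<iota> s) (\<iota> t) ?v ?v') = \<Phi> \<zero>\<^bsub>ME\<^esub>"
        using \<Phi>_comb v v' \<Phi>_zero by simp
      then have "comb2 ME (\<iota> s) (\<iota> t) ?v ?v' = \<zero>\<^bsub>ME\<^esub>"
        using inj_onD[OF \<Phi>_inj] v v' \<iota>K st by simp
      then have "\<iota> s = \<zero>" "\<iota> t = \<zero>" using ind \<iota>K st unfolding indep2_def by auto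
      then show "s = \<zero>\<^bsub>F\<^esub> \<and> t = \<zero>\<^bsub>F\<^esub>"
        using inj_onD[OF bij_betw_imp_inj_on[OF \<iota>(1)]] \<iota>(2) st W.R.zero_closed by metis
    qed
    then have "vline F MF (emb T ` g)"
      unfolding vline_def img using \<Phi>_closed v v' by blast
    moreover have "\<Phi> ?v \<in> emb T ` g" "\<Phi> ?v' \<in> emb T ` g"
      unfolding img using W.in_span2 \<Phi>_closed v v' by auto
    ultimately show ?thesis using ind v v' by blast
  qed
  \<comment> \<open>The image contains two vectors of \<open>T\<close> that are independent over
    \<open>E\<close>, and these fix \<open>T\<close>; here it matters that no line of a spread is a
    point over \<open>E\<close>.\<close>
  have emb_unique: "T = T' \<and> g = g'"
    if T: "vline E ME T" "vline E ME T'" and g: "e \<in> slopes" "f \<in> K" "g \<in> spread e f"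
      and g': "e' \<in> slopes" "f' \<in> K" "g' \<in> spread e' f'" and eq: "emb T ` g = emb T' ` g'"
    for T T' e f g e' f' g'
  proof -
    have in_T: "v \<in> T'" if v: "\<Phi> v \<in> emb T' ` g'" "v \<in> carrier ME" for v
    proof -
      obtain p where p: "p \<in> g'" "\<Phi> v = \<Phi> (pt T' p)" using v by (auto simp: emb_def)
      then have "p \<in> ?EE" using sub[OF g'] by blast
      then show ?thesis using inj_onD[OF \<Phi>_inj p(2)] v(2) pt_mem[OF T(2)] by simp
    qed
    obtain v1 v2 where v: "indep2 E ME v1 v2" "v1 \<in> T" "v2 \<in> T" "\<Phi> v1 \<in> emb T ` g" "\<Phi> v2 \<in> emb T ` g"
      using line[OF T(1) g] by blast
    have "v1 \<in> T'" "v2 \<in> T'" using in_T v eq V.vline_closed[OF T(1)] by auto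
    then have TT: "T = T'" using V.vline_eqI[OF fin T v(1)] v by blast
    have "inj_on (emb T) ?EE" using emb_inj[OF T(1)] by (auto intro!: inj_onI)
    then have "g = g'"
      using eq inj_on_image_eq_iff[OF _ sub[OF g] sub[OF g']] unfolding TT by blast
    then show ?thesis using TT by simp
  qed
  note sysD = sys[unfolded class_system_def]
  note sys_line = conjunct1[OF sysD] and sys_disjoint = conjunct1[OF conjunct2[OF sysD]]
    and sys_index = conjunct1[OF conjunct2[OF conjunct2[OF sysD]]]
    and sys_meet = conjunct2[OF conjunct2[OF conjunct2[OF sysD]]]
  have lines: "vline E ME T" if "C \<in> \<C>" "T \<in> C" for C T
    using sys_line that by blast
  define new where "new = (\<lambda>(C, e, f). {emb T ` g | T g. T \<in> C \<and> g \<in> spread e f})"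
  let ?I = "\<C> \<times> slopes \<times> K"
  have new_line: "vline F MF l" if "i \<in> ?I" "l \<in> new i" for i l
    using that line lines by (auto simp: new_def)
  have new_index: "i = i'" if H: "i \<in> ?I" "i' \<in> ?I" "l \<in> new i" "l \<in> new i'" for i i' l
  proof -
    obtain C e f C' e' f' where i: "i = (C, e, f)" "i' = (C', e', f')" by (cases i; cases i') auto
    have c: "C \<in> \<C>" "C' \<in> \<C>" "e \<in> slopes" "e' \<in> slopes" "f \<in> K" "f' \<in> K" using H i by auto
    obtain T g T' g' where Tg: "T \<in> C" "g \<in> spread e f" "T' \<in> C'" "g' \<in> spread e' f'"
      "l = emb T ` g" "l = emb T' ` g'" using H(3,4) i by (auto simp: new_def)
    then have "T = T' \<and> g = g'"
      using emb_unique[of T T' e f g e' f' g'] lines c by blast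
    then have "e = e' \<and> f = f'" "T \<in> C \<inter> C'" using spread_index_unique c Tg by auto
    moreover from this have "C = C'" using sys_index c by blast
    ultimately show ?thesis using i by simp
  qed
  have new_meet: "\<exists>l\<in>new i. \<exists>l'\<in>new i'. \<exists>v\<in>l \<inter> l'. v \<noteq> \<zero>\<^bsub>MF\<^esub>" if I: "i \<in> ?I" "i' \<in> ?I" for i i'
  proof -
    obtain C e f C' e' f' where i: "i = (C, e, f)" "i' = (C', e', f')" by (cases i; cases i') auto
    have c: "C \<in> \<C>" "C' \<in> \<C>" "e \<in> slopes" "e' \<in> slopes" "f \<in> K" "f' \<in> K" using I i by auto
    then obtain T T' v where T: "T \<in> C" "T' \<in> C'" "v \<in> T" "v \<in> T'" "v \<noteq> \<zero>\<^bsub>ME\<^esub>"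
      using sys_meet by blast
    have vc: "v \<in> carrier ME" using T lines[OF c(1)] V.vline_closed by blast
    have find: "\<exists>l\<in>new (C, e, f). \<Phi> v \<in> l" if H: "C \<in> \<C>" "e \<in> slopes" "f \<in> K" "T \<in> C" "v \<in> T" for C e f T
    proof -
      obtain p where p: "p \<in> ?EE" "v = pt T p" using pt_surj[OF lines[OF H(1,4)] H(5)] by blast
      obtain g where "g \<in> spread e f" "p \<in> g" using spread_cover[OF H(2,3), of "fst p" "snd p"] p by auto
      then show ?thesis using p H by (auto simp: new_def emb_def)
    qed
    have "\<Phi> v \<noteq> \<zero>\<^bsub>MF\<^esub>" using inj_onD[OF \<Phi>_inj, of v "\<zero>\<^bsub>ME\<^esub>"] \<Phi>_zero vc T(5) by auto
    then show ?thesis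
      using find[OF c(1,3,5) T(1,3)] find[OF c(2,4,6) T(2,4)] i by blast
  qed
  have new_disjoint: "l = l'" if I: "i \<in> ?I" and l: "l \<in> new i" "l' \<in> new i" and x: "x \<in> l \<inter> l'" "x \<noteq> \<zero>\<^bsub>MF\<^esub>" for i l l' x
  proof -
    obtain C e f where i: "i = (C, e, f)" by (cases i) auto
    have c: "C \<in> \<C>" "e \<in> slopes" "f \<in> K" using I i by auto
    obtain T g T' g' where Tg: "T \<in> C" "g \<in> spread e f" "T' \<in> C" "g' \<in> spread e f"
      "l = emb T ` g" "l' = emb T' ` g'" using l i by (auto simp: new_def)
    obtain p p' where p: "p \<in> g" "p' \<in> g'" "x = emb T p" "x = emb T' p'" using x Tg by blast
    have pE: "p \<in> ?EE" "p' \<in> ?EE" using p sub c Tg by blast+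
    have T: "vline E ME T" "vline E ME T'" using lines c Tg by auto
    have "\<Phi> (pt T p) = \<Phi> (pt T' p')" using p(3,4) by (simp add: emb_def)
    then have eq: "pt T p = pt T' p'" using inj_onD[OF \<Phi>_inj] pt_mem(2) T pE by blast
    have nz: "pt T p \<noteq> \<zero>\<^bsub>ME\<^esub>" using p(3) x(2) \<Phi>_zero by (auto simp: emb_def)
    have "pt T p \<in> T \<inter> T'" using pt_mem(1)[OF T(1) pE(1)] pt_mem(1)[OF T(2) pE(2)] eq by simp
    then have TT: "T = T'" using sys_disjoint nz c Tg by blast
    then have pp: "p = p'" using pt_inj[OF T(1) pE] eq by simp
    have "p \<noteq> (\<zero>, \<zero>)" using nz pt_zero[OF T(1)] by auto
    then have "fst p \<noteq> \<zero> \<or> snd p \<noteq> \<zero>" by (cases p) auto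
    then have "g = g'"
      using spread_disjoint[OF c(2,3) Tg(2,4), of "fst p" "snd p"] pE p pp by auto
    then show ?thesis using Tg TT by simp
  qed
  have "class_system F MF (new ` ?I)"
    unfolding class_system_def
  proof (intro conjI)
    show "\<forall>C\<in>new ` ?I. \<forall>l\<in>C. vline F MF l" using new_line by blast
    show "\<forall>C\<in>new ` ?I. \<forall>l\<in>C. \<forall>l'\<in>C. \<forall>v\<in>l \<inter> l'. v \<noteq> \<zero>\<^bsub>MF\<^esub> \<longrightarrow> l = l'"
      unfolding ball_simps using new_disjoint by blast
    show "\<forall>C\<in>new ` ?I. \<forall>C'\<in>new ` ?I. \<forall>l\<in>C \<inter> C'. C = C'"
      unfolding ball_simps
    proof (intro ballI)
      fix i i' l assume "i \<in> ?I" "i' \<in> ?I" "l \<in> new i \<inter> new i'"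
      then have "i = i'" using new_index[of i i' l] by blast
      then show "new i = new i'" by simp
    qed
    show "\<forall>C\<in>new ` ?I. \<forall>C'\<in>new ` ?I. \<exists>l\<in>C. \<exists>l'\<in>C'. \<exists>v\<in>l \<inter> l'. v \<noteq> \<zero>\<^bsub>MF\<^esub>"
      unfolding ball_simps using new_meet by (intro ballI)
  qed
  moreover have "inj_on new ?I"
  proof (rule inj_onI)
    fix i i' assume I: "i \<in> ?I" "i' \<in> ?I" "new i = new i'"
    \<comment> \<open>The meeting condition of a class with itself supplies a line, which then
      determines the index.\<close>
    obtain l where "l \<in> new i" using new_meet[OF I(1,1)] by blast
    then show "i = i'" using new_index I by metis
  qed
  then have "card (new ` ?I) = card \<C> * card K ^ 2"
    by (simp add: card_image card_cartesian_product card_slopes power2_eq_square)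
  ultimately show ?thesis by blast
qed

section \<open>Restriction of scalars from the quadratic extension\<close>

lemma quad_over_quad_ext:
  fixes F (structure)
  assumes "field F" and ab: "a \<in> carrier F" "b \<in> carrier F"
    and irred: "\<And>x. x \<in> carrier F \<Longrightarrow> x \<otimes> x \<noteq> a \<otimes> x \<oplus> b"
  shows "quad_over (quad_ext F a b) ((\<lambda>s. prod_encode (s, \<zero>)) ` carrier F) (prod_encode (\<zero>, \<one>))"
proof -
  interpret field F by fact
  interpret E: field "quad_ext F a b" using field_quad_ext assms by blast
  let ?E = "quad_ext F a b" and ?i = "\<lambda>s. prod_encode (s, \<zero>)"
  have mult: "?i s \<otimes>\<^bsub>?E\<^esub> ?i t = ?i (s \<otimes> t)" if "s \<in> carrier F" "t \<in> carrier F" for s t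
    using that ab by simp
  show ?thesis
  proof (intro quad_over.intro quad_over_axioms.intro)
    show "field ?E" by (rule E.field_axioms)
    fix x assume "x \<in> ?i ` carrier F"
    then obtain s where s: "s \<in> carrier F" "x = ?i s" by blast
    have "?i (\<ominus> s) \<oplus>\<^bsub>?E\<^esub> x = \<zero>\<^bsub>?E\<^esub>" using s by (simp add: l_neg)
    then have "\<ominus>\<^bsub>?E\<^esub> x = ?i (\<ominus> s)" using s by (intro E.minus_equality) auto
    then show "\<ominus>\<^bsub>?E\<^esub> x \<in> ?i ` carrier F" using s by simp
    assume "x \<noteq> \<zero>\<^bsub>?E\<^esub>"
    then have sU: "s \<in> Units F" using s field_Units by auto
    have "x \<otimes>\<^bsub>?E\<^esub> ?i (inv s) = \<one>\<^bsub>?E\<^esub>" using sU s mult[of s "inv s"] by simp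
    then have "inv\<^bsub>?E\<^esub> x = ?i (inv s)" using s sU by (intro E.comm_inv_char) auto
    then show "inv\<^bsub>?E\<^esub> x \<in> ?i ` carrier F" using sU by simp
  next
    fix x assume "x \<in> carrier ?E"
    then obtain s t where st: "s \<in> carrier F" "t \<in> carrier F" "x = prod_encode (s, t)" by auto
    then have "x = ?i s \<oplus>\<^bsub>?E\<^esub> ?i t \<otimes>\<^bsub>?E\<^esub> prod_encode (\<zero>, \<one>)" using ab by simp
    then show "\<exists>s\<in>?i ` carrier F. \<exists>t\<in>?i ` carrier F. x = s \<oplus>\<^bsub>?E\<^esub> t \<otimes>\<^bsub>?E\<^esub> prod_encode (\<zero>, \<one>)"
      using st by blast
  qed (use ab in auto)
qed

text \<open>Coordinate \<open>i\<close> over the extension turns into coordinates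
  \<open>2 * i\<close> and \<open>2 * i + 1\<close> over the base field, its components with respect
  to 1 and \<theta>.\<close>

definition unpack :: "nat \<Rightarrow> (nat \<Rightarrow> nat) \<Rightarrow> nat \<Rightarrow> nat" where
  "unpack k v = (\<lambda>j\<in>{..<2 * k}. (if even j then fst else snd) (prod_decode (v (j div 2))))"

lemma class_system_double:
  fixes F (structure)
  assumes "is_GF q F" and ab: "a \<in> carrier F" "b \<in> carrier F"
    and irred: "\<And>x. x \<in> carrier F \<Longrightarrow> x \<otimes> x \<noteq> a \<otimes> x \<oplus> b"
    and sys: "class_system (quad_ext F a b) (coord_space (quad_ext F a b) k) \<C>"
  shows "\<exists>\<C>'. class_system F (coord_space F (2 * k)) \<C>' \<and> card \<C>' = card \<C> * q\<^sup>2"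
proof -
  have F: "field F" "finite (carrier F)" "card (carrier F) = q" using assms by (auto simp: is_GF_def)
  interpret field F by fact
  let ?E = "quad_ext F a b" and ?i = "\<lambda>s. prod_encode (s, \<zero>)"
  let ?K = "?i ` carrier F" and ?\<theta> = "prod_encode (\<zero>, \<one>)"
  let ?V = "coord_space ?E k" and ?W = "coord_space F (2 * k)"
  have fE: "field ?E" using field_quad_ext F(1) ab irred by blast
  have finE: "finite (carrier ?E)" using F(2) by simp
  obtain \<psi> \<sigma> where "denniston ?E ?K ?\<theta> \<psi> \<sigma>"
    using quad_over.denniston_exists[OF quad_over_quad_ext[OF F(1) ab irred] finE] by blast
  then interpret D: denniston ?E ?K ?\<theta> \<psi> \<sigma> .
  have bij: "bij_betw ?i (carrier F) ?K" by (rule inj_on_imp_bij_betw) (auto simp: inj_on_def)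
  have comp: "\<exists>x\<in>carrier F. \<exists>y\<in>carrier F. v i = prod_encode (x, y)" if "v \<in> carrier ?V" "i < k" for v i
  proof -
    have "v i \<in> carrier ?E" using that by (auto simp: coord_space_simps)
    then show ?thesis by auto
  qed
  have half: "j div 2 < k" if "j < 2 * k" for j using that by linarith
  have "\<exists>\<C>'. class_system F ?W \<C>' \<and> card \<C>' = card \<C> * card ?K ^ 2"
  proof (rule D.lift_class_system[where \<iota> = ?i and \<Phi> = "unpack k"])
    show "vecsp ?E ?V" "vecsp F ?W" using vecsp_coord_space fE F(1) by auto
    show "finite (carrier ?E)" by (rule finE)
    show "bij_betw ?i (carrier F) ?K" by (rule bij)
    show "?i \<zero> = \<zero>\<^bsub>?E\<^esub>" by simp
    show "class_system ?E ?V \<C>" by (rule sys)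
  next
    fix v assume v: "v \<in> carrier ?V"
    have "(if even j then fst else snd) (prod_decode (v (j div 2))) \<in> carrier F" if "j < 2 * k" for j
      using comp[OF v half[OF that]] by auto
    then show "unpack k v \<in> carrier ?W" by (auto simp: unpack_def coord_space_simps)
  next
    show "inj_on (unpack k) (carrier ?V)"
    proof (rule inj_onI)
      fix v w assume vw: "v \<in> carrier ?V" "w \<in> carrier ?V" "unpack k v = unpack k w"
      show "v = w"
      proof (rule PiE_ext[of v "{..<k}" "\<lambda>_. carrier ?E" w])
        fix i assume "i \<in> {..<k}"
        then have i: "i < k" by simp
        have "fst (prod_decode (v i)) = fst (prod_decode (w i))"
          using fun_cong[OF vw(3), of "2 * i"] i by (simp add: unpack_def)
        moreover have "snd (prod_decode (v i)) = snd (prod_decode (w i))"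
          using fun_cong[OF vw(3), of "2 * i + 1"] i by (simp add: unpack_def)
        ultimately have "prod_decode (v i) = prod_decode (w i)" by (simp add: prod_eq_iff)
        then show "v i = w i" by (metis prod_decode_inverse)
      qed (use vw in \<open>simp_all add: coord_space_simps\<close>)
    qed
  next
    show "unpack k \<zero>\<^bsub>?V\<^esub> = \<zero>\<^bsub>?W\<^esub>"
      using half by (auto simp: unpack_def coord_space_simps intro!: restrict_ext)
  next
    fix s t v w assume st: "s \<in> carrier F" "t \<in> carrier F" and vw: "v \<in> carrier ?V" "w \<in> carrier ?V"
    show "unpack k (comb2 ?V (?i s) (?i t) v w) = comb2 ?W s t (unpack k v) (unpack k w)"
      unfolding comb2_def coord_space_simps unpack_def
    proof (rule restrict_ext)
      fix j assume "j \<in> {..<2 * k}"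
      then have j: "j < 2 * k" by simp
      obtain x y where xy: "x \<in> carrier F" "y \<in> carrier F" "v (j div 2) = prod_encode (x, y)"
        using comp[OF vw(1) half[OF j]] by blast
      obtain x' y' where xy': "x' \<in> carrier F" "y' \<in> carrier F" "w (j div 2) = prod_encode (x', y')"
        using comp[OF vw(2) half[OF j]] by blast
      show "(if even j then fst else snd) (prod_decode ((\<lambda>i\<in>{..<k}.
          (\<lambda>i\<in>{..<k}. ?i s \<otimes>\<^bsub>?E\<^esub> v i) i \<oplus>\<^bsub>?E\<^esub> (\<lambda>i\<in>{..<k}. ?i t \<otimes>\<^bsub>?E\<^esub> w i) i) (j div 2)))
        = (\<lambda>i\<in>{..<2 * k}. s \<otimes> (\<lambda>j\<in>{..<2 * k}. (if even j then fst else snd) (prod_decode (v (j div 2)))) i) j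
          \<oplus> (\<lambda>i\<in>{..<2 * k}. t \<otimes> (\<lambda>j\<in>{..<2 * k}. (if even j then fst else snd) (prod_decode (w (j div 2)))) i) j"
        using st xy xy' ab j half[OF j] by simp
    qed
  qed
  moreover have "card ?K = q" using bij_betw_same_card[OF bij] F(3) by simp
  ultimately show ?thesis by simp
qed

text \<open>The classes are single lines, so meeting is the condition with content, and any two
  lines of a projective plane meet. The lines used are z = a x + b y, which are those missing the
  point of (0, 0, 1); there are q^2 of them, exactly the number that starts the recursion.\<close>

lemma class_system_plane:
  fixes F (structure)
  assumes "is_GF q F"
  shows "\<exists>\<C>. class_system F (coord_space F 3) \<C> \<and> card \<C> = q\<^sup>2"
proof -
  have F: "field F" "finite (carrier F)" "card (carrier F) = q" using assms by (auto simp: is_GF_def)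
  interpret field F by fact
  let ?V = "coord_space F 3"
  interpret V: vecsp F ?V using vecsp_coord_space F(1) .
  define vec where "vec x y z = (\<lambda>i\<in>{..<3::nat}. if i = 0 then x else if i = 1 then y else z)" for x y z :: nat
  have vec_eq: "vec x y z = vec x' y' z' \<longleftrightarrow> x = x' \<and> y = y' \<and> z = z'" for x y z x' y' z'
  proof
    assume H: "vec x y z = vec x' y' z'"
    show "x = x' \<and> y = y' \<and> z = z'"
      using fun_cong[OF H, of 0] fun_cong[OF H, of 1] fun_cong[OF H, of 2] by (simp add: vec_def)
  qed simp
  have vec_closed: "vec x y z \<in> carrier ?V" if "x \<in> carrier F" "y \<in> carrier F" "z \<in> carrier F" for x y z
    using that by (auto simp: vec_def coord_space_simps)
  have vec_zero: "\<zero>\<^bsub>?V\<^esub> = vec \<zero> \<zero> \<zero>" by (auto simp: vec_def coord_space_simps intro!: restrict_ext)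
  have comb: "comb2 ?V s t (vec \<one> \<zero> a) (vec \<zero> \<one> b) = vec s t (s \<otimes> a \<oplus> t \<otimes> b)"
    if "s \<in> carrier F" "t \<in> carrier F" for s t a b
    unfolding comb2_def coord_space_simps vec_def by (rule restrict_ext) (use that in auto)
  define L where "L = (\<lambda>(a, b). span2 F ?V (vec \<one> \<zero> a) (vec \<zero> \<one> b))"
  have L: "L (a, b) = {vec s t (s \<otimes> a \<oplus> t \<otimes> b) | s t. s \<in> carrier F \<and> t \<in> carrier F}" for a b
    unfolding L_def span2_def using comb[of _ _ a b] by (auto; metis)
  let ?I = "carrier F \<times> carrier F"
  have line: "vline F ?V (L i)" if I: "i \<in> ?I" for i
  proof -
    obtain a b where i: "i = (a, b)" "a \<in> carrier F" "b \<in> carrier F" using I by auto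
    have "indep2 F ?V (vec \<one> \<zero> a) (vec \<zero> \<one> b)"
      unfolding indep2_def using comb vec_eq vec_zero by simp
    then show ?thesis
      unfolding vline_def L_def i(1) case_prod_conv using vec_closed i(2,3) one_closed zero_closed by blast
  qed
  have meet: "\<exists>v\<in>L i \<inter> L i'. v \<noteq> \<zero>\<^bsub>?V\<^esub>" if I: "i \<in> ?I" "i' \<in> ?I" for i i'
  proof -
    obtain a b a' b' where i: "i = (a, b)" "i' = (a', b')" and c: "a \<in> carrier F" "b \<in> carrier F"
      "a' \<in> carrier F" "b' \<in> carrier F" using I by auto
    show ?thesis
    proof (cases "i = i'")
      case True
      have "vec \<one> \<zero> (\<one> \<otimes> a \<oplus> \<zero> \<otimes> b) \<in> L (a, b)" unfolding L using one_closed zero_closed by blast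
      then have "vec \<one> \<zero> (\<one> \<otimes> a \<oplus> \<zero> \<otimes> b) \<in> L i \<inter> L i'" using True i by simp
      then show ?thesis using vec_zero vec_eq by (intro bexI) auto
    next
      case False
      \<comment> \<open>Equal third coordinates mean s (a - a') + t (b - b') = 0, and this is the
        obvious nonzero solution when the two lines differ.\<close>
      define s t where "s = b \<oplus> \<ominus> b'" and "t = a' \<oplus> \<ominus> a"
      have st: "s \<in> carrier F" "t \<in> carrier F" using c by (auto simp: s_def t_def)
      have eq: "s \<otimes> a \<oplus> t \<otimes> b = s \<otimes> a' \<oplus> t \<otimes> b'" unfolding s_def t_def using c by algebra
      have "vec s t (s \<otimes> a \<oplus> t \<otimes> b) \<in> L (a, b)" "vec s t (s \<otimes> a' \<oplus> t \<otimes> b') \<in> L (a', b')"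
        unfolding L using st by blast+
      then have "vec s t (s \<otimes> a \<oplus> t \<otimes> b) \<in> L i \<inter> L i'" unfolding i eq by simp
      moreover have "s \<noteq> \<zero> \<or> t \<noteq> \<zero>"
      proof (rule ccontr)
        assume "\<not> ?thesis"
        then have "b \<oplus> \<ominus> b' = \<zero>" "a' \<oplus> \<ominus> a = \<zero>" by (auto simp: s_def t_def)
        then have "b = b'" "a' = a" using c minus_equality by fastforce+
        then show False using False i by simp
      qed
      ultimately show ?thesis using vec_zero vec_eq by (intro bexI) auto
    qed
  qed
  have inj: "inj_on (\<lambda>i. {L i}) ?I"
  proof (rule inj_onI)
    fix i i' assume I: "i \<in> ?I" "i' \<in> ?I" "{L i} = {L i'}"
    obtain a b a' b' where i: "i = (a, b)" "i' = (a', b')" and c: "a \<in> carrier F" "b \<in> carrier F"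
      "a' \<in> carrier F" "b' \<in> carrier F" using I by auto
    have "vec \<one> \<zero> (\<one> \<otimes> a \<oplus> \<zero> \<otimes> b) \<in> L i" "vec \<zero> \<one> (\<zero> \<otimes> a \<oplus> \<one> \<otimes> b) \<in> L i"
      unfolding i L using one_closed zero_closed by blast+
    then have "vec \<one> \<zero> a \<in> L (a', b')" "vec \<zero> \<one> b \<in> L (a', b')" using I(3) i c by auto
    then show "i = i'" using i c unfolding L by (auto simp: vec_eq)
  qed
  let ?C = "(\<lambda>i. {L i}) ` ?I"
  have "class_system F ?V ?C"
    unfolding class_system_def using line meet by auto
  moreover have "card ?C = q\<^sup>2"
    using inj F(3) by (simp add: card_image card_cartesian_product power2_eq_square)
  ultimately show ?thesis by blast
qed

text \<open>The induction hypothesis is applied to the extension of order q^2, so \<open>q\<close>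
  and \<open>F\<close> must vary. The dimension over the extension is half of that over
  \<open>F\<close>, which produces the powers of two.\<close>

lemma class_system_exists:
  assumes "is_GF q F"
  shows "\<exists>\<C>. class_system F (coord_space F (3 * 2 ^ i)) \<C> \<and> card \<C> = q ^ (4 * 2 ^ i - 2)"
  using assms
proof (induction i arbitrary: q F)
  case 0
  then show ?case using class_system_plane by simp
next
  case (Suc i)
  have F: "field F" "finite (carrier F)" "card (carrier F) = q" using Suc.prems by (auto simp: is_GF_def)
  interpret field F by fact
  \<comment> \<open>The linear coefficient is \<open>\<one>\<close> because this works in every
    characteristic; with coefficient zero there would be no irreducible quadratic in characteristic
    two.\<close>
  obtain b where b: "b \<in> carrier F" "\<forall>x\<in>carrier F. x \<otimes>\<^bsub>F\<^esub> x \<noteq> \<one>\<^bsub>F\<^esub> \<otimes>\<^bsub>F\<^esub> x \<oplus>\<^bsub>F\<^esub> b"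
    using exists_irreducible_quadratic[of "carrier F" "\<one>\<^bsub>F\<^esub>"] F(2) by auto
  let ?E = "quad_ext F \<one>\<^bsub>F\<^esub> b"
  have "is_GF (q\<^sup>2) ?E" using is_GF_quad_ext Suc.prems b by simp
  from Suc.IH[OF this] obtain \<C> where
    \<C>: "class_system ?E (coord_space ?E (3 * 2 ^ i)) \<C>" "card \<C> = (q\<^sup>2) ^ (4 * 2 ^ i - 2)" by blast
  obtain \<C>' where \<C>': "class_system F (coord_space F (2 * (3 * 2 ^ i))) \<C>'" "card \<C>' = card \<C> * q\<^sup>2"
    using class_system_double[OF Suc.prems one_closed b(1) _ \<C>(1)] b(2) by auto
  \<comment> \<open>This keeps the truncated subtraction of 2 harmless in the recursion d' = 2 d + 2
    for the exponents.\<close>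
  have "(1::nat) \<le> 2 ^ i" by simp
  then have "2 * (4 * 2 ^ i - 2) + 2 = 4 * 2 ^ Suc i - (2::nat)" unfolding power_Suc by linarith
  then have "card \<C>' = q ^ (4 * 2 ^ Suc i - 2)"
    unfolding \<C>'(2) \<C>(2) by (metis power_add power_mult)
  then show ?case using \<C>'(1) by (auto simp: mult.left_commute)
qed

lemma class_system_achromatic:
  assumes "is_GF q F" "class_system F (coord_space F (n + 1)) \<C>"
  shows "card \<C> \<le> pg_achromatic_index F n"
proof -
  let ?M = "coord_space F (n + 1)"
  have F: "field F" "finite (carrier F)" using assms by (auto simp: is_GF_def)
  interpret vecsp F ?M using vecsp_coord_space F(1) .
  have finM: "finite (carrier ?M)" using finite_coord_space F(2) .
  have points: "pg_points F n = {p. subspace_of_dim F ?M 1 p}" unfolding pg_points_def ..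
  have lines: "pg_lines F n = {l. vline F ?M l}" unfolding pg_lines_def subspace_of_dim_2_iff ..
  note sysD = assms(2)[unfolded class_system_def]
  have sys1: "vline F ?M l" if "C \<in> \<C>" "l \<in> C" for C l
    using conjunct1[OF sysD] that by blast
  have sys2: "l = l'" if "C \<in> \<C>" "l \<in> C" "l' \<in> C" "v \<in> l \<inter> l'" "v \<noteq> \<zero>\<^bsub>?M\<^esub>" for C l l' v
    using conjunct1[OF conjunct2[OF sysD]] that by blast
  have sys3: "C = C'" if "C \<in> \<C>" "C' \<in> \<C>" "l \<in> C \<inter> C'" for C C' l
    using conjunct1[OF conjunct2[OF conjunct2[OF sysD]]] that by blast
  have sys4: "\<exists>l\<in>C. \<exists>l'\<in>C'. \<exists>v\<in>l \<inter> l'. v \<noteq> \<zero>\<^bsub>?M\<^esub>" if "C \<in> \<C>" "C' \<in> \<C>" for C C'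
    using conjunct2[OF conjunct2[OF conjunct2[OF sysD]]] that by blast
  have "class_family (pg_points F n) (pg_lines F n) \<C>"
    unfolding class_family_def
  proof (intro conjI ballI impI)
    show "pairwise disjnt \<C>"
      unfolding pairwise_def disjnt_def using sys3 by blast
    show "\<Union>\<C> \<subseteq> pg_lines F n" using sys1 by (auto simp: lines)
    show "{} \<notin> \<C>" using sys4 by blast
  next
    fix C l1 l2 assume C: "C \<in> \<C>" "l1 \<in> C" "l2 \<in> C" "l1 \<noteq> l2"
    then have "vline F ?M l1" "vline F ?M l2" using sys1 by blast+
    then show "\<not> share_point (pg_points F n) l1 l2"
      unfolding points using share_point_vlines_iff[of l1 l2] sys2[OF C(1-3)] C(4) by blast
  next
    fix C1 C2 assume C: "C1 \<in> \<C>" "C2 \<in> \<C>"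
    then obtain l1 l2 where l: "l1 \<in> C1" "l2 \<in> C2" "\<exists>v\<in>l1 \<inter> l2. v \<noteq> \<zero>\<^bsub>?M\<^esub>" using sys4 by blast
    then have "vline F ?M l1" "vline F ?M l2" using sys1 C by blast+
    then have "share_point (pg_points F n) l1 l2"
      unfolding points using share_point_vlines_iff[of l1 l2] l(3) by blast
    then show "\<exists>l1\<in>C1. \<exists>l2\<in>C2. share_point (pg_points F n) l1 l2" using l by blast
  qed
  moreover have "finite (pg_lines F n)" using finite_vlines[OF finM] by (simp add: lines)
  ultimately show ?thesis unfolding pg_achromatic_index_def by (rule achromatic_index_ge[rotated])
qed

section \<open>From the number of classes to the stated power of the order\<close>

lemma pg_achromatic_lower_bound:
  assumes "i \<ge> 1" "n = 3 * 2 ^ i - 1" "is_GF q F"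
  shows "1 / 2 powr (7 / 5) * (1 / real q) * pg_order n q powr (4 / 3 + 1 / (3 * real n))
    \<le> real (pg_achromatic_index F n)"
proof -
  define m :: nat where "m = 2 ^ i"
  have "(2::nat) ^ 1 \<le> 2 ^ i" using assms(1) by (intro power_increasing) auto
  then have m: "m \<ge> 2" by (simp add: m_def)
  have n: "n = 3 * m - 1" "n + 1 = 3 * 2 ^ i" using assms(2) m by (auto simp: m_def)
  have q: "real q \<ge> 2" using is_GF_card_ge_2[OF assms(3)] by simp
  obtain \<C> where "class_system F (coord_space F (n + 1)) \<C>" and \<C>: "card \<C> = q ^ (4 * m - 2)"
    using class_system_exists[OF assms(3), of i] unfolding n(2) m_def by blast
  then have k: "q ^ (4 * m - 2) \<le> pg_achromatic_index F n"
    using class_system_achromatic[OF assms(3)] by metis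
  define x where "x = 4 / 3 + 1 / (3 * real n)"
  have n5: "real n \<ge> 5" using n m by linarith
  have rn: "real n = 3 * real m - 1" using n m by linarith
  \<comment> \<open>From i >= 1 follows n >= 5, and the decreasing exponent equals 4/3 + 1/15 = 7/5
    at n = 5; this is the origin of the constant. The product n x is an integer, one more than the
    exponent of the number of classes.\<close>
  have x: "0 \<le> x" "x \<le> 7 / 5" "real n * x = 4 * real m - 1"
  proof -
    show "0 \<le> x" using n5 by (simp add: x_def)
    have "1 / (3 * real n) \<le> 1 / 15" using n5 by (simp add: field_simps)
    then show "x \<le> 7 / 5" by (simp add: x_def)
    have "real n * x = (4 * real n + 1) / 3" using n5 by (simp add: x_def field_simps)
    then show "real n * x = 4 * real m - 1" by (simp add: rn)
  qed
  have v: "0 \<le> pg_order n q" "pg_order n q \<le> 2 * real q ^ n"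
  proof -
    have "1 \<le> real q ^ (n + 1)" using q by (intro one_le_power) simp
    then show "0 \<le> pg_order n q" using q by (simp add: pg_order_def)
    \<comment> \<open>The estimate of the order by twice its leading power uses q >= 2, and its
      factor 2, raised to \<open>x\<close>, is the only loss paid for by the constant.\<close>
    have "2 * real q ^ n \<le> real q * real q ^ n" using q by (intro mult_right_mono) auto
    then have "real q ^ (n + 1) - 1 \<le> 2 * real q ^ n * (real q - 1)" by (simp add: algebra_simps)
    then show "pg_order n q \<le> 2 * real q ^ n" using q by (simp add: pg_order_def divide_le_eq)
  qed
  have "pg_order n q powr x \<le> (2 * real q ^ n) powr x"
    using v x by (intro powr_mono2) auto
  also have "\<dots> = 2 powr x * (real q powr real n) powr x"
    using q by (simp add: powr_mult powr_realpow)
  also have "(real q powr real n) powr x = real q powr (4 * real m - 1)"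
    by (simp add: powr_powr x(3))
  also have "2 powr x \<le> (2::real) powr (7 / 5)" using x by (intro powr_mono) auto
  also have "real q powr (4 * real m - 1) = real q * real q ^ (4 * m - 2)"
  proof -
    have "4 * real m - 1 = real (Suc (4 * m - 2))" using m by (simp add: of_nat_diff)
    then have "real q powr (4 * real m - 1) = real q ^ Suc (4 * m - 2)" using q by (metis powr_realpow less_le_trans zero_less_numeral)
    then show ?thesis by simp
  qed
  finally have "pg_order n q powr x \<le> 2 powr (7 / 5) * (real q * real q ^ (4 * m - 2))"
    by (simp add: mult_right_mono)
  then have "1 / 2 powr (7 / 5) * (1 / real q) * pg_order n q powr x
      \<le> 1 / 2 powr (7 / 5) * (1 / real q) * (2 powr (7 / 5) * (real q * real q ^ (4 * m - 2)))"
    by (intro mult_left_mono) auto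
  also have "\<dots> = real q ^ (4 * m - 2)" using q by simp
  also have "\<dots> \<le> real (pg_achromatic_index F n)" using k by (metis of_nat_le_iff of_nat_power)
  finally show ?thesis unfolding x_def .
qed

theorem theorem1:
  shows "(\<exists>c :: nat \<Rightarrow> real. \<forall>n\<ge>2. (\<exists>i\<ge>1. n = 3 * 2 ^ i - 1) \<longrightarrow>
            1 / 2 powr (7 / 5) \<le> c n \<and> c n < 1 / 2 powr (4 / 3) \<and>
            (\<forall>q F. primepow q \<and> is_GF q F \<longrightarrow>
               c n * (1 / real q) * pg_order n q powr (4 / 3 + 1 / (3 * real n))
                 \<le> real (pg_achromatic_index F n)))
       \<and> (\<forall>n\<ge>2. \<forall>q F. primepow q \<and> is_GF q F \<longrightarrow>
            real (pg_pseudoachromatic_index F n) \<le> (1 / real q) * pg_order n q powr (3 / 2))"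
proof (intro conjI exI[of _ "\<lambda>_. 1 / 2 powr (7 / 5)"] allI impI)
  \<comment> \<open>One constant serves all n; the strict upper bound amounts to 4/3 < 7/5.\<close>
  show "1 / 2 powr (7 / 5) < 1 / (2::real) powr (4 / 3)"
    by (intro divide_strict_left_mono powr_less_mono) auto
next
  fix n q :: nat and F assume "\<exists>i\<ge>1. n = 3 * 2 ^ i - 1" "primepow q \<and> is_GF q F"
  then show "1 / 2 powr (7 / 5) * (1 / real q) * pg_order n q powr (4 / 3 + 1 / (3 * real n))
      \<le> real (pg_achromatic_index F n)"
    using pg_achromatic_lower_bound by blast
next
  fix n q F assume "2 \<le> (n::nat)" "primepow q \<and> is_GF q F"
  then show "real (pg_pseudoachromatic_index F n) \<le> (1 / real q) * pg_order n q powr (3 / 2)"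
    using pg_pseudoachromatic_upper_bound by blast
qed simp

end
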